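(* Let $(X,g)$ be a compact Kähler manifold, $S$ a complex manifold, and $(F,h)\to X\times S$ a holomorphic hermitian vector bundle such that all $(F_s,h_s)$, $s\in S$, are simple holomorphic Hermite-Einstein bundles. Equip the bundle $\mathrm{End}(F)\to X\times S$ with the hermitian metric $\widetilde h$ induced by $h$. Then the fiberwise harmonic projections $H(\rho_{k\overline l})$ that belong to the family $(\mathrm{End}(F),\widetilde h)$ (i.e. those occurring in the curvature formula for the sheaves $R^qp_*\mathcal O(\mathrm{End}(F))$) vanish identically: $H(\widetilde\rho_{k\overline l})(s)=0$ for all $s\in S$ and all $k,l$, where $\widetilde\rho_{k\overline l}=R^{\widetilde h}_{k\overline l}$.
   Context: $F_s=F|_{X\times\{s\}}$, $h_s=h|_{F_s}$, $p:X\times S\to S$ is the projection. Hermite-Einstein means that the Chern curvature of $h_s$ satisfies $g^{\overline\beta\alpha}R^h_{\alpha\overline\beta}|_s=\lambda\cdot\mathrm{id}_{F_s}$ with $\lambda$ a constant. Simple means that the only holomorphic endomorphisms of $F_s$ are multiples of the identity. For a hermitian holomorphic bundle $(E,k_E)$ on $X\times S$ with Chern curvature form $\Omega^{k_E}$ on $X\times S$, and local holomorphic coordinates $(s^k)$ on $S$, the section $\partial_{\overline l}\lrcorner(\partial_k\lrcorner\,\Omega^{k_E})=R^{k_E}_{k\overline l}$ (the coefficient of $ds^k\wedge ds^{\overline l}$), restricted to $X\times\{s\}$, is a smooth section of $\mathrm{End}(E_s)$. For $(E,k_E)=(\mathrm{End}(F),\widetilde h)$ it is denoted $\widetilde\rho_{k\overline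 l}$; it is a section of $\mathrm{End}(\mathrm{End}(F_s))$. $H$ denotes the harmonic projection, i.e. $L_2$-orthogonal projection (with respect to $g$ and the metric induced by $h_s$) onto the kernel of $\Box=\overline\partial^*\overline\partial$ on sections of $\mathrm{End}(\mathrm{End}(F_s))$ over $X$. *)

theory Defs
  imports "HOL-Analysis.Analysis"
begin

section \<open>Functions of several complex variables\<close>

text \<open>The codomain is always \<^typ>\<open>complex\<close>; vector- and matrix-valued functions are treated entrywise.\<close>

definition holo_on :: "(complex^'n) set \<Rightarrow> (complex^'n \<Rightarrow> complex) \<Rightarrow> bool" where
  "holo_on Z f \<longleftrightarrow> (\<forall>z\<in>Z. \<exists>D. (f has_derivative D) (at z) \<and> (\<forall>v. D (\<i> *s v) = \<i> * D v))"

text \<open>On open sets, \<open>Ck_on k\<close> is real $k$-fold continuous differentiability.\<close>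

primrec Ck_on :: "nat \<Rightarrow> (complex^'n) set \<Rightarrow> (complex^'n \<Rightarrow> complex) \<Rightarrow> bool" where
  "Ck_on 0 Z f \<longleftrightarrow> continuous_on Z f"
| "Ck_on (Suc k) Z f \<longleftrightarrow>
     (\<forall>z\<in>Z. f differentiable (at z)) \<and> (\<forall>v. Ck_on k Z (\<lambda>z. frechet_derivative f (at z) v))"

definition smooth_on :: "(complex^'n) set \<Rightarrow> (complex^'n \<Rightarrow> complex) \<Rightarrow> bool" where
  "smooth_on Z f \<longleftrightarrow> (\<forall>k. Ck_on k Z f)"

text \<open>The Wirtinger derivatives $\partial/\partial z^i$ and $\partial/\partial\bar z^i$.\<close>

definition wirt :: "'n \<Rightarrow> (complex^'n \<Rightarrow> complex) \<Rightarrow> complex^'n \<Rightarrow> complex" where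
  "wirt i f z = (frechet_derivative f (at z) (axis i 1) - \<i> * frechet_derivative f (at z) (axis i \<i>)) / 2"

definition wirt_bar :: "'n \<Rightarrow> (complex^'n \<Rightarrow> complex) \<Rightarrow> complex^'n \<Rightarrow> complex" where
  "wirt_bar i f z = (frechet_derivative f (at z) (axis i 1) + \<i> * frechet_derivative f (at z) (axis i \<i>)) / 2"

definition mwirt :: "'n \<Rightarrow> (complex^'n \<Rightarrow> complex^'a^'b) \<Rightarrow> complex^'n \<Rightarrow> complex^'a^'b" where
  "mwirt i M z = (\<chi> a b. wirt i (\<lambda>z. M z $ a $ b) z)"

definition mwirt_bar :: "'n \<Rightarrow> (complex^'n \<Rightarrow> complex^'a^'b) \<Rightarrow> complex^'n \<Rightarrow> complex^'a^'b" where
  "mwirt_bar i M z = (\<chi> a b. wirt_bar i (\<lambda>z. M z $ a $ b) z)"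


section \<open>Hermitian linear algebra\<close>

definition cadj :: "complex^'a^'b \<Rightarrow> complex^'b^'a" where
  "cadj M = (\<chi> a b. cnj (M $ b $ a))"

text \<open>The sesquilinear form $w^* h v$ with matrix $h$, linear in the first argument \<open>v\<close>.\<close>

definition hinner :: "complex^'r^'r \<Rightarrow> complex^'r \<Rightarrow> complex^'r \<Rightarrow> complex" where
  "hinner h v w = (\<Sum>a\<in>UNIV. \<Sum>b\<in>UNIV. h $ a $ b * v $ b * cnj (w $ a))"

definition hermitian_posdef :: "complex^'r^'r \<Rightarrow> bool" where
  "hermitian_posdef h \<longleftrightarrow> cadj h = h \<and> (\<forall>v. v \<noteq> 0 \<longrightarrow> 0 < Re (hinner h v v))"

text \<open>Endomorphisms of $\mathbb C^r$ as elements of $\mathbb C^{r\times r}$.\<close>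

definition vec_of_mat :: "complex^'r^'r \<Rightarrow> complex^('r \<times> 'r)" where
  "vec_of_mat A = (\<chi> ab. A $ fst ab $ snd ab)"

definition mat_of_vec :: "complex^('r \<times> 'r) \<Rightarrow> complex^'r^'r" where
  "mat_of_vec v = (\<chi> a b. v $ (a, b))"


section \<open>Complex manifolds\<close>

text \<open>
  A manifold is a Hausdorff, second countable space (a type) with a holomorphic atlas, whose
  elements are pairs of a domain and a coordinate map; coordinate maps are irrelevant outside
  their domain.
\<close>

type_synonym ('p, 'n) cchart = "'p set \<times> ('p \<Rightarrow> complex^'n)"

definition complex_manifold ::
  "('p::{t2_space, second_countable_topology}, 'n::finite) cchart set \<Rightarrow> bool" where
  "complex_manifold A \<longleftrightarrow>
     (\<Union>(U, \<phi>)\<in>A. U) = UNIV \<and>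
     (\<forall>(U, \<phi>)\<in>A. open U \<and> open (\<phi> ` U) \<and> (\<exists>\<psi>. homeomorphism U (\<phi> ` U) \<phi> \<psi>)) \<and>
     (\<forall>(U, \<phi>)\<in>A. \<forall>(V, \<psi>)\<in>A. \<forall>i. holo_on (\<phi> ` (U \<inter> V)) (\<lambda>z. \<psi> (inv_into U \<phi> z) $ i))"

text \<open>All local holomorphic coordinate systems, i.e. the maximal atlas.\<close>

definition coordinates ::
  "('p::{t2_space, second_countable_topology}, 'n::finite) cchart set \<Rightarrow> ('p, 'n) cchart set" where
  "coordinates A = {c. complex_manifold (insert c A)}"

definition chart_at :: "('p, 'n) cchart set \<Rightarrow> 'p \<Rightarrow> ('p, 'n) cchart" where
  "chart_at A p = (SOME c. c \<in> A \<and> p \<in> fst c)"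

definition prod_chart ::
  "('x, 'n::finite) cchart \<Rightarrow> ('s, 'm::finite) cchart \<Rightarrow> ('x \<times> 's, 'n + 'm) cchart" where
  "prod_chart c d =
     (fst c \<times> fst d,
      \<lambda>(x, s). \<chi> i. case i of Inl a \<Rightarrow> snd c x $ a | Inr k \<Rightarrow> snd d s $ k)"

definition prod_atlas ::
  "('x, 'n::finite) cchart set \<Rightarrow> ('s, 'm::finite) cchart set \<Rightarrow> ('x \<times> 's, 'n + 'm) cchart set" where
  "prod_atlas A B = {prod_chart c d | c d. c \<in> A \<and> d \<in> B}"

definition holo_fun :: "('p, 'n::finite) cchart set \<Rightarrow> 'p set \<Rightarrow> ('p \<Rightarrow> complex) \<Rightarrow> bool" where
  "holo_fun A W f \<longleftrightarrow> (\<forall>(U, \<phi>)\<in>A. holo_on (\<phi> ` (U \<inter> W)) (f \<circ> inv_into U \<phi>))"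

definition smooth_fun :: "('p, 'n::finite) cchart set \<Rightarrow> 'p set \<Rightarrow> ('p \<Rightarrow> complex) \<Rightarrow> bool" where
  "smooth_fun A W f \<longleftrightarrow> (\<forall>(U, \<phi>)\<in>A. smooth_on (\<phi> ` (U \<inter> W)) (f \<circ> inv_into U \<phi>))"


section \<open>Kaehler metrics\<close>

text \<open>
  A hermitian metric is given by its coefficient matrices
  \<open>g c x $ \<alpha> $ \<beta>\<close> $= g_{\alpha\bar\beta}(x)$ in the charts \<open>c\<close> of the atlas; the last
  condition of \<open>hermitian_metric\<close> is the transformation rule of a tensor.
\<close>

type_synonym ('x, 'n) metric = "('x, 'n) cchart \<Rightarrow> 'x \<Rightarrow> complex^'n^'n"

definition hermitian_metric :: "('x, 'n::finite) cchart set \<Rightarrow> ('x, 'n) metric \<Rightarrow> bool" where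
  "hermitian_metric A g \<longleftrightarrow>
     (\<forall>c\<in>A. \<forall>x\<in>fst c. hermitian_posdef (g c x)) \<and>
     (\<forall>c\<in>A. \<forall>\<alpha> \<beta>. smooth_fun A (fst c) (\<lambda>x. g c x $ \<alpha> $ \<beta>)) \<and>
     (\<forall>c\<in>A. \<forall>c'\<in>A. \<forall>x\<in>fst c \<inter> fst c'. \<forall>\<alpha> \<beta>.
        let J = (\<lambda>\<gamma> \<alpha>. wirt \<alpha> (\<lambda>z. snd c' (inv_into (fst c) (snd c) z) $ \<gamma>) (snd c x))
        in g c x $ \<alpha> $ \<beta> = (\<Sum>\<gamma>\<in>UNIV. \<Sum>\<delta>\<in>UNIV. J \<gamma> \<alpha> * cnj (J \<delta> \<beta>) * g c' x $ \<gamma> $ \<delta>))"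

definition kaehler_metric :: "('x, 'n::finite) cchart set \<Rightarrow> ('x, 'n) metric \<Rightarrow> bool" where
  "kaehler_metric A g \<longleftrightarrow>
     hermitian_metric A g \<and>
     (\<forall>c\<in>A. \<forall>x\<in>fst c. \<forall>\<alpha> \<beta> \<gamma>.
        wirt \<gamma> (\<lambda>z. g c (inv_into (fst c) (snd c) z) $ \<alpha> $ \<beta>) (snd c x) =
        wirt \<alpha> (\<lambda>z. g c (inv_into (fst c) (snd c) z) $ \<gamma> $ \<beta>) (snd c x))"

text \<open>
  The measure of the volume form $\omega^n/n!$ for
  $\omega = \sqrt{-1}\,g_{\alpha\bar\beta}\,dz^\alpha\wedge dz^{\bar\beta}$, where
  $\sqrt{-1}\,dz\wedge d\bar z = 2\,dx\wedge dy$. The predicate determines the measure uniquely.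
\<close>

definition volume_measure ::
  "('x::topological_space, 'n::finite) cchart set \<Rightarrow> ('x, 'n) metric \<Rightarrow> 'x measure \<Rightarrow> bool" where
  "volume_measure A g vol \<longleftrightarrow>
     sets vol = sets borel \<and>
     (\<forall>c\<in>A. \<forall>B\<in>sets borel. B \<subseteq> fst c \<longrightarrow>
        emeasure vol B =
          (\<integral>\<^sup>+z. ennreal (2 ^ CARD('n) * Re (det (g c (inv_into (fst c) (snd c) z))))
               * indicator (snd c ` B) z \<partial>lborel))"


section \<open>Holomorphic vector bundles\<close>

text \<open>
  A rank $r$ bundle over \<open>'p\<close> is represented by a (non-topological) identification of each of
  its fibres with $\mathbb C^r$ together with an atlas of local frames \<open>(W, e)\<close>: the columns of the
  invertible matrix \<open>e p\<close> are the values at \<open>p \<in> W\<close> of a holomorphic frame. The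
  fibrewise identification carries no information (it need not be continuous in \<open>p\<close>); topology and
  holomorphic structure come from the frames alone, through their transition functions. Sections
  are then ordinary functions \<open>'p \<Rightarrow> complex^'r\<close>, hermitian metrics are matrix-valued
  functions, and sections of $\mathrm{End}(E)$ are functions \<open>'p \<Rightarrow> complex^'r^'r\<close>.
\<close>

type_synonym ('p, 'r) holo_frames = "('p set \<times> ('p \<Rightarrow> complex^'r^'r)) set"

definition holo_bundle ::
  "('p::topological_space, 'n::finite) cchart set \<Rightarrow> ('p, 'r::finite) holo_frames \<Rightarrow> bool" where
  "holo_bundle A E \<longleftrightarrow>
     (\<Union>(W, e)\<in>E. W) = UNIV \<and>
     (\<forall>(W, e)\<in>E. open W \<and> (\<forall>p\<in>W. invertible (e p))) \<and>
     (\<forall>(W, e)\<in>E. \<forall>(W', e')\<in>E. \<forall>a b.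
        holo_fun A (W \<inter> W') (\<lambda>p. (matrix_inv (e p) ** e' p) $ a $ b))"

definition frame_at :: "('p, 'r) holo_frames \<Rightarrow> 'p \<Rightarrow> 'p \<Rightarrow> complex^'r^'r" where
  "frame_at E p = snd (SOME We. We \<in> E \<and> p \<in> fst We)"

definition holo_section ::
  "('p, 'n::finite) cchart set \<Rightarrow> ('p, 'r::finite) holo_frames \<Rightarrow> ('p \<Rightarrow> complex^'r) \<Rightarrow> bool" where
  "holo_section A E u \<longleftrightarrow>
     (\<forall>(W, e)\<in>E. \<forall>a. holo_fun A W (\<lambda>p. (matrix_inv (e p) *v u p) $ a))"

definition smooth_section ::
  "('p, 'n::finite) cchart set \<Rightarrow> ('p, 'r::finite) holo_frames \<Rightarrow> ('p \<Rightarrow> complex^'r) \<Rightarrow> bool" where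
  "smooth_section A E u \<longleftrightarrow>
     (\<forall>(W, e)\<in>E. \<forall>a. smooth_fun A W (\<lambda>p. (matrix_inv (e p) *v u p) $ a))"

text \<open>The Gram matrix of the frame \<open>e\<close>: the \<open>(a, b)\<close> entry is $\langle e_b, e_a\rangle$.\<close>

definition gram :: "('p \<Rightarrow> complex^'r^'r) \<Rightarrow> ('p \<Rightarrow> complex^'r^'r) \<Rightarrow> 'p \<Rightarrow> complex^'r^'r" where
  "gram e h p = cadj (e p) ** h p ** e p"

definition bundle_metric ::
  "('p, 'n::finite) cchart set \<Rightarrow> ('p, 'r::finite) holo_frames \<Rightarrow> ('p \<Rightarrow> complex^'r^'r) \<Rightarrow> bool" where
  "bundle_metric A E h \<longleftrightarrow>
     (\<forall>p. hermitian_posdef (h p)) \<and>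
     (\<forall>(W, e)\<in>E. \<forall>a b. smooth_fun A W (\<lambda>p. gram e h p $ a $ b))"

text \<open>
  With $G$ the Gram matrix of a holomorphic frame, the Chern connection form is
  $\theta = G^{-1}\partial G$ and the curvature form is $\Omega = \bar\partial\theta$, so the
  coefficient of $dz^i\wedge dz^{\bar j}$ in $\Omega$ is
  $R_{i\bar j} = -\partial_{\bar j}(G^{-1}\partial_i G)$ in that frame. Conjugation by \<open>e p\<close> turns
  it into an endomorphism of the fibre at \<open>p\<close>, independent of the frame.
\<close>

definition chern_curvature ::
  "('p, 'n::finite) cchart \<Rightarrow> ('p, 'r::finite) holo_frames \<Rightarrow> ('p \<Rightarrow> complex^'r^'r)
     \<Rightarrow> 'n \<Rightarrow> 'n \<Rightarrow> 'p \<Rightarrow> complex^'r^'r" where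
  "chern_curvature c E h i j p =
     (let e = frame_at E p;
          G = (\<lambda>z. gram e h (inv_into (fst c) (snd c) z));
          \<theta> = (\<lambda>z. matrix_inv (G z) ** mwirt i G z)
      in e p ** (- mwirt_bar j \<theta> (snd c p)) ** matrix_inv (e p))"

text \<open>
  The frame of $\mathrm{End}(E)$ induced by \<open>e\<close> is the image of the elementary matrices
  under conjugation by \<open>e\<close>.
\<close>

definition End_bundle :: "('p, 'r::finite) holo_frames \<Rightarrow> ('p, 'r \<times> 'r) holo_frames" where
  "End_bundle E =
     (\<lambda>(W, e). (W, \<lambda>p. matrix (\<lambda>v. vec_of_mat (e p ** mat_of_vec v ** matrix_inv (e p))))) ` E"

text \<open>
  The induced metric is $\langle A, B\rangle = \mathrm{tr}(A B^{*})$, where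
  $B^{*} = h^{-1}\,\overline{B}^{\,t} h$ is the adjoint with respect to $h$.
\<close>

definition End_inner :: "complex^'r^'r \<Rightarrow> complex^'r^'r \<Rightarrow> complex^'r^'r \<Rightarrow> complex" where
  "End_inner h A B = trace (A ** (matrix_inv h ** cadj B ** h))"

definition End_metric ::
  "('p \<Rightarrow> complex^'r::finite^'r) \<Rightarrow> 'p \<Rightarrow> complex^('r \<times> 'r)^('r \<times> 'r)" where
  "End_metric h p =
     (\<chi> I J. End_inner (h p) (mat_of_vec (axis J 1)) (mat_of_vec (axis I 1)))"

text \<open>Restriction of a bundle and of a metric on $X\times S$ to $X\times\{s\}\cong X$.\<close>

definition restr_bundle :: "('x \<times> 's, 'r) holo_frames \<Rightarrow> 's \<Rightarrow> ('x, 'r) holo_frames" where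
  "restr_bundle F s = (\<lambda>(W, e). ({x. (x, s) \<in> W}, \<lambda>x. e (x, s))) ` F"

definition restr_metric :: "('x \<times> 's \<Rightarrow> 'b) \<Rightarrow> 's \<Rightarrow> 'x \<Rightarrow> 'b" where
  "restr_metric h s x = h (x, s)"

definition simple_bundle ::
  "('x, 'n::finite) cchart set \<Rightarrow> ('x, 'r::finite) holo_frames \<Rightarrow> bool" where
  "simple_bundle A E \<longleftrightarrow>
     (\<forall>u. holo_section A (End_bundle E) (\<lambda>x. vec_of_mat (u x)) \<longrightarrow> (\<exists>c. \<forall>x. u x = mat c))"

definition hermite_einstein ::
  "('x, 'n::finite) cchart set \<Rightarrow> ('x, 'n) metric \<Rightarrow> ('x, 'r::finite) holo_frames
     \<Rightarrow> ('x \<Rightarrow> complex^'r^'r) \<Rightarrow> bool" where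
  "hermite_einstein A g E h \<longleftrightarrow>
     (\<exists>\<kappa>. \<forall>c\<in>A. \<forall>x\<in>fst c.
        (\<Sum>\<alpha>\<in>UNIV. \<Sum>\<beta>\<in>UNIV.
           mat (matrix_inv (g c x) $ \<beta> $ \<alpha>) ** chern_curvature c E h \<alpha> \<beta> x) = mat \<kappa>)"


section \<open>Harmonic sections and the harmonic projection\<close>

definition L2_inner ::
  "'x measure \<Rightarrow> ('x \<Rightarrow> complex^'r^'r) \<Rightarrow> ('x \<Rightarrow> complex^'r) \<Rightarrow> ('x \<Rightarrow> complex^'r) \<Rightarrow> complex" where
  "L2_inner vol h u w = (LINT x|vol. hinner (h x) (u x) (w x))"

text \<open>
  Bundle-valued \<open>(0,1)\<close>-forms $\eta = \eta_{\bar\beta}\,dz^{\bar\beta}$ are given by their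
  coefficients \<open>\<eta> c x \<beta>\<close> in the charts \<open>c\<close>.
\<close>

type_synonym ('x, 'n, 'r) form01 = "('x, 'n) cchart \<Rightarrow> 'x \<Rightarrow> 'n \<Rightarrow> complex^'r"

definition dbar :: "('x, 'r::finite) holo_frames \<Rightarrow> ('x \<Rightarrow> complex^'r) \<Rightarrow> ('x, 'n::finite, 'r) form01" where
  "dbar E u c x \<beta> =
     (let e = frame_at E x; \<psi> = inv_into (fst c) (snd c)
      in e x *v (\<chi> a. wirt_bar \<beta> (\<lambda>z. (matrix_inv (e (\<psi> z)) *v u (\<psi> z)) $ a) (snd c x)))"

text \<open>
  $\langle\eta,\xi\rangle = g^{\bar\beta\alpha}\langle\eta_{\bar\beta},\xi_{\bar\alpha}\rangle$;
  the value does not depend on the chart.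
\<close>

definition L2_inner_form ::
  "('x, 'n::finite) cchart set \<Rightarrow> ('x, 'n) metric \<Rightarrow> 'x measure \<Rightarrow> ('x \<Rightarrow> complex^'r^'r)
     \<Rightarrow> ('x, 'n, 'r) form01 \<Rightarrow> ('x, 'n, 'r) form01 \<Rightarrow> complex" where
  "L2_inner_form A g vol h \<eta> \<xi> =
     (LINT x|vol. (let c = chart_at A x in
        \<Sum>\<alpha>\<in>UNIV. \<Sum>\<beta>\<in>UNIV. matrix_inv (g c x) $ \<beta> $ \<alpha> * hinner (h x) (\<eta> c x \<beta>) (\<xi> c x \<alpha>)))"

text \<open>
  The formal adjoint of $\bar\partial$ and the Laplacian $\Box = \bar\partial^*\bar\partial$ as
  (single-valued) relations: \<open>dbar_adjoint \<dots> \<eta> v\<close> says $\bar\partial^*\eta = v$.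
\<close>

definition dbar_adjoint ::
  "('x, 'n::finite) cchart set \<Rightarrow> ('x, 'n) metric \<Rightarrow> 'x measure \<Rightarrow> ('x, 'r::finite) holo_frames
     \<Rightarrow> ('x \<Rightarrow> complex^'r^'r) \<Rightarrow> ('x, 'n, 'r) form01 \<Rightarrow> ('x \<Rightarrow> complex^'r) \<Rightarrow> bool" where
  "dbar_adjoint A g vol E h \<eta> v \<longleftrightarrow>
     smooth_section A E v \<and>
     (\<forall>w. smooth_section A E w \<longrightarrow> L2_inner vol h v w = L2_inner_form A g vol h \<eta> (dbar E w))"

definition box ::
  "('x, 'n::finite) cchart set \<Rightarrow> ('x, 'n) metric \<Rightarrow> 'x measure \<Rightarrow> ('x, 'r::finite) holo_frames
     \<Rightarrow> ('x \<Rightarrow> complex^'r^'r) \<Rightarrow> ('x \<Rightarrow> complex^'r) \<Rightarrow> ('x \<Rightarrow> complex^'r) \<Rightarrow> bool" where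
  "box A g vol E h u v \<longleftrightarrow> smooth_section A E u \<and> dbar_adjoint A g vol E h (dbar E u) v"

definition ker_box ::
  "('x, 'n::finite) cchart set \<Rightarrow> ('x, 'n) metric \<Rightarrow> 'x measure \<Rightarrow> ('x, 'r::finite) holo_frames
     \<Rightarrow> ('x \<Rightarrow> complex^'r^'r) \<Rightarrow> ('x \<Rightarrow> complex^'r) set" where
  "ker_box A g vol E h = {u. box A g vol E h u (\<lambda>_. 0)}"

definition harmonic_projection ::
  "('x, 'n::finite) cchart set \<Rightarrow> ('x, 'n) metric \<Rightarrow> 'x measure \<Rightarrow> ('x, 'r::finite) holo_frames
     \<Rightarrow> ('x \<Rightarrow> complex^'r^'r) \<Rightarrow> ('x \<Rightarrow> complex^'r) \<Rightarrow> 'x \<Rightarrow> complex^'r" where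
  "harmonic_projection A g vol E h \<rho> =
     (THE u. u \<in> ker_box A g vol E h \<and>
        (\<forall>w\<in>ker_box A g vol E h. L2_inner vol h (\<lambda>x. \<rho> x - u x) w = 0))"

text \<open>
  The component $R_{k\bar l}$ of the curvature on $X\times S$ in the directions of the coordinates
  \<open>d\<close> on $S$, restricted to $X\times\{s\}$. It does not depend on the chart of $X$.
\<close>

definition rho ::
  "('x, 'n::finite) cchart set \<Rightarrow> ('s, 'm::finite) cchart \<Rightarrow> ('x \<times> 's, 'r::finite) holo_frames
     \<Rightarrow> ('x \<times> 's \<Rightarrow> complex^'r^'r) \<Rightarrow> 'm \<Rightarrow> 'm \<Rightarrow> 's \<Rightarrow> 'x \<Rightarrow> complex^'r^'r" where
  "rho A d E h k l s x =
     chern_curvature (prod_chart (chart_at A x) d) E h (Inr k) (Inr l) (x, s)"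

end

theory Submission
  imports Defs "HOL-Complex_Analysis.Cauchy_Integral_Formula"
begin

text \<open>
  The curvature of $\mathrm{End}(F)$ acts by commutators, $\widetilde\rho_{k\bar l} = \mathrm{ad}(R^h_{k\bar l})$,
  and the image of $\mathrm{ad}$ is pointwise orthogonal to every harmonic section $T$ of
  $\mathrm{End}(\mathrm{End}(F_s))$. Indeed $T$ is holomorphic, and since the mean curvature of
  $\mathrm{End}(\mathrm{End}(F_s))$ vanishes, the Bochner formula reads
  $g^{\bar\beta\alpha}\partial_\alpha\partial_{\bar\beta}|T|^2 = |\nabla' T|^2 \ge 0$. By the strong maximum principle
  $|T|^2$ is constant, so $T$ is parallel. Hence the endomorphism $\sigma$ determined by
  $\mathrm{tr}(M\sigma) = \langle \mathrm{ad}(M), T\rangle$ is a holomorphic section of $\mathrm{End}(F_s)$, so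
  $\sigma = c\cdot\mathrm{id}$ by simplicity, and $M = \mathrm{id}$ gives $c = 0$ because $\mathrm{ad}(\mathrm{id}) = 0$.
\<close>

section \<open>Wirtinger calculus\<close>

text \<open>The maximum principle takes the place of integrating the Bochner formula over X, so the
  argument stays inside single charts and frames. Hodge decomposition is avoided too: orthogonality
  is proved pointwise and for every matrix M, so all that is asked of rho is to be some ad(M) at
  each point; 0 then has the property that defines the harmonic projection, and testing a second
  candidate against itself gives uniqueness. The mean curvature vanishes because ad annihilates the
  multiple of the identity in the Hermite-Einstein condition, already on End(F_s). Parallelism is
  used in this form: G t is antiholomorphic, for G the Gram matrix and t the coordinates of T in a
  holomorphic frame. Hence pairing ad of a holomorphic endomorphism with T gives a holomorphic
  function, which is why sigma is holomorphic. Holomorphy is defined by mere complex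
  differentiability, yet chart changes and transition matrices are differentiated repeatedly, so
  smoothness of holomorphic functions has to be established early.\<close>

lemma vec_axis_decomp:
  fixes w :: "complex^'n"
  shows "w = (\<Sum>i\<in>UNIV. Re (w$i) *\<^sub>R axis i 1 + Im (w$i) *\<^sub>R axis i \<i>)"
proof -
  have "(\<Sum>i\<in>UNIV. Re (w$i) *\<^sub>R axis i 1 + Im (w$i) *\<^sub>R axis i \<i>) $ j = w $ j" for j
  proof -
    have "(\<Sum>i\<in>UNIV. Re (w$i) *\<^sub>R axis i 1 + Im (w$i) *\<^sub>R axis i \<i>) $ j
        = (\<Sum>i\<in>UNIV. if i = j then w $ j else 0)"
      unfolding sum_component by (rule sum.cong) (auto simp: axis_def complex_eq_iff)
    then show ?thesis by simp
  qed
  then show ?thesis by (simp add: vec_eq_iff)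
qed

text \<open>Splits a real-linear functional into its complex-linear and antilinear parts. For a
  Frechet derivative the two coefficients are the Wirtinger derivatives, so chain rule and
  Cauchy-Riemann equations become sums over coordinates.\<close>

lemma real_linear_decomp:
  fixes L :: "complex^'n \<Rightarrow> complex"
  assumes "linear L"
  shows "L w = (\<Sum>i\<in>UNIV. w$i * ((L (axis i 1) - \<i> * L (axis i \<i>)) / 2)
                 + cnj (w$i) * ((L (axis i 1) + \<i> * L (axis i \<i>)) / 2))"
proof -
  have "L w = L (\<Sum>i\<in>UNIV. Re (w$i) *\<^sub>R axis i 1 + Im (w$i) *\<^sub>R axis i \<i>)"
    using arg_cong[OF vec_axis_decomp[of w], of L] .
  also have "\<dots> = (\<Sum>i\<in>UNIV. Re (w$i) *\<^sub>R L (axis i 1) + Im (w$i) *\<^sub>R L (axis i \<i>))"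
    by (simp only: linear_sum[OF assms] linear_add[OF assms] linear_scale[OF assms])
  also have "\<dots> = (\<Sum>i\<in>UNIV. w$i * ((L (axis i 1) - \<i> * L (axis i \<i>)) / 2)
                 + cnj (w$i) * ((L (axis i 1) + \<i> * L (axis i \<i>)) / 2))"
  proof (intro sum.cong refl)
    have "Re c *\<^sub>R a + Im c *\<^sub>R b = c * ((a - \<i> * b) / 2) + cnj c * ((a + \<i> * b) / 2)" for a b c :: complex
    proof -
      have "c * ((a - \<i> * b) / 2) + cnj c * ((a + \<i> * b) / 2)
          = ((c + cnj c) / 2) * a + (\<i> * ((cnj c - c) / 2)) * b"
        by (simp add: algebra_simps diff_divide_distrib add_divide_distrib)
      also have "(c + cnj c) / 2 = of_real (Re c)" by (simp add: complex_add_cnj)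
      also have "\<i> * ((cnj c - c) / 2) = of_real (Im c)" by (simp add: complex_eq_iff)
      finally show ?thesis by (simp only: scaleR_conv_of_real)
    qed
    then show "Re (w$i) *\<^sub>R L (axis i 1) + Im (w$i) *\<^sub>R L (axis i \<i>) =
      w$i * ((L (axis i 1) - \<i> * L (axis i \<i>)) / 2)
                 + cnj (w$i) * ((L (axis i 1) + \<i> * L (axis i \<i>)) / 2)" for i .
  qed
  finally show ?thesis .
qed

lemma wirt_eqI:
  assumes "(f has_derivative D) (at z)"
  shows "wirt i f z = (D (axis i 1) - \<i> * D (axis i \<i>)) / 2"
    and "wirt_bar i f z = (D (axis i 1) + \<i> * D (axis i \<i>)) / 2"
  using frechet_derivative_at[OF assms] by (simp_all add: wirt_def wirt_bar_def)

lemma frechet_wirt: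
  assumes "f differentiable (at z)"
  shows "frechet_derivative f (at z) w = (\<Sum>i\<in>UNIV. w$i * wirt i f z + cnj (w$i) * wirt_bar i f z)"
  unfolding wirt_def wirt_bar_def
  by (rule real_linear_decomp)
    (use assms frechet_derivative_works has_derivative_linear in blast)

text \<open>\<open>frechet_derivative\<close> chooses from the set of derivatives at
  \<open>z\<close>, and both functions have the same set, possibly empty.\<close>

lemma frechet_derivative_cong_open:
  assumes "open Z" "z \<in> Z" "\<And>y. y \<in> Z \<Longrightarrow> f y = g y"
  shows "frechet_derivative f (at z) = frechet_derivative g (at z)"
proof -
  have "(f has_derivative D) (at z) \<longleftrightarrow> (g has_derivative D) (at z)" for D
    using assms by (metis has_derivative_transform_within_open)
  then show ?thesis by (simp add: frechet_derivative_def)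
qed

lemma differentiable_cong_open:
  assumes "open Z" "z \<in> Z" "\<And>y. y \<in> Z \<Longrightarrow> f y = g y"
  shows "f differentiable (at z) \<longleftrightarrow> g differentiable (at z)"
  using assms unfolding differentiable_def by (metis has_derivative_transform_within_open)

lemma wirt_cong:
  assumes "open Z" "z \<in> Z" "\<And>y. y \<in> Z \<Longrightarrow> f y = g y"
  shows "wirt i f z = wirt i g z" "wirt_bar i f z = wirt_bar i g z"
  by (simp_all add: wirt_def wirt_bar_def frechet_derivative_cong_open[OF assms])

lemma wirt_const [simp]: "wirt i (\<lambda>z. c) z = 0" "wirt_bar i (\<lambda>z. c) z = 0"
  by (simp_all add: wirt_def wirt_bar_def)

lemma wirt_add:
  assumes "f differentiable (at z)" "g differentiable (at z)"
  shows "wirt i (\<lambda>z. f z + g z) z = wirt i f z + wirt i g z"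
    and "wirt_bar i (\<lambda>z. f z + g z) z = wirt_bar i f z + wirt_bar i g z"
proof -
  note d = has_derivative_add[OF assms[unfolded frechet_derivative_works]]
  show "wirt i (\<lambda>z. f z + g z) z = wirt i f z + wirt i g z"
    and "wirt_bar i (\<lambda>z. f z + g z) z = wirt_bar i f z + wirt_bar i g z"
    by (simp_all add: wirt_eqI[OF d]) (simp_all add: wirt_def wirt_bar_def field_simps)
qed

lemma wirt_mult:
  assumes "f differentiable (at z)" "g differentiable (at z)"
  shows "wirt i (\<lambda>z. f z * g z) z = wirt i f z * g z + f z * wirt i g z"
    and "wirt_bar i (\<lambda>z. f z * g z) z = wirt_bar i f z * g z + f z * wirt_bar i g z"
proof -
  note d = has_derivative_mult[OF assms[unfolded frechet_derivative_works]]
  show "wirt i (\<lambda>z. f z * g z) z = wirt i f z * g z + f z * wirt i g z"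
    and "wirt_bar i (\<lambda>z. f z * g z) z = wirt_bar i f z * g z + f z * wirt_bar i g z"
    by (simp_all add: wirt_eqI[OF d]) (simp_all add: wirt_def wirt_bar_def field_simps)
qed

lemma wirt_cmult:
  fixes f :: "complex^'n \<Rightarrow> complex"
  assumes "f differentiable (at z)"
  shows "wirt i (\<lambda>z. c * f z) z = c * wirt i f z"
    and "wirt_bar i (\<lambda>z. c * f z) z = c * wirt_bar i f z"
  using wirt_mult[OF differentiable_const[of c] assms] by simp_all

lemma wirt_minus:
  assumes "f differentiable (at z)"
  shows "wirt i (\<lambda>z. - f z) z = - wirt i f z"
    and "wirt_bar i (\<lambda>z. - f z) z = - wirt_bar i f z"
  using wirt_cmult[OF assms, where c = "-1"] by simp_all

lemma has_derivative_cnj_comp: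
  "(f has_derivative D) (at z) \<Longrightarrow> ((\<lambda>z. cnj (f z)) has_derivative (\<lambda>v. cnj (D v))) (at z)"
  by (rule bounded_linear.has_derivative[OF bounded_linear_cnj])

lemma differentiable_cnj:
  "f differentiable (at z) \<Longrightarrow> (\<lambda>z. cnj (f z)) differentiable (at z)"
  unfolding differentiable_def using has_derivative_cnj_comp by blast

lemma wirt_cnj:
  assumes "f differentiable (at z)"
  shows "wirt i (\<lambda>z. cnj (f z)) z = cnj (wirt_bar i f z)"
    and "wirt_bar i (\<lambda>z. cnj (f z)) z = cnj (wirt i f z)"
proof -
  note d = has_derivative_cnj_comp[OF assms[unfolded frechet_derivative_works]]
  show "wirt i (\<lambda>z. cnj (f z)) z = cnj (wirt_bar i f z)"
    and "wirt_bar i (\<lambda>z. cnj (f z)) z = cnj (wirt i f z)"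
    by (simp_all add: wirt_eqI[OF d]) (simp_all add: wirt_def wirt_bar_def)
qed

lemma differentiable_sum_fun:
  fixes f :: "'k \<Rightarrow> 'a::real_normed_vector \<Rightarrow> 'b::real_normed_vector"
  shows "(\<And>k. k \<in> K \<Longrightarrow> f k differentiable (at z)) \<Longrightarrow> (\<lambda>z. \<Sum>k\<in>K. f k z) differentiable (at z)"
  by (induction K rule: infinite_finite_induct) auto

lemma wirt_sum:
  assumes "\<And>k. k \<in> K \<Longrightarrow> f k differentiable (at z)"
  shows "wirt i (\<lambda>z. \<Sum>k\<in>K. f k z) z = (\<Sum>k\<in>K. wirt i (f k) z)"
    and "wirt_bar i (\<lambda>z. \<Sum>k\<in>K. f k z) z = (\<Sum>k\<in>K. wirt_bar i (f k) z)"
  using assms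
  by (induction K rule: infinite_finite_induct)
    (simp_all add: wirt_add differentiable_sum_fun)

lemma has_derivative_vecI:
  fixes \<phi> :: "'a::real_normed_vector \<Rightarrow> complex^'n"
  assumes "\<And>k. ((\<lambda>z. \<phi> z $ k) has_derivative D k) (at z)"
  shows "(\<phi> has_derivative (\<lambda>v. \<chi> k. D k v)) (at z)"
proof -
  have "((\<lambda>z. \<Sum>k\<in>UNIV. axis k (\<phi> z $ k)) has_derivative (\<lambda>v. \<Sum>k\<in>UNIV. axis k (D k v))) (at z)"
  proof (rule has_derivative_sum)
    fix k
    have "linear (axis k :: complex \<Rightarrow> complex^'n)"
      by (rule linearI) (simp_all add: vec_eq_iff axis_def)
    then have "bounded_linear (axis k :: complex \<Rightarrow> complex^'n)"
      by (simp add: linear_conv_bounded_linear)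
    from bounded_linear.has_derivative[OF this assms]
    show "((\<lambda>z. axis k (\<phi> z $ k)) has_derivative (\<lambda>v. axis k (D k v))) (at z)" .
  qed
  moreover have "(\<Sum>k\<in>UNIV. axis k (u k)) = (\<chi> k. u k)" for u :: "'n \<Rightarrow> complex"
    by (simp add: vec_eq_iff axis_def if_distrib cong: if_cong)
  ultimately show ?thesis by simp
qed

lemma frechet_compose:
  fixes f :: "complex^'n \<Rightarrow> complex" and \<phi> :: "complex^'m \<Rightarrow> complex^'n"
  assumes f: "f differentiable (at (\<phi> z))" and \<phi>: "\<And>k. (\<lambda>z. \<phi> z $ k) differentiable (at z)"
  shows "(\<lambda>z. f (\<phi> z)) differentiable (at z)"
    and "frechet_derivative (\<lambda>z. f (\<phi> z)) (at z) v =
      (\<Sum>k\<in>UNIV. frechet_derivative (\<lambda>z. \<phi> z $ k) (at z) v * wirt k f (\<phi> z)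
         + cnj (frechet_derivative (\<lambda>z. \<phi> z $ k) (at z) v) * wirt_bar k f (\<phi> z))"
proof -
  have 1: "(\<phi> has_derivative (\<lambda>v. \<chi> k. frechet_derivative (\<lambda>z. \<phi> z $ k) (at z) v)) (at z)"
    by (rule has_derivative_vecI) (simp add: \<phi> frechet_derivative_works[symmetric])
  have 2: "((\<lambda>z. f (\<phi> z)) has_derivative
      (\<lambda>v. frechet_derivative f (at (\<phi> z)) (\<chi> k. frechet_derivative (\<lambda>z. \<phi> z $ k) (at z) v))) (at z)"
    using diff_chain_at[OF 1, of f "frechet_derivative f (at (\<phi> z))"] f
    by (simp add: o_def frechet_derivative_works)
  show "(\<lambda>z. f (\<phi> z)) differentiable (at z)" using 2 by (auto simp: differentiable_def)
  show "frechet_derivative (\<lambda>z. f (\<phi> z)) (at z) v =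
      (\<Sum>k\<in>UNIV. frechet_derivative (\<lambda>z. \<phi> z $ k) (at z) v * wirt k f (\<phi> z)
         + cnj (frechet_derivative (\<lambda>z. \<phi> z $ k) (at z) v) * wirt_bar k f (\<phi> z))"
    by (simp add: frechet_derivative_at[OF 2, symmetric] frechet_wirt[OF f])
qed

section \<open>Holomorphic functions and the Cauchy-Riemann equations\<close>

lemma holo_on_iff:
  "holo_on Z f \<longleftrightarrow> (\<forall>z\<in>Z. f differentiable (at z) \<and> (\<forall>i. wirt_bar i f z = 0))"
proof
  assume H: "holo_on Z f"
  show "\<forall>z\<in>Z. f differentiable (at z) \<and> (\<forall>i. wirt_bar i f z = 0)"
  proof (intro ballI conjI allI)
    fix z i assume "z \<in> Z"
    with H obtain D where D: "(f has_derivative D) (at z)" "\<And>v. D (\<i> *s v) = \<i> * D v"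
      unfolding holo_on_def by blast
    then show "f differentiable (at z)" unfolding differentiable_def by blast
    have "axis i \<i> = \<i> *s (axis i 1 :: complex^'a)" by (simp add: vec_eq_iff axis_def)
    then have "D (axis i \<i>) = \<i> * D (axis i 1)" by (simp only: D(2))
    then show "wirt_bar i f z = 0" unfolding wirt_eqI[OF D(1)] by simp
  qed
next
  assume H: "\<forall>z\<in>Z. f differentiable (at z) \<and> (\<forall>i. wirt_bar i f z = 0)"
  show "holo_on Z f" unfolding holo_on_def
  proof
    fix z assume "z \<in> Z"
    with H have d: "f differentiable (at z)" and w: "\<And>i. wirt_bar i f z = 0" by auto
    have "frechet_derivative f (at z) (\<i> *s v) = \<i> * frechet_derivative f (at z) v" for v
      unfolding frechet_wirt[OF d] by (simp only: w mult_zero_right add_0_right vector_smult_component mult.assoc sum_distrib_left)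
    with d show "\<exists>D. (f has_derivative D) (at z) \<and> (\<forall>v. D (\<i> *s v) = \<i> * D v)"
      by (intro exI[of _ "frechet_derivative f (at z)"] conjI allI) (simp_all only: frechet_derivative_works[symmetric])
  qed
qed

lemma holo_on_subset: "holo_on Z f \<Longrightarrow> Y \<subseteq> Z \<Longrightarrow> holo_on Y f"
  by (auto simp: holo_on_def)

lemma holo_on_cong_open:
  assumes "open Z" "\<And>y. y \<in> Z \<Longrightarrow> f y = g y"
  shows "holo_on Z f \<longleftrightarrow> holo_on Z g"
  unfolding holo_on_iff
  using differentiable_cong_open[OF assms(1) _ assms(2)] wirt_cong(2)[OF assms(1) _ assms(2)] by auto

lemma holo_on_const [simp]: "holo_on Z (\<lambda>z. c)"
  by (simp add: holo_on_iff)

lemma holo_on_add: "holo_on Z f \<Longrightarrow> holo_on Z g \<Longrightarrow> holo_on Z (\<lambda>z. f z + g z)"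
  by (simp add: holo_on_iff wirt_add)

lemma holo_on_mult: "holo_on Z f \<Longrightarrow> holo_on Z g \<Longrightarrow> holo_on Z (\<lambda>z. f z * g z)"
  by (simp add: holo_on_iff wirt_mult differentiable_mult)

lemma wirt_bar_compose:
  fixes f :: "complex^'n \<Rightarrow> complex" and \<phi> :: "complex^'m \<Rightarrow> complex^'n"
  assumes f: "f differentiable (at (\<phi> z))" and \<phi>: "\<And>k. (\<lambda>z. \<phi> z $ k) differentiable (at z)"
  shows "wirt_bar i (\<lambda>z. f (\<phi> z)) z =
    (\<Sum>k\<in>UNIV. wirt_bar i (\<lambda>z. \<phi> z $ k) z * wirt k f (\<phi> z)
      + cnj (wirt i (\<lambda>z. \<phi> z $ k) z) * wirt_bar k f (\<phi> z))"
proof -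
  let ?D = "\<lambda>k. frechet_derivative (\<lambda>z. \<phi> z $ k) (at z)"
  have "wirt_bar i (\<lambda>z. f (\<phi> z)) z =
      (\<Sum>k\<in>UNIV. ((?D k (axis i 1) * wirt k f (\<phi> z) + cnj (?D k (axis i 1)) * wirt_bar k f (\<phi> z))
        + \<i> * (?D k (axis i \<i>) * wirt k f (\<phi> z) + cnj (?D k (axis i \<i>)) * wirt_bar k f (\<phi> z))) / 2)"
    unfolding wirt_bar_def[of i] frechet_compose(2)[where f = f and \<phi> = \<phi>, OF f \<phi>]
    by (simp only: sum_divide_distrib[symmetric] sum.distrib[symmetric] sum_distrib_left)
  also have "\<dots> = (\<Sum>k\<in>UNIV. (?D k (axis i 1) + \<i> * ?D k (axis i \<i>)) / 2 * wirt k f (\<phi> z)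
      + cnj ((?D k (axis i 1) - \<i> * ?D k (axis i \<i>)) / 2) * wirt_bar k f (\<phi> z))"
  proof (intro sum.cong refl)
    have "((a * p + cnj a * q) + \<i> * (b * p + cnj b * q)) / 2
        = (a + \<i> * b) / 2 * p + cnj ((a - \<i> * b) / 2) * q" for a b p q :: complex
      by (simp add: field_simps)
    then show "((?D k (axis i 1) * wirt k f (\<phi> z) + cnj (?D k (axis i 1)) * wirt_bar k f (\<phi> z))
        + \<i> * (?D k (axis i \<i>) * wirt k f (\<phi> z) + cnj (?D k (axis i \<i>)) * wirt_bar k f (\<phi> z))) / 2
      = (?D k (axis i 1) + \<i> * ?D k (axis i \<i>)) / 2 * wirt k f (\<phi> z)
      + cnj ((?D k (axis i 1) - \<i> * ?D k (axis i \<i>)) / 2) * wirt_bar k f (\<phi> z)" for k .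
  qed
  finally show ?thesis by (simp only: wirt_def[of i] wirt_bar_def[of i])
qed

lemma holo_on_compose:
  fixes f :: "complex^'n \<Rightarrow> complex" and \<phi> :: "complex^'m \<Rightarrow> complex^'n"
  assumes "holo_on Y f" "\<And>k. holo_on Z (\<lambda>z. \<phi> z $ k)" "\<phi> ` Z \<subseteq> Y"
  shows "holo_on Z (\<lambda>z. f (\<phi> z))"
  unfolding holo_on_iff
proof (intro ballI conjI allI)
  fix z i assume z: "z \<in> Z"
  have f: "f differentiable (at (\<phi> z))" and fw: "\<And>k. wirt_bar k f (\<phi> z) = 0"
    using assms(1,3) z by (auto simp: holo_on_iff)
  have p: "\<And>k. (\<lambda>z. \<phi> z $ k) differentiable (at z)" and pw: "\<And>k. wirt_bar i (\<lambda>z. \<phi> z $ k) z = 0"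
    using assms(2) z by (auto simp: holo_on_iff)
  show "(\<lambda>z. f (\<phi> z)) differentiable (at z)" by (rule frechet_compose(1)[where f = f and \<phi> = \<phi>, OF f p])
  show "wirt_bar i (\<lambda>z. f (\<phi> z)) z = 0"
    by (simp add: wirt_bar_compose[where f = f and \<phi> = \<phi>, OF f p] fw pw)
qed

section \<open>Closure of C^k functions under algebra, inversion and composition\<close>

lemma Ck_on_cong_open:
  assumes "open Z" "\<And>y. y \<in> Z \<Longrightarrow> f y = g y"
  shows "Ck_on k Z f \<longleftrightarrow> Ck_on k Z g"
  using assms(2)
proof (induction k arbitrary: f g)
  case 0
  then show ?case by (simp cong: continuous_on_cong)
next
  case (Suc k)
  show ?case
    using differentiable_cong_open[OF assms(1) _ Suc.prems]
      Suc.IH[of "\<lambda>z. frechet_derivative f (at z) v" "\<lambda>z. frechet_derivative g (at z) v" for v]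
      frechet_derivative_cong_open[OF assms(1) _ Suc.prems]
    by simp
qed

lemma Ck_on_subset: "Ck_on k Z f \<Longrightarrow> Y \<subseteq> Z \<Longrightarrow> Ck_on k Y f"
  by (induction k arbitrary: f) (auto intro: continuous_on_subset)

lemma Ck_on_SucD: "Ck_on (Suc k) Z f \<Longrightarrow> Ck_on k Z f"
proof (induction k arbitrary: f)
  case 0
  then show ?case
    by (auto intro!: continuous_at_imp_continuous_on differentiable_imp_continuous_within)
next
  case (Suc k)
  have "Ck_on k Z (\<lambda>z. frechet_derivative f (at z) v)" for v
    by (rule Suc.IH) (use Suc.prems in \<open>simp del: Ck_on.simps add: Ck_on.simps(2)[of "Suc k"]\<close>)
  with Suc.prems show ?case by simp
qed

lemma Ck_on_const [simp]: "Ck_on k Z (\<lambda>z. c)"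
  by (induction k arbitrary: c) auto

lemma frechet_add:
  assumes "f differentiable (at z)" "g differentiable (at z)"
  shows "frechet_derivative (\<lambda>z. f z + g z) (at z) v = frechet_derivative f (at z) v + frechet_derivative g (at z) v"
  by (simp add: frechet_derivative_at[OF has_derivative_add[OF assms[unfolded frechet_derivative_works]], symmetric])

lemma frechet_mult:
  fixes f g :: "'a::real_normed_vector \<Rightarrow> complex"
  assumes "f differentiable (at z)" "g differentiable (at z)"
  shows "frechet_derivative (\<lambda>z. f z * g z) (at z) v = f z * frechet_derivative g (at z) v + frechet_derivative f (at z) v * g z"
  by (simp add: frechet_derivative_at[OF has_derivative_mult[OF assms[unfolded frechet_derivative_works]], symmetric])

lemma frechet_cnj:
  assumes "f differentiable (at z)"
  shows "frechet_derivative (\<lambda>z. cnj (f z)) (at z) v = cnj (frechet_derivative f (at z) v)"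
  by (simp add: frechet_derivative_at[OF has_derivative_cnj_comp[OF assms[unfolded frechet_derivative_works]], symmetric])

lemma Ck_on_add:
  "open Z \<Longrightarrow> Ck_on k Z f \<Longrightarrow> Ck_on k Z g \<Longrightarrow> Ck_on k Z (\<lambda>z. f z + g z)"
proof (induction k arbitrary: f g)
  case 0
  then show ?case by (auto intro: continuous_intros)
next
  case (Suc k)
  have "Ck_on k Z (\<lambda>z. frechet_derivative (\<lambda>z. f z + g z) (at z) v)" for v
    by (subst Ck_on_cong_open[OF \<open>open Z\<close>, where g = "\<lambda>z. frechet_derivative f (at z) v + frechet_derivative g (at z) v"])
      (use Suc in \<open>simp_all add: frechet_add\<close>)
  then show ?case using Suc.prems by simp
qed

lemma Ck_on_mult:
  "open Z \<Longrightarrow> Ck_on k Z f \<Longrightarrow> Ck_on k Z g \<Longrightarrow> Ck_on k Z (\<lambda>z. f z * g z)"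
proof (induction k arbitrary: f g)
  case 0
  then show ?case by (auto intro: continuous_intros)
next
  case (Suc k)
  have "Ck_on k Z (\<lambda>z. frechet_derivative (\<lambda>z. f z * g z) (at z) v)" for v
    by (subst Ck_on_cong_open[OF \<open>open Z\<close>, where g = "\<lambda>z. f z * frechet_derivative g (at z) v + frechet_derivative f (at z) v * g z"])
      (use Suc Ck_on_SucD[OF Suc.prems(2)] Ck_on_SucD[OF Suc.prems(3)] in \<open>simp_all add: frechet_mult Ck_on_add\<close>)
  then show ?case using Suc.prems by (simp add: differentiable_mult)
qed

lemma Ck_on_cnj:
  "open Z \<Longrightarrow> Ck_on k Z f \<Longrightarrow> Ck_on k Z (\<lambda>z. cnj (f z))"
proof (induction k arbitrary: f)
  case 0
  then show ?case by (auto intro: continuous_intros)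
next
  case (Suc k)
  have "Ck_on k Z (\<lambda>z. frechet_derivative (\<lambda>z. cnj (f z)) (at z) v)" for v
    by (subst Ck_on_cong_open[OF \<open>open Z\<close>, where g = "\<lambda>z. cnj (frechet_derivative f (at z) v)"])
      (use Suc in \<open>simp_all add: frechet_cnj\<close>)
  then show ?case using Suc.prems by (simp add: differentiable_cnj)
qed

lemma Ck_on_sum:
  "open Z \<Longrightarrow> (\<And>i. i \<in> I \<Longrightarrow> Ck_on k Z (f i)) \<Longrightarrow> Ck_on k Z (\<lambda>z. \<Sum>i\<in>I. f i z)"
  by (induction I rule: infinite_finite_induct) (simp_all add: Ck_on_add)

lemma Ck_on_prod:
  "open Z \<Longrightarrow> (\<And>i. i \<in> I \<Longrightarrow> Ck_on k Z (f i)) \<Longrightarrow> Ck_on k Z (\<lambda>z. \<Prod>i\<in>I. f i z)"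
  by (induction I rule: infinite_finite_induct) (simp_all add: Ck_on_mult)

lemma has_derivative_inverse_complex:
  fixes f :: "'a::real_normed_vector \<Rightarrow> complex"
  assumes "f differentiable (at z)" "f z \<noteq> 0"
  shows "((\<lambda>z. inverse (f z)) has_derivative
     (\<lambda>v. - (frechet_derivative f (at z) v) * (inverse (f z) * inverse (f z)))) (at z)"
  using Deriv.has_derivative_inverse[OF assms(2) assms(1)[unfolded frechet_derivative_works]]
  by (simp add: algebra_simps)

text \<open>The derivative -Df / f^2 contains 1/f again, but one order lower, so the induction
  closes.\<close>

lemma Ck_on_inverse:
  assumes "open Z" "\<And>z. z \<in> Z \<Longrightarrow> f z \<noteq> 0"
  shows "Ck_on k Z f \<Longrightarrow> Ck_on k Z (\<lambda>z. inverse (f z))"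
proof (induction k)
  case 0
  then show ?case using assms(2) by (simp add: continuous_on_inverse)
next
  case (Suc k)
  have fd: "f differentiable (at z)" if "z \<in> Z" for z using Suc.prems that by simp
  have d: "((\<lambda>z. inverse (f z)) has_derivative
     (\<lambda>v. - (frechet_derivative f (at z) v) * (inverse (f z) * inverse (f z)))) (at z)" if "z \<in> Z" for z
    by (rule has_derivative_inverse_complex[OF fd[OF that] assms(2)[OF that]])
  have fk: "Ck_on k Z f" by (rule Ck_on_SucD[OF Suc.prems])
  have ik: "Ck_on k Z (\<lambda>z. inverse (f z))" by (rule Suc.IH[OF fk])
  have dk: "Ck_on k Z (\<lambda>z. frechet_derivative f (at z) v)" for v using Suc.prems by simp
  have "Ck_on k Z (\<lambda>z. frechet_derivative (\<lambda>z. inverse (f z)) (at z) v)" for v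
  proof (subst Ck_on_cong_open[OF \<open>open Z\<close>])
    show "Ck_on k Z (\<lambda>z. (- 1) * (frechet_derivative f (at z) v) * (inverse (f z) * inverse (f z)))"
      by (intro Ck_on_mult assms(1) Ck_on_const ik dk)
    show "frechet_derivative (\<lambda>z. inverse (f z)) (at z) v =
      (- 1) * (frechet_derivative f (at z) v) * (inverse (f z) * inverse (f z))" if "z \<in> Z" for z
      using fun_cong[OF frechet_derivative_at[OF d[OF that]], of v] by simp
  qed
  moreover have "(\<lambda>z. inverse (f z)) differentiable (at z)" if "z \<in> Z" for z
    using d[OF that] unfolding differentiable_def by blast
  ultimately show ?case by simp
qed

lemma Ck_on_wirt:
  assumes "open Z" "Ck_on (Suc k) Z f"
  shows "Ck_on k Z (wirt i f)" "Ck_on k Z (wirt_bar i f)"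
proof -
  have *: "Ck_on k Z (\<lambda>z. (1/2) * (frechet_derivative f (at z) (axis i 1) + c * frechet_derivative f (at z) (axis i \<i>)))" for c
    using assms by (intro Ck_on_mult Ck_on_add) simp_all
  have 1: "wirt i f = (\<lambda>z. (1/2) * (frechet_derivative f (at z) (axis i 1) + (-\<i>) * frechet_derivative f (at z) (axis i \<i>)))"
    by (rule ext) (simp add: wirt_def)
  show "Ck_on k Z (wirt i f)" unfolding 1 by (rule *)
  have 2: "wirt_bar i f = (\<lambda>z. (1/2) * (frechet_derivative f (at z) (axis i 1) + \<i> * frechet_derivative f (at z) (axis i \<i>)))"
    by (rule ext) (simp add: wirt_bar_def)
  show "Ck_on k Z (wirt_bar i f)" unfolding 2 by (rule *)
qed

text \<open>The induction runs over all \<open>f\<close> at once: the chain rule expresses the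
  derivative through \<open>wirt j f\<close> and \<open>wirt_bar j f\<close> composed with
  \<open>\<phi>\<close>, and the induction hypothesis is applied to these in place of
  \<open>f\<close>.\<close>

lemma Ck_on_compose:
  fixes f :: "complex^'n \<Rightarrow> complex" and \<phi> :: "complex^'m \<Rightarrow> complex^'n"
  assumes Y: "open Y" and Z: "open Z" and sub: "\<phi> ` Z \<subseteq> Y"
  shows "Ck_on k Y f \<Longrightarrow> (\<And>j. Ck_on k Z (\<lambda>z. \<phi> z $ j)) \<Longrightarrow> Ck_on k Z (\<lambda>z. f (\<phi> z))"
proof (induction k arbitrary: f)
  case 0
  then have "continuous_on Z \<phi>"
    using continuous_on_vec_lambda[of Z "\<lambda>j z. \<phi> z $ j"] by simp
  then show ?case using 0 sub by (auto intro: continuous_on_compose2)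
next
  case (Suc k)
  have p: "\<And>j. Ck_on k Z (\<lambda>z. \<phi> z $ j)" using Suc.prems(2) Ck_on_SucD by blast
  have fd: "f differentiable (at (\<phi> z))" if "z \<in> Z" for z using Suc.prems(1) sub that by auto
  have pd: "(\<lambda>z. \<phi> z $ j) differentiable (at z)" if "z \<in> Z" for z j using Suc.prems(2)[of j] that by auto
  have fk: "Ck_on k Z (\<lambda>z. frechet_derivative (\<lambda>z. \<phi> z $ j) (at z) v)" for j v
    using Suc.prems(2)[of j] by simp
  have "Ck_on k Z (\<lambda>z. frechet_derivative (\<lambda>z. f (\<phi> z)) (at z) v)" for v
  proof (subst Ck_on_cong_open[OF Z])
    show "frechet_derivative (\<lambda>z. f (\<phi> z)) (at z) v =
      (\<Sum>k\<in>UNIV. frechet_derivative (\<lambda>z. \<phi> z $ k) (at z) v * wirt k f (\<phi> z)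
         + cnj (frechet_derivative (\<lambda>z. \<phi> z $ k) (at z) v) * wirt_bar k f (\<phi> z))" if "z \<in> Z" for z
      by (rule frechet_compose(2)[where f = f and \<phi> = \<phi>, OF fd[OF that] pd[OF that]])
    show "Ck_on k Z (\<lambda>z. \<Sum>k\<in>UNIV. frechet_derivative (\<lambda>z. \<phi> z $ k) (at z) v * wirt k f (\<phi> z)
         + cnj (frechet_derivative (\<lambda>z. \<phi> z $ k) (at z) v) * wirt_bar k f (\<phi> z))"
      by (intro Ck_on_sum Ck_on_add Ck_on_mult Ck_on_cnj Z fk
          Suc.IH[of "wirt j f" for j] Suc.IH[of "wirt_bar j f" for j] Ck_on_wirt[OF Y Suc.prems(1)] p)
  qed
  moreover have "(\<lambda>z. f (\<phi> z)) differentiable (at z)" if "z \<in> Z" for z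
    by (rule frechet_compose(1)[where f = f and \<phi> = \<phi>, OF fd[OF that] pd[OF that]])
  ultimately show ?case by simp
qed

section \<open>Holomorphic functions of several variables are smooth\<close>

lemma frechet_holo_scale:
  assumes "holo_on Z f" "z \<in> Z"
  shows "frechet_derivative f (at z) (c *s v) = c * frechet_derivative f (at z) v"
proof -
  have d: "f differentiable (at z)" and w: "\<And>i. wirt_bar i f z = 0"
    using assms by (auto simp: holo_on_iff)
  show ?thesis unfolding frechet_wirt[OF d]
    by (simp only: w mult_zero_right add_0_right vector_smult_component mult.assoc sum_distrib_left)
qed

text \<open>Restriction to a complex line makes one-variable Cauchy theory available; complex
  linearity of the derivative turns the directional derivative into a field derivative.\<close>

lemma holo_on_line:
  assumes "holo_on Z f" "y + \<zeta> *s v \<in> Z"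
  shows "((\<lambda>\<zeta>. f (y + \<zeta> *s v)) has_field_derivative frechet_derivative f (at (y + \<zeta> *s v)) v) (at \<zeta>)"
proof -
  have "f differentiable (at (y + \<zeta> *s v))" using assms by (auto simp: holo_on_iff)
  then have d: "(f has_derivative frechet_derivative f (at (y + \<zeta> *s v))) (at (y + \<zeta> *s v))"
    by (simp only: frechet_derivative_works)
  have l: "linear (\<lambda>h::complex. h *s v)"
    by (rule linearI) (simp_all add: vec_eq_iff algebra_simps)
  have "((\<lambda>\<zeta>. y + \<zeta> *s v) has_derivative (\<lambda>h. 0 + h *s v)) (at \<zeta>)"
    by (intro has_derivative_add has_derivative_const linear_imp_has_derivative l)
  from diff_chain_at[OF this d]
  have "((\<lambda>\<zeta>. f (y + \<zeta> *s v)) has_derivative (\<lambda>h. frechet_derivative f (at (y + \<zeta> *s v)) (h *s v))) (at \<zeta>)"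
    by (simp add: o_def)
  then show ?thesis
    unfolding has_field_derivative_def frechet_holo_scale[OF assms]
    by (rule has_derivative_eq_rhs) (simp add: fun_eq_iff)
qed

lemma norm_smult_vec: "norm (c *s v) = cmod c * norm (v :: complex^'n)"
proof -
  have "(norm (c *s v))\<^sup>2 = (cmod c * norm v)\<^sup>2"
    by (simp add: norm_vec_def L2_set_def norm_mult power_mult_distrib sum_nonneg sum_distrib_left)
  then show ?thesis by (simp add: power2_eq_iff_nonneg)
qed

text \<open>First-order Taylor remainder on the disc of radius R/2. The second derivative is bounded
  by Cauchy's inequality on discs of radius R/4, which stay inside the big disc: 2! K / (R/4)^2 = 32
  K / R^2.\<close>

lemma difference_quotient_bound:
  assumes hol: "\<psi> holomorphic_on ball 0 R" and R: "R > 0"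
    and K: "\<And>x. x \<in> ball 0 R \<Longrightarrow> cmod (\<psi> x) \<le> K" and h: "cmod h < R / 2" "h \<noteq> 0"
  shows "cmod ((\<psi> h - \<psi> 0) / h - deriv \<psi> 0) \<le> 32 * K / R\<^sup>2 * cmod h"
proof -
  have B: "cmod ((deriv ^^ 2) \<psi> x) \<le> 32 * K / R\<^sup>2" if "x \<in> ball 0 (R/2)" for x
  proof -
    have sub: "cball x (R/4) \<subseteq> ball 0 R"
    proof
      fix y assume "y \<in> cball x (R/4)"
      then have "cmod (y - x) \<le> R / 4" by (simp add: dist_norm norm_minus_commute)
      moreover have "cmod x < R / 2" using that by simp
      moreover have "cmod y \<le> cmod x + cmod (y - x)" by (rule norm_triangle_sub)
      ultimately have "cmod y < R" using R by linarith
      then show "y \<in> ball 0 R" by simp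
    qed
    have "cmod ((deriv ^^ 2) \<psi> x) \<le> fact 2 * K / (R/4)^2"
    proof (rule Cauchy_inequality)
      show "\<psi> holomorphic_on ball x (R/4)"
        by (rule holomorphic_on_subset[OF hol]) (use sub ball_subset_cball[of x "R/4"] in \<open>rule order_trans[rotated]\<close>)
      show "continuous_on (cball x (R/4)) \<psi>"
        by (rule continuous_on_subset[OF holomorphic_on_imp_continuous_on[OF hol] sub])
      show "cmod (\<psi> y) \<le> K" if "cmod (x - y) = R/4" for y
      proof -
        have "y \<in> cball x (R/4)" using that by (simp add: dist_norm)
        then show ?thesis using K sub by blast
      qed
    qed (use R in simp)
    then show ?thesis by (simp add: power_divide)
  qed
  have "cmod ((deriv ^^ 0) \<psi> h - (\<Sum>i\<le>1. (deriv ^^ i) \<psi> 0 * (h - 0)^i / fact i)) \<le> 32 * K / R\<^sup>2 * cmod (h - 0)^Suc 1 / fact 1"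
  proof (rule complex_Taylor[where S = "ball 0 (R/2)" and f = "\<lambda>i. (deriv ^^ i) \<psi>"])
    show "((deriv ^^ i) \<psi> has_field_derivative (deriv ^^ Suc i) \<psi> x) (at x within ball 0 (R/2))"
      if "x \<in> ball 0 (R/2)" "i \<le> 1" for x i
    proof -
      have "(deriv ^^ i) \<psi> holomorphic_on ball 0 R"
        by (rule holomorphic_higher_deriv[OF hol open_ball])
      then have "((deriv ^^ i) \<psi> has_field_derivative deriv ((deriv ^^ i) \<psi>) x) (at x)"
        by (rule holomorphic_derivI[OF _ open_ball]) (use that R in auto)
      then show ?thesis by (simp add: has_field_derivative_at_within)
    qed
    show "cmod ((deriv ^^ Suc 1) \<psi> x) \<le> 32 * K / R\<^sup>2" if "x \<in> ball 0 (R/2)" for x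
      using B[OF that] by (simp add: numeral_2_eq_2)
  qed (use R h in auto)
  then have "cmod (\<psi> h - \<psi> 0 - deriv \<psi> 0 * h) \<le> 32 * K / R\<^sup>2 * (cmod h)^2"
    by (simp add: power2_eq_square diff_diff_eq)
  moreover have "(\<psi> h - \<psi> 0) / h - deriv \<psi> 0 = (\<psi> h - \<psi> 0 - deriv \<psi> 0 * h) / h"
    using h(2) by (simp add: field_simps)
  ultimately show ?thesis
    by (simp only: norm_divide divide_le_eq) (use h(2) in \<open>simp add: power2_eq_square\<close>)
qed

text \<open>
  The difference quotients of \<open>f\<close> in the direction \<open>v\<close> converge locally uniformly; Cauchy's
  inequality on complex lines turns this into uniform convergence of their derivatives, so the
  limit is differentiable.
\<close>

lemma holo_on_frechet_unit:
  fixes f :: "complex^'n \<Rightarrow> complex"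
  assumes Z: "open Z" and f: "holo_on Z f" and v: "norm v \<le> 1"
  shows "holo_on Z (\<lambda>z. frechet_derivative f (at z) v)"
  unfolding holo_on_def
proof
  fix z0 assume "z0 \<in> Z"
  let ?D = "\<lambda>z. frechet_derivative f (at z)"
  obtain e where e: "e > 0" "cball z0 e \<subseteq> Z"
    using Z \<open>z0 \<in> Z\<close> open_contains_cball by metis
  \<comment> \<open>Room for two successive moves: points of \<open>ball z0 r\<close> travel along
    \<open>w\<close> by at most \<open>r\<close> and then along \<open>v\<close> by at most
    \<open>r\<close>, and must stay in the closed ball where \<open>f\<close> is holomorphic and
    bounded by \<open>K\<close>.\<close>
  define r where "r = e / 4"
  have r: "r > 0" using e by (simp add: r_def)
  have sub: "cball z0 (4 * r) \<subseteq> Z" using e by (simp add: r_def)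
  have fd: "f differentiable (at z)" if "z \<in> Z" for z using f that by (simp add: holo_on_iff)
  have "continuous_on (cball z0 (4 * r)) f"
    using sub fd by (intro continuous_at_imp_continuous_on ballI differentiable_imp_continuous_within) auto
  then have "compact (f ` cball z0 (4 * r))" by (intro compact_continuous_image) auto
  then obtain K where K: "\<And>z. z \<in> cball z0 (4 * r) \<Longrightarrow> cmod (f z) \<le> K"
    using compact_imp_bounded bounded_iff by (metis image_eqI)
  \<comment> \<open>The offset 3 gives |h n| <= r/3 < r/2, the range in which
    \<open>difference_quotient_bound\<close> applies.\<close>
  define h :: "nat \<Rightarrow> complex" where "h n = of_real (r / real (n + 3))" for n
  have hn: "cmod (h n) = r / real (n + 3)" for n unfolding h_def norm_of_real using r by simp
  have h0: "h n \<noteq> 0" for n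
  proof -
    have "cmod (h n) > 0" unfolding hn by (intro divide_pos_pos r) simp
    then show ?thesis by auto
  qed
  have hr: "cmod (h n) < r / 2" for n unfolding hn by (rule divide_strict_left_mono) (use r in auto)
  have hlim: "(\<lambda>n. c * cmod (h n)) \<longlonglongrightarrow> 0" for c
  proof -
    have "(\<lambda>n. r / real (n + 3)) \<longlonglongrightarrow> 0"
      using LIMSEQ_ignore_initial_segment[OF lim_const_over_n[of r], of 3] by simp
    from tendsto_mult_right_zero[OF this, of c] show ?thesis unfolding hn .
  qed
  define C where "C = 32 * K / r\<^sup>2"
  define fn where "fn n z = (f (z + h n *s v) - f z) / h n" for n z
  define fn' where "fn' n z w = (?D (z + h n *s v) w - ?D z w) / h n" for n z w
  have in4: "y + \<zeta> *s u \<in> cball z0 (4 * r)"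
    if "y \<in> cball z0 (a * r)" "cmod \<zeta> \<le> r" "norm u \<le> 1" "a \<le> 3" for y \<zeta> u a
  proof -
    have "cmod \<zeta> * norm u \<le> r * 1" using that r by (intro mult_mono) auto
    moreover have "a * r \<le> 3 * r" using that r by (intro mult_right_mono) auto
    moreover have "dist z0 (y + \<zeta> *s u) \<le> dist z0 y + norm (\<zeta> *s u)"
      using dist_triangle[of z0 "y + \<zeta> *s u" y] by (simp add: dist_norm)
    ultimately show ?thesis using that by (simp add: norm_smult_vec)
  qed
  have inZ: "y + \<zeta> *s u \<in> Z"
    if "y \<in> cball z0 (a * r)" "cmod \<zeta> \<le> r" "norm u \<le> 1" "a \<le> 3" for y \<zeta> u a
    using in4[OF that] sub by blast
  have dq: "cmod (fn n y - ?D y v) \<le> C * cmod (h n)" if y: "y \<in> cball z0 (2 * r)" for n y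
  proof -
    define \<psi> where "\<psi> \<zeta> = f (y + \<zeta> *s v)" for \<zeta>
    have fld: "(\<psi> has_field_derivative ?D (y + \<zeta> *s v) v) (at \<zeta>)" if "cmod \<zeta> < r" for \<zeta>
      unfolding \<psi>_def by (rule holo_on_line[OF f]) (rule inZ[OF y _ v], use that in auto)
    have "\<psi> holomorphic_on ball 0 r"
      using fld by (intro holomorphic_onI) (auto simp: field_differentiable_def intro: has_field_derivative_at_within)
    then have "cmod ((\<psi> (h n) - \<psi> 0) / h n - deriv \<psi> 0) \<le> C * cmod (h n)"
      unfolding C_def
      by (rule difference_quotient_bound[OF _ r _ hr h0])
        (auto simp: \<psi>_def intro!: K in4[OF y _ v])
    moreover have "deriv \<psi> 0 = ?D y v" using DERIV_imp_deriv[OF fld[of 0]] r by simp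
    ultimately show ?thesis by (simp add: \<psi>_def fn_def)
  qed
  have Dlin: "linear (?D z)" if "z \<in> Z" for z
    using fd[OF that] frechet_derivative_works has_derivative_linear by blast
  have y0: "y \<in> cball z0 (2 * r)" if "y \<in> ball z0 r" for y using that r by auto
  have zZ: "z \<in> Z" "z + h n *s v \<in> Z" if "z \<in> cball z0 (2 * r)" for z n
  proof -
    have "cmod (h n) \<le> r" using hr[of n] r by linarith
    with inZ[OF that _ v, of "h n"] show "z + h n *s v \<in> Z" by simp
    have "cball z0 (2 * r) \<subseteq> cball z0 (4 * r)" using r by (intro cball_subset_cball_iff[THEN iffD2]) simp
    then show "z \<in> Z" using that sub by blast
  qed
  have fnd: "(fn n has_derivative fn' n z) (at z)" if "z \<in> cball z0 (2 * r)" for n z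
  proof -
    have "((\<lambda>z. f (z + h n *s v)) has_derivative (\<lambda>w. ?D (z + h n *s v) w)) (at z)"
    proof -
      have "((\<lambda>z. z + h n *s v) has_derivative (\<lambda>w. w + 0)) (at z)"
        by (intro has_derivative_add has_derivative_ident has_derivative_const)
      moreover have "(f has_derivative ?D (z + h n *s v)) (at (z + h n *s v))"
        using fd[OF zZ(2)[OF that]] by (simp only: frechet_derivative_works)
      ultimately have "(f \<circ> (\<lambda>z. z + h n *s v) has_derivative ?D (z + h n *s v) \<circ> (\<lambda>w. w + 0)) (at z)"
        by (rule diff_chain_at)
      then show ?thesis by (simp only: o_def add_0_right)
    qed
    moreover have "(f has_derivative ?D z) (at z)"
      using fd[OF zZ(1)[OF that]] by (simp only: frechet_derivative_works)
    ultimately have "((\<lambda>z. (f (z + h n *s v) - f z) * inverse (h n)) has_derivative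
       (\<lambda>w. (?D (z + h n *s v) w - ?D z w) * inverse (h n))) (at z)"
      by (intro has_derivative_mult_left has_derivative_diff)
    then show ?thesis by (simp add: fn_def[abs_def] fn'_def[abs_def] divide_inverse)
  qed
  \<comment> \<open>For |\<xi>| <= r the points z + \<xi> w lie in \<open>cball z0 (2 * r)\<close>,
    where \<open>dq\<close> bounds the difference of two quotients. Cauchy's inequality of order one
    on this disc costs the factor 1/r.\<close>
  have unit: "cmod (fn' n z w - fn' m z w) \<le> C / r * (cmod (h n) + cmod (h m))"
    if z: "z \<in> ball z0 r" and w: "norm w \<le> 1" for n m z w
  proof -
    define G where "G \<xi> = fn n (z + \<xi> *s w) - fn m (z + \<xi> *s w)" for \<xi>
    have in2: "z + \<xi> *s w \<in> cball z0 (2 * r)" if "cmod \<xi> \<le> r" for \<xi>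
    proof -
      have "cmod \<xi> * norm w \<le> r * 1" using that w r by (intro mult_mono) auto
      then show ?thesis
        using dist_triangle[of z0 "z + \<xi> *s w" z] z by (simp add: dist_norm norm_smult_vec)
    qed
    have ln: "((\<lambda>\<xi>. fn k (z + \<xi> *s w)) has_field_derivative fn' k (z + \<xi> *s w) w) (at \<xi>)"
      if "cmod \<xi> \<le> r" for \<xi> k
    proof -
      note zz = zZ[OF in2[OF that]]
      have eq: "z + \<xi> *s w + h k *s v = (z + h k *s v) + \<xi> *s w" for \<xi> by simp
      have "((\<lambda>\<xi>. f (z + h k *s v + \<xi> *s w)) has_field_derivative ?D (z + h k *s v + \<xi> *s w) w) (at \<xi>)"
        by (rule holo_on_line[OF f]) (rule zz(2)[of k, unfolded eq])
      moreover have "((\<lambda>\<xi>. f (z + \<xi> *s w)) has_field_derivative ?D (z + \<xi> *s w) w) (at \<xi>)"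
        by (rule holo_on_line[OF f zz(1)])
      ultimately show ?thesis unfolding fn_def fn'_def eq
        by (rule DERIV_cdivide[OF DERIV_diff])
    qed
    have Gd: "(G has_field_derivative fn' n (z + \<xi> *s w) w - fn' m (z + \<xi> *s w) w) (at \<xi>)" if "cmod \<xi> \<le> r" for \<xi>
      unfolding G_def by (intro DERIV_diff ln that)
    have "cmod ((deriv ^^ 1) G 0) \<le> fact 1 * (C * (cmod (h n) + cmod (h m))) / r ^ 1"
    proof (rule Cauchy_inequality[OF _ _ r])
      show "G holomorphic_on ball 0 r"
        by (rule holomorphic_onI, unfold field_differentiable_def, rule exI,
            rule has_field_derivative_at_within, rule Gd) simp
      show "continuous_on (cball 0 r) G"
        by (rule continuous_at_imp_continuous_on, rule ballI, rule DERIV_isCont, rule Gd) simp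
      show "cmod (G \<xi>) \<le> C * (cmod (h n) + cmod (h m))" if "cmod (0 - \<xi>) = r" for \<xi>
      proof -
        have "z + \<xi> *s w \<in> cball z0 (2 * r)" using in2 that by simp
        from dq[OF this, of n] dq[OF this, of m] have "cmod ((fn n (z + \<xi> *s w) - ?D (z + \<xi> *s w) v) - (fn m (z + \<xi> *s w) - ?D (z + \<xi> *s w) v))
              \<le> C * cmod (h n) + C * cmod (h m)"
            by (rule order_trans[OF norm_triangle_ineq4 add_mono])
          then show ?thesis by (simp add: G_def distrib_left)
      qed
    qed
    then show ?thesis using DERIV_imp_deriv[OF Gd[of 0]] r by simp
  qed
  have lin': "fn' n z (c *\<^sub>R w) = c *\<^sub>R fn' n z w" if "z \<in> ball z0 r" for n z c w
    unfolding fn'_def linear_scale[OF Dlin[OF zZ(1)[OF y0[OF that]]]] linear_scale[OF Dlin[OF zZ(2)[OF y0[OF that]]]]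
    by (simp only: scaleR_conv_of_real right_diff_distrib times_divide_eq_right)
  define c where "c = C / r"
  have hlim2: "(\<lambda>n. c * cmod (h n) * x) \<longlonglongrightarrow> 0" for x
    by (rule tendsto_mult_left_zero[OF hlim])
  \<comment> \<open>Homogeneity removes the restriction to the unit ball: the theorem on
    differentiating a limit of functions demands an error relative to \<open>norm w\<close>,
    uniformly in \<open>z\<close>.\<close>
  have all: "cmod (fn' n z w - fn' m z w) \<le> c * cmod (h n) * norm w + c * cmod (h m) * norm w"
    if z: "z \<in> ball z0 r" for n m z w
  proof (cases "w = 0")
    case True
    have "fn' k z w = 0" for k using lin'[OF z, of k 0 w] True by (simp only: scaleR_zero_left)
    then show ?thesis by (simp add: True)
  next
    case False
    have "norm w *\<^sub>R ((1 / norm w) *\<^sub>R w) = w" using False by simp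
    then have eq: "norm w *\<^sub>R fn' k z ((1 / norm w) *\<^sub>R w) = fn' k z w" for k
      using lin'[OF z, of k "norm w" "(1 / norm w) *\<^sub>R w"] by simp
    have "fn' n z w - fn' m z w = norm w *\<^sub>R (fn' n z ((1 / norm w) *\<^sub>R w) - fn' m z ((1 / norm w) *\<^sub>R w))"
      unfolding scaleR_diff_right eq ..
    then have "cmod (fn' n z w - fn' m z w) = norm w * cmod (fn' n z ((1 / norm w) *\<^sub>R w) - fn' m z ((1 / norm w) *\<^sub>R w))"
      by simp
    also have "\<dots> \<le> norm w * (c * (cmod (h n) + cmod (h m)))"
      unfolding c_def by (rule mult_left_mono[OF unit[OF z] norm_ge_zero]) (use False in simp)
    also have "\<dots> = c * cmod (h n) * norm w + c * cmod (h m) * norm w" by (simp add: algebra_simps)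
    finally show ?thesis .
  qed
  have "\<exists>l. (\<lambda>n. fn' n z w) \<longlonglongrightarrow> l" if z: "z \<in> ball z0 r" for z w
    unfolding convergent_eq_Cauchy
  proof (rule metric_CauchyI)
    fix \<epsilon> :: real assume "\<epsilon> > 0"
    have "eventually (\<lambda>n. c * cmod (h n) * norm w < \<epsilon> / 2) sequentially"
      by (rule order_tendstoD(2)[OF hlim2]) (use \<open>\<epsilon> > 0\<close> in simp)
    then obtain M where M: "\<And>n. n \<ge> M \<Longrightarrow> c * cmod (h n) * norm w < \<epsilon> / 2"
      unfolding eventually_sequentially by blast
    show "\<exists>M. \<forall>m\<ge>M. \<forall>n\<ge>M. dist (fn' m z w) (fn' n z w) < \<epsilon>"
    proof (intro exI[of _ M] allI impI)
      fix m n assume "M \<le> m" "M \<le> n"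
      then show "dist (fn' m z w) (fn' n z w) < \<epsilon>"
        using all[OF z, of m w n] M[of m] M[of n] unfolding dist_norm by linarith
    qed
  qed
  then obtain g' where g': "\<And>z w. z \<in> ball z0 r \<Longrightarrow> (\<lambda>n. fn' n z w) \<longlonglongrightarrow> g' z w" by metis
  have bound: "cmod (fn' n z w - g' z w) \<le> c * cmod (h n) * norm w" if z: "z \<in> ball z0 r" for n z w
  proof (rule LIMSEQ_le)
    show "(\<lambda>m. cmod (fn' n z w - fn' m z w)) \<longlonglongrightarrow> cmod (fn' n z w - g' z w)"
      by (intro tendsto_norm tendsto_diff tendsto_const g' z)
    have "(\<lambda>m. c * cmod (h n) * norm w + c * cmod (h m) * norm w) \<longlonglongrightarrow> c * cmod (h n) * norm w + 0"
      by (intro tendsto_add tendsto_const hlim2)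
    then show "(\<lambda>m. c * cmod (h n) * norm w + c * cmod (h m) * norm w) \<longlonglongrightarrow> c * cmod (h n) * norm w"
      by simp
    show "\<exists>N. \<forall>m\<ge>N. cmod (fn' n z w - fn' m z w) \<le> c * cmod (h n) * norm w + c * cmod (h m) * norm w"
      using all[OF z, of n w] by blast
  qed
  have lim: "(\<lambda>n. fn n z) \<longlonglongrightarrow> ?D z v" if "z \<in> ball z0 r" for z
  proof (rule LIM_zero_cancel, rule Lim_null_comparison)
    show "eventually (\<lambda>n. cmod (fn n z - ?D z v) \<le> C * cmod (h n)) sequentially"
      using dq[OF y0[OF that]] by simp
  qed (rule hlim)
  have "\<exists>g. \<forall>z\<in>ball z0 r. (\<lambda>n. fn n z) \<longlonglongrightarrow> g z \<and> (g has_derivative g' z) (at z within ball z0 r)"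
  proof (rule has_derivative_sequence)
    show "(fn n has_derivative fn' n z) (at z within ball z0 r)" if "z \<in> ball z0 r" for n z
      using fnd[OF y0[OF that]] by (rule has_derivative_at_withinI)
    show "\<forall>\<^sub>F n in sequentially. \<forall>z\<in>ball z0 r. \<forall>w. cmod (fn' n z w - g' z w) \<le> \<epsilon> * norm w" if "\<epsilon> > 0" for \<epsilon>
    proof -
      have "eventually (\<lambda>n. c * cmod (h n) < \<epsilon>) sequentially"
        by (rule order_tendstoD(2)[OF hlim that])
      then show ?thesis
      proof (rule eventually_mono, intro ballI allI)
        fix n z w assume "c * cmod (h n) < \<epsilon>" "z \<in> ball z0 r"
        then show "cmod (fn' n z w - g' z w) \<le> \<epsilon> * norm w"
          using order_trans[OF bound mult_right_mono[of "c * cmod (h n)" \<epsilon> "norm w"]] by simp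
      qed
    qed
    show "z0 \<in> ball z0 r" using r by simp
    then show "(\<lambda>n. fn n z0) \<longlonglongrightarrow> ?D z0 v" by (rule lim)
  qed auto
  then obtain g where g: "\<And>z. z \<in> ball z0 r \<Longrightarrow> (\<lambda>n. fn n z) \<longlonglongrightarrow> g z"
    "\<And>z. z \<in> ball z0 r \<Longrightarrow> (g has_derivative g' z) (at z within ball z0 r)" by blast
  have z0: "z0 \<in> ball z0 r" using r by simp
  have geq: "g z = ?D z v" if "z \<in> ball z0 r" for z using LIMSEQ_unique[OF g(1)[OF that] lim[OF that]] .
  have "(g has_derivative g' z0) (at z0)" using g(2)[OF z0] z0 at_within_open[OF z0 open_ball] by simp
  then have "((\<lambda>z. ?D z v) has_derivative g' z0) (at z0)"
    by (rule has_derivative_transform_within_open[OF _ open_ball z0]) (rule geq)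
  moreover have "g' z0 (\<i> *s w) = \<i> * g' z0 w" for w
  proof (rule LIMSEQ_unique)
    show "(\<lambda>n. fn' n z0 (\<i> *s w)) \<longlonglongrightarrow> g' z0 (\<i> *s w)" by (rule g'[OF z0])
    have "fn' n z0 (\<i> *s w) = \<i> * fn' n z0 w" for n
      unfolding fn'_def frechet_holo_scale[OF f zZ(1)[OF y0[OF z0]]] frechet_holo_scale[OF f zZ(2)[OF y0[OF z0]]]
      by (simp only: right_diff_distrib[symmetric] times_divide_eq_right)
    then show "(\<lambda>n. fn' n z0 (\<i> *s w)) \<longlonglongrightarrow> \<i> * g' z0 w" by (simp add: tendsto_mult_left g'[OF z0])
  qed
  ultimately show "\<exists>D. ((\<lambda>z. ?D z v) has_derivative D) (at z0) \<and> (\<forall>w. D (\<i> *s w) = \<i> * D w)" by blast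
qed

lemma holo_on_frechet:
  fixes f :: "complex^'n \<Rightarrow> complex"
  assumes Z: "open Z" and f: "holo_on Z f"
  shows "holo_on Z (\<lambda>z. frechet_derivative f (at z) v)"
proof (cases "v = 0")
  case True
  have "frechet_derivative f (at z) 0 = 0" if "z \<in> Z" for z
    using frechet_holo_scale[OF f that, of 0 0] by simp
  then show ?thesis using holo_on_cong_open[OF Z, of "\<lambda>z. frechet_derivative f (at z) v" "\<lambda>z. 0"] True by simp
next
  case False
  define u where "u = complex_of_real (1 / norm v) *s v"
  have u: "v = complex_of_real (norm v) *s u" using False by (simp add: u_def vec_eq_iff)
  have "norm u \<le> 1" using False by (simp add: u_def norm_smult_vec norm_divide)
  then have "holo_on Z (\<lambda>z. complex_of_real (norm v) * frechet_derivative f (at z) u)"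
    by (intro holo_on_mult holo_on_const holo_on_frechet_unit Z f)
  moreover have "frechet_derivative f (at z) v = complex_of_real (norm v) * frechet_derivative f (at z) u" if "z \<in> Z" for z
    using frechet_holo_scale[OF f that, of "complex_of_real (norm v)" u] unfolding u[symmetric] .
  ultimately show ?thesis using holo_on_cong_open[OF Z, of "\<lambda>z. frechet_derivative f (at z) v"
    "\<lambda>z. complex_of_real (norm v) * frechet_derivative f (at z) u"] by blast
qed

lemma holo_on_imp_Ck_on: "open Z \<Longrightarrow> holo_on Z f \<Longrightarrow> Ck_on k Z f"
proof (induction k arbitrary: f)
  case 0
  then have "\<And>z. z \<in> Z \<Longrightarrow> f differentiable (at z)" by (simp add: holo_on_iff)
  then show ?case by (auto intro!: continuous_at_imp_continuous_on differentiable_imp_continuous_within)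
next
  case (Suc k)
  have "Ck_on k Z (\<lambda>z. frechet_derivative f (at z) v)" for v
    by (rule Suc.IH[OF \<open>open Z\<close> holo_on_frechet[OF Suc.prems]])
  moreover have "\<And>z. z \<in> Z \<Longrightarrow> f differentiable (at z)" using Suc.prems by (simp add: holo_on_iff)
  ultimately show ?case by simp
qed

lemma holo_on_wirt:
  assumes "open Z" "holo_on Z f"
  shows "holo_on Z (wirt i f)"
proof -
  have "holo_on Z (\<lambda>z. (1/2) * (frechet_derivative f (at z) (axis i 1) + (-\<i>) * frechet_derivative f (at z) (axis i \<i>)))"
    by (intro holo_on_mult holo_on_add holo_on_const holo_on_frechet assms)
  moreover have "wirt i f = (\<lambda>z. (1/2) * (frechet_derivative f (at z) (axis i 1) + (-\<i>) * frechet_derivative f (at z) (axis i \<i>)))"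
    by (rule ext) (simp add: wirt_def)
  ultimately show ?thesis by simp
qed

section \<open>Hermitian linear algebra\<close>

lemma matrix_inv_both:
  assumes "invertible (A :: complex^'r^'r)"
  shows "A ** matrix_inv A = mat 1" "matrix_inv A ** A = mat 1"
proof -
  have "\<exists>A'. A ** A' = mat 1 \<and> A' ** A = mat 1" using assms by (simp add: invertible_def)
  then have "A ** matrix_inv A = mat 1 \<and> matrix_inv A ** A = mat 1"
    unfolding matrix_inv_def by (rule someI_ex)
  then show "A ** matrix_inv A = mat 1" "matrix_inv A ** A = mat 1" by auto
qed

lemma matrix_inv_eqI:
  fixes A B :: "complex^'r^'r"
  assumes "A ** B = mat 1"
  shows "matrix_inv A = B" "invertible A"
proof -
  show inv: "invertible A" using assms invertible_right_inverse by blast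
  have "matrix_inv A = matrix_inv A ** (A ** B)" by (simp add: assms)
  also have "\<dots> = B" by (simp add: matrix_mul_assoc matrix_inv_both[OF inv])
  finally show "matrix_inv A = B" .
qed

lemma invertible_matrix_inv: "invertible (A :: complex^'r^'r) \<Longrightarrow> invertible (matrix_inv A)"
  using matrix_inv_both matrix_inv_eqI(2) by blast

lemma matrix_inv_inv: "invertible (A :: complex^'r^'r) \<Longrightarrow> matrix_inv (matrix_inv A) = A"
  using matrix_inv_both matrix_inv_eqI(1) by blast

lemma matrix_inv_cancel:
  assumes "invertible (A :: complex^'r^'r)"
  shows "A ** (matrix_inv A ** B) = B" "matrix_inv A ** (A ** B) = B"
    "B ** A ** matrix_inv A = B" "B ** matrix_inv A ** A = B"
  using matrix_inv_both[OF assms]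
  by (simp_all add: matrix_mul_assoc) (simp_all flip: matrix_mul_assoc)

lemma matrix_inv_mult:
  fixes A B :: "complex^'r^'r"
  assumes "invertible A" "invertible B"
  shows "matrix_inv (A ** B) = matrix_inv B ** matrix_inv A" "invertible (A ** B)"
proof -
  have "(A ** B) ** (matrix_inv B ** matrix_inv A) = A ** (B ** (matrix_inv B ** matrix_inv A))"
    by (simp only: matrix_mul_assoc)
  also have "\<dots> = mat 1" by (simp only: matrix_inv_cancel assms matrix_inv_both)
  finally have "(A ** B) ** (matrix_inv B ** matrix_inv A) = mat 1" .
  from matrix_inv_eqI[OF this]
  show "matrix_inv (A ** B) = matrix_inv B ** matrix_inv A" "invertible (A ** B)" .
qed

lemma cadj_cadj [simp]: "cadj (cadj M) = M"
  by (simp add: cadj_def vec_eq_iff)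

lemma cadj_mult: "cadj (M ** N) = cadj N ** cadj M"
  by (simp add: cadj_def vec_eq_iff matrix_matrix_mult_def mult.commute)

lemma cadj_mat_1 [simp]: "cadj (mat 1) = mat 1"
  by (auto simp: cadj_def vec_eq_iff mat_def)

lemma cadj_inv:
  assumes "invertible (A :: complex^'r^'r)"
  shows "matrix_inv (cadj A) = cadj (matrix_inv A)" "invertible (cadj A)"
proof -
  have "cadj A ** cadj (matrix_inv A) = mat 1"
    by (simp add: cadj_mult[symmetric] matrix_inv_both[OF assms])
  from matrix_inv_eqI[OF this] show "matrix_inv (cadj A) = cadj (matrix_inv A)" "invertible (cadj A)" .
qed

section \<open>Hermitian products and positive definite matrices\<close>

definition cdot :: "complex^'r \<Rightarrow> complex^'r \<Rightarrow> complex" where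
  "cdot v w = (\<Sum>a\<in>UNIV. v $ a * cnj (w $ a))"

lemma cdot_commute: "cdot w v = cnj (cdot v w)"
  by (simp add: cdot_def mult.commute)

lemma cdot_add: "cdot (u + v) w = cdot u w + cdot v w" "cdot w (u + v) = cdot w u + cdot w v"
  by (simp_all add: cdot_def sum.distrib algebra_simps)

lemma cdot_smult: "cdot (c *s v) w = c * cdot v w" "cdot v (c *s w) = cnj c * cdot v w"
  by (simp_all add: cdot_def sum_distrib_left mult_ac)

lemma cdot_0 [simp]: "cdot 0 w = 0" "cdot w 0 = 0"
  by (simp_all add: cdot_def)

lemma cdot_sum: "cdot (\<Sum>k\<in>K. v k) w = (\<Sum>k\<in>K. cdot (v k) w)" "cdot w (\<Sum>k\<in>K. v k) = (\<Sum>k\<in>K. cdot w (v k))"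
  by (induction K rule: infinite_finite_induct) (simp_all add: cdot_add)

lemma cdot_cadj: "cdot (A *v v) w = cdot v (cadj A *v w)"
proof -
  have "cdot (A *v v) w = (\<Sum>a\<in>UNIV. \<Sum>b\<in>UNIV. A $ a $ b * v $ b * cnj (w $ a))"
    by (simp add: cdot_def matrix_vector_mult_def sum_distrib_right)
  also have "\<dots> = (\<Sum>b\<in>UNIV. \<Sum>a\<in>UNIV. A $ a $ b * v $ b * cnj (w $ a))" by (rule sum.swap)
  also have "\<dots> = cdot v (cadj A *v w)"
    by (simp add: cdot_def matrix_vector_mult_def cadj_def sum_distrib_left mult_ac)
  finally show ?thesis .
qed

lemma hinner_cdot: "hinner h v w = cdot (h *v v) w"
  by (simp add: hinner_def cdot_def matrix_vector_mult_def sum_distrib_right)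

lemma cdot_self: "cdot v v = of_real (\<Sum>a\<in>UNIV. (cmod (v $ a))\<^sup>2)"
  by (simp add: cdot_def complex_norm_square[symmetric])

lemma cdot_self_pos: "Re (cdot v v) \<ge> 0" "Im (cdot v v) = 0" "cdot v v = 0 \<longleftrightarrow> v = 0"
proof -
  show "Re (cdot v v) \<ge> 0" "Im (cdot v v) = 0" by (simp_all add: cdot_self sum_nonneg)
  have "cdot v v = 0 \<longleftrightarrow> (\<Sum>a\<in>UNIV. (cmod (v $ a))\<^sup>2) = 0"
    by (simp only: cdot_self of_real_eq_0_iff)
  also have "\<dots> \<longleftrightarrow> v = 0" by (subst sum_nonneg_eq_0_iff) (auto simp: vec_eq_iff)
  finally show "cdot v v = 0 \<longleftrightarrow> v = 0" .
qed

lemma hinner_congruence: "hinner (cadj a ** h ** a) v w = hinner h (a *v v) (a *v w)"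
proof -
  have "hinner (cadj a ** h ** a) v w = cdot (cadj a *v (h *v (a *v v))) w"
    by (simp only: hinner_cdot matrix_vector_mul_assoc matrix_mul_assoc)
  also have "\<dots> = cdot (h *v (a *v v)) (cadj (cadj a) *v w)" by (rule cdot_cadj)
  finally show ?thesis by (simp only: cadj_cadj hinner_cdot)
qed

lemma hinner_gram: "hinner h (a *v v) (a *v w) = cdot ((cadj a ** h ** a) *v v) w"
  by (metis hinner_congruence hinner_cdot)

lemma matrix_inv_left_vec:
  assumes "invertible (A :: complex^'r^'r)"
  shows "A *v (matrix_inv A *v v) = v" "matrix_inv A *v (A *v v) = v"
  by (simp_all add: matrix_vector_mul_assoc matrix_inv_both[OF assms])

lemma posdef_cadj_mult:
  assumes "invertible (Q :: complex^'r^'r)"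
  shows "hermitian_posdef (cadj Q ** Q)"
  unfolding hermitian_posdef_def
proof (intro conjI allI impI)
  show "cadj (cadj Q ** Q) = cadj Q ** Q" by (simp add: cadj_mult)
  fix v :: "complex^'r" assume "v \<noteq> 0"
  have "hinner (cadj Q ** Q) v v = cdot (Q *v v) (Q *v v)"
    by (simp add: hinner_cdot cdot_cadj matrix_vector_mul_assoc[symmetric])
  moreover have "Q *v v \<noteq> 0"
    using \<open>v \<noteq> 0\<close> matrix_inv_left_vec(2)[OF assms, of v] by auto
  ultimately show "0 < Re (hinner (cadj Q ** Q) v v)"
    using cdot_self_pos[of "Q *v v"] by (metis complex_eq_iff less_eq_real_def zero_complex.sel)
qed

lemma hinner_commute:
  assumes "cadj h = h" shows "hinner h w v = cnj (hinner h v w)"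
  by (metis assms cdot_cadj cdot_commute hinner_cdot)

text \<open>
  Instead of a dimension count, the next vector of the Gram-Schmidt process is found in the kernel
  of a matrix whose row \<open>k\<close> is zero.
\<close>

lemma exists_orthonormal:
  fixes h :: "complex^'r^'r"
  assumes h: "hermitian_posdef h"
  shows "\<exists>f :: 'r \<Rightarrow> complex^'r. \<forall>i\<in>S. \<forall>j\<in>S. hinner h (f i) (f j) = (if i = j then 1 else 0)"
  using finite[of S]
proof (induction S rule: finite_induct)
  case empty
  then show ?case by simp
next
  case (insert k S)
  have hh: "cadj h = h" using h by (simp add: hermitian_posdef_def)
  obtain f where f: "\<forall>i\<in>S. \<forall>j\<in>S. hinner h (f i) (f j) = (if i = j then 1 else 0)" using insert.IH by blast
  define M :: "complex^'r^'r" where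
    "M = (\<chi> i b. if i \<in> S then (\<Sum>a\<in>UNIV. h $ a $ b * cnj (f i $ a)) else 0)"
  have Mi: "(M *v v) $ i = hinner h v (f i)" if "i \<in> S" for i v
  proof -
    have "(M *v v) $ i = (\<Sum>b\<in>UNIV. \<Sum>a\<in>UNIV. h $ a $ b * v $ b * cnj (f i $ a))"
      using that by (simp add: M_def matrix_vector_mult_def sum_distrib_left mult_ac)
    also have "\<dots> = hinner h v (f i)" unfolding hinner_def by (rule sum.swap)
    finally show ?thesis .
  qed
  have "\<not> (\<exists>B. B ** M = mat 1)"
  proof
    assume "\<exists>B. B ** M = mat 1"
    then have "invertible M" using invertible_left_inverse by blast
    then obtain B where "M ** B = mat 1" by (auto simp: invertible_def)
    then have "(M ** B) $ k $ k = 1" by (simp add: mat_def)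
    moreover have "(M ** B) $ k $ k = 0" using insert.hyps by (simp add: M_def matrix_matrix_mult_def)
    ultimately show False by simp
  qed
  then obtain v where v: "v \<noteq> 0" "M *v v = 0" using matrix_left_invertible_ker[of M] by auto
  define c where "c = Re (hinner h v v)"
  have c: "c > 0" using h v by (simp add: hermitian_posdef_def c_def)
  have "hinner h v v = cnj (hinner h v v)" by (rule hinner_commute[OF hh])
  then have vv: "hinner h v v = of_real c" by (simp add: c_def complex_eq_iff)
  define u where "u = of_real (1 / sqrt c) *s v"
  have hs: "hinner h u w = of_real (1 / sqrt c) * hinner h v w" for w
    by (simp add: u_def hinner_cdot vector_smult_assoc vec.scale cdot_smult)
  have uS: "hinner h u (f i) = 0" if "i \<in> S" for i
    using Mi[OF that, of v] v hs by simp
  have uS': "hinner h (f i) u = 0" if "i \<in> S" for i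
    using hinner_commute[OF hh, of "f i" u] uS[OF that] by simp
  have "hinner h u u = of_real (1 / sqrt c) * (of_real (1 / sqrt c) * hinner h v v)"
    using hs[of u] hinner_commute[OF hh, of v u] hs[of v] vv by simp
  also have "\<dots> = 1"
  proof -
    have "(1 / sqrt c) * ((1 / sqrt c) * c) = 1" using c by (simp add: field_simps)
    then show ?thesis unfolding vv of_real_mult[symmetric] by simp
  qed
  finally have uu: "hinner h u u = 1" .
  have "k \<notin> S" by (rule insert.hyps)
  then have "\<forall>i\<in>insert k S. \<forall>j\<in>insert k S. hinner h ((f(k := u)) i) ((f(k := u)) j) = (if i = j then 1 else 0)"
    using f uu uS uS' by auto
  then show ?case by blast
qed

text \<open>The columns of \<open>P\<close> form an \<open>h\<close>-orthonormal basis, so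
  \<open>cadj P ** h ** P = mat 1\<close>, and \<open>Q\<close> is the inverse of \<open>P\<close>.
  Invertibility, positivity of the determinant and stability of positivity under congruence and
  under passage to End all reduce to this factorization.\<close>

lemma posdef_factor:
  fixes h :: "complex^'r^'r"
  assumes h: "hermitian_posdef h"
  shows "\<exists>Q :: complex^'r^'r. invertible Q \<and> h = cadj Q ** Q"
proof -
  obtain f :: "'r \<Rightarrow> complex^'r" where f: "\<And>i j. hinner h (f i) (f j) = (if i = j then 1 else 0)"
    using exists_orthonormal[OF h, of UNIV] by auto
  define P :: "complex^'r^'r" where "P = (\<chi> a i. f i $ a)"
  have "(cadj P ** h ** P) $ i $ j = hinner h (f j) (f i)" for i j
  proof -
    have "(cadj P ** h ** P) $ i $ j = (\<Sum>b\<in>UNIV. \<Sum>a\<in>UNIV. h $ a $ b * f j $ b * cnj (f i $ a))"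
      by (simp add: matrix_matrix_mult_def cadj_def P_def sum_distrib_left mult_ac)
    also have "\<dots> = hinner h (f j) (f i)" unfolding hinner_def by (rule sum.swap)
    finally show ?thesis .
  qed
  then have 1: "cadj P ** h ** P = mat 1" by (auto simp: vec_eq_iff f mat_def)
  then have P: "invertible P" using invertible_left_inverse by blast
  let ?Q = "matrix_inv P"
  have "cadj ?Q ** ?Q = cadj ?Q ** (cadj P ** h ** P) ** ?Q" by (simp add: 1)
  also have "\<dots> = (cadj ?Q ** cadj P) ** h ** (P ** ?Q)" by (simp add: matrix_mul_assoc)
  also have "\<dots> = h" by (simp add: cadj_mult[symmetric] matrix_inv_both[OF P])
  finally show ?thesis using invertible_matrix_inv[OF P] by metis
qed

lemma posdef_invertible: "hermitian_posdef (h :: complex^'r^'r) \<Longrightarrow> invertible h"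
  using posdef_factor cadj_inv(2) invertible_mult by metis

lemma posdef_congruence:
  fixes h a :: "complex^'r^'r"
  assumes "hermitian_posdef h" "invertible a"
  shows "hermitian_posdef (cadj a ** h ** a)"
proof -
  obtain Q :: "complex^'r^'r" where Q: "invertible Q" "h = cadj Q ** Q" using posdef_factor[OF assms(1)] by blast
  have "cadj a ** h ** a = cadj (Q ** a) ** (Q ** a)" by (simp add: Q cadj_mult matrix_mul_assoc)
  then show ?thesis using posdef_cadj_mult[OF matrix_inv_mult(2)[OF Q(1) assms(2)]] by simp
qed

lemma det_cadj: "det (cadj M) = cnj (det M)"
proof -
  have "det (cadj M) = det (\<chi> i j. cnj (M $ i $ j))"
    by (subst det_transpose[symmetric]) (simp add: cadj_def transpose_def)
  also have "\<dots> = cnj (det M)" by (simp add: det_def)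
  finally show ?thesis .
qed

lemma posdef_det:
  fixes h :: "complex^'r^'r"
  assumes "hermitian_posdef h"
  shows "Re (det h) > 0"
proof -
  obtain Q :: "complex^'r^'r" where Q: "invertible Q" "h = cadj Q ** Q"
    using posdef_factor[OF assms] by blast
  have "det h = of_real ((cmod (det Q))\<^sup>2)"
    by (simp only: Q det_mul det_cadj complex_norm_square mult.commute)
  moreover have "det Q \<noteq> 0" using Q invertible_det_nz by blast
  ultimately show ?thesis by simp
qed

text \<open>Positive definiteness of G in the form N times its adjoint, that is, as a sum of
  rank-one terms indexed by \<open>m\<close>: contracting a hermitian expression against G becomes a
  sum of its values on single vectors.\<close>

definition gram_factor :: "complex^'n^'n \<Rightarrow> bool" where
  "gram_factor G \<longleftrightarrow> (\<exists>N :: complex^'n^'n. invertible N \<and> (\<forall>a b. G $ a $ b = (\<Sum>m\<in>UNIV. N $ a $ m * cnj (N $ b $ m))))"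

lemma posdef_inv_gram_factor:
  fixes g :: "complex^'n^'n"
  assumes "hermitian_posdef g"
  shows "gram_factor (matrix_inv g)"
proof -
  obtain Q :: "complex^'n^'n" where Q: "invertible Q" "g = cadj Q ** Q" using posdef_factor[OF assms] by blast
  have "matrix_inv g = matrix_inv Q ** cadj (matrix_inv Q)"
    using Q by (simp add: matrix_inv_mult cadj_inv)
  then show ?thesis unfolding gram_factor_def
    using invertible_matrix_inv[OF Q(1)]
    by (intro exI[of _ "matrix_inv Q"]) (simp add: matrix_matrix_mult_def cadj_def)
qed

lemma invertible_transpose_matrix: "invertible (A :: complex^'r^'r) \<Longrightarrow> invertible (transpose A)"
  by (simp add: invertible_det_nz det_transpose)

text \<open>Reconciles two index orders: the Laplacian pairs \<open>P $ \<beta> $ \<alpha>\<close>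
  with the derivatives in directions \<alpha> and conjugate \<beta>, while
  \<open>contraction_nonneg\<close> reads \<open>G $ a $ b\<close> against \<open>D a\<close> and
  \<open>D b\<close>. The entrywise conjugate of \<open>N\<close> is the new factor.\<close>

lemma gram_factor_transpose:
  fixes G :: "complex^'n^'n"
  assumes "gram_factor G" shows "gram_factor (transpose G)"
proof -
  obtain N :: "complex^'n^'n" where N: "invertible N" "\<And>a b. G $ a $ b = (\<Sum>m\<in>UNIV. N $ a $ m * cnj (N $ b $ m))"
    using assms unfolding gram_factor_def by blast
  define N' where "N' = transpose (cadj N)"
  have "invertible N'" using cadj_inv(2)[OF N(1)] invertible_transpose_matrix unfolding N'_def by blast
  moreover have "transpose G $ a $ b = (\<Sum>m\<in>UNIV. N' $ a $ m * cnj (N' $ b $ m))" for a b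
    by (simp add: transpose_def N(2) N'_def cadj_def mult.commute)
  ultimately show ?thesis unfolding gram_factor_def by blast
qed

lemma gram_factor_quadratic_pos:
  fixes G :: "complex^'n^'n"
  assumes "gram_factor G" "y \<noteq> 0"
  shows "Re (\<Sum>a\<in>UNIV. \<Sum>b\<in>UNIV. G $ a $ b * (y $ a * cnj (y $ b))) > 0"
proof -
  obtain N :: "complex^'n^'n" where N: "invertible N" "\<And>a b. G $ a $ b = (\<Sum>m\<in>UNIV. N $ a $ m * cnj (N $ b $ m))"
    using assms unfolding gram_factor_def by blast
  define w where "w = transpose N *v y"
  have "invertible (transpose N)" using N(1) invertible_transpose_matrix by blast
  then have "w \<noteq> 0" using matrix_inv_left_vec(2)[of "transpose N" y] assms(2) by (auto simp: w_def)
  have "(\<Sum>a\<in>UNIV. \<Sum>b\<in>UNIV. G $ a $ b * (y $ a * cnj (y $ b)))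
      = (\<Sum>a\<in>UNIV. \<Sum>b\<in>UNIV. \<Sum>m\<in>UNIV. (N $ a $ m * y $ a) * cnj (N $ b $ m * y $ b))"
    by (simp add: N(2) sum_distrib_left sum_distrib_right mult_ac)
  also have "\<dots> = (\<Sum>a\<in>UNIV. \<Sum>m\<in>UNIV. \<Sum>b\<in>UNIV. (N $ a $ m * y $ a) * cnj (N $ b $ m * y $ b))"
    by (intro sum.cong refl sum.swap)
  also have "\<dots> = (\<Sum>m\<in>UNIV. \<Sum>a\<in>UNIV. \<Sum>b\<in>UNIV. (N $ a $ m * y $ a) * cnj (N $ b $ m * y $ b))"
    by (rule sum.swap)
  also have "\<dots> = (\<Sum>m\<in>UNIV. w $ m * cnj (w $ m))"
    by (simp only: w_def matrix_vector_mult_def transpose_def vec_lambda_beta sum_product cnj_sum)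
  also have "\<dots> = cdot w w" by (simp add: cdot_def)
  finally show ?thesis
    using cdot_self_pos[of w] \<open>w \<noteq> 0\<close> by (metis complex_eq_iff less_eq_real_def zero_complex.sel)
qed

text \<open>With h the product \<open>cadj Q ** Q\<close>, the double sum is the sum over m of |w
  m|^2, where w m is the combination of the vectors Q D a with coefficients N a m; if all w m
  vanish, invertibility of N and Q kills every D a. It is applied both to the gradient term of the
  Bochner formula and to the pointwise energy of a (0,1)-form.\<close>

lemma contraction_nonneg:
  fixes G :: "complex^'n^'n" and D :: "'n \<Rightarrow> complex^'r"
  assumes G: "gram_factor G" and h: "hermitian_posdef h"
  defines "S \<equiv> (\<Sum>a\<in>UNIV. \<Sum>b\<in>UNIV. G $ a $ b * hinner h (D a) (D b))"
  shows "Re S \<ge> 0" "Im S = 0" "S = 0 \<Longrightarrow> D a = 0"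
proof -
  obtain N :: "complex^'n^'n" where N: "invertible N" "\<And>a b. G $ a $ b = (\<Sum>m\<in>UNIV. N $ a $ m * cnj (N $ b $ m))"
    using G unfolding gram_factor_def by blast
  obtain Q :: "complex^'r^'r" where Q: "invertible Q" "h = cadj Q ** Q" using posdef_factor[OF h] by blast
  define w where "w m = (\<Sum>a\<in>UNIV. N $ a $ m *s (Q *v D a))" for m
  have hq: "hinner h u v = cdot (Q *v u) (Q *v v)" for u v
    by (simp add: Q(2) hinner_cdot cdot_cadj matrix_vector_mul_assoc[symmetric])
  have "S = (\<Sum>a\<in>UNIV. \<Sum>b\<in>UNIV. \<Sum>m\<in>UNIV. cdot (N $ a $ m *s (Q *v D a)) (N $ b $ m *s (Q *v D b)))"
    by (simp add: S_def N(2) hq cdot_smult sum_distrib_left sum_distrib_right mult_ac)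
  also have "\<dots> = (\<Sum>a\<in>UNIV. \<Sum>m\<in>UNIV. \<Sum>b\<in>UNIV. cdot (N $ a $ m *s (Q *v D a)) (N $ b $ m *s (Q *v D b)))"
    by (intro sum.cong refl sum.swap)
  also have "\<dots> = (\<Sum>m\<in>UNIV. \<Sum>a\<in>UNIV. \<Sum>b\<in>UNIV. cdot (N $ a $ m *s (Q *v D a)) (N $ b $ m *s (Q *v D b)))"
    by (rule sum.swap)
  also have "\<dots> = (\<Sum>m\<in>UNIV. cdot (w m) (w m))" unfolding w_def cdot_sum(1) unfolding cdot_sum(2) ..
  finally have S: "S = (\<Sum>m\<in>UNIV. cdot (w m) (w m))" .
  show "Re S \<ge> 0" "Im S = 0" unfolding S by (simp_all add: cdot_self_pos sum_nonneg)
  show "D a = 0" if "S = 0"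
  proof -
    have "(\<Sum>m\<in>UNIV. Re (cdot (w m) (w m))) = 0" using that S by (metis Re_sum zero_complex.sel(1))
    then have "Re (cdot (w m) (w m)) = 0" for m
      by (subst (asm) sum_nonneg_eq_0_iff) (auto simp: cdot_self_pos)
    then have w: "w m = 0" for m using cdot_self_pos by (metis complex_eq_iff zero_complex.sel)
    define M :: "complex^'r^'n" where "M = (\<chi> a c. (Q *v D a) $ c)"
    have "transpose N ** M = 0"
    proof -
      have "(transpose N ** M) $ m $ c = w m $ c" for m c
        by (simp add: matrix_matrix_mult_def transpose_def M_def w_def)
      then show ?thesis by (simp add: vec_eq_iff w)
    qed
    moreover have "invertible (transpose N)" using N(1) invertible_transpose_matrix by blast
    ultimately have "M = 0"
      using matrix_mul_assoc[of "matrix_inv (transpose N)" "transpose N" M] matrix_inv_both(2)[of "transpose N"]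
      by simp
    then have "Q *v D a = 0" by (simp add: M_def vec_eq_iff)
    then show ?thesis using matrix_inv_left_vec(2)[OF Q(1), of "D a"] by simp
  qed
qed

section \<open>Linear algebra of End: conjugation and commutators as matrices\<close>

lemma mat_of_vec_of_mat [simp]: "mat_of_vec (vec_of_mat B) = B"
  by (simp add: mat_of_vec_def vec_of_mat_def vec_eq_iff)

lemma vec_of_mat_of_vec [simp]: "vec_of_mat (mat_of_vec v) = v"
  by (simp add: mat_of_vec_def vec_of_mat_def vec_eq_iff)

lemma vec_of_mat_0 [simp]: "vec_of_mat 0 = 0"
  by (simp add: vec_of_mat_def vec_eq_iff)

text \<open>The matrix of $B \mapsto M B N$ on $\mathbb C^{r\times r}$.\<close>

definition sandwich :: "complex^'r^'r \<Rightarrow> complex^'r^'r \<Rightarrow> complex^('r \<times> 'r)^('r \<times> 'r)" where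
  "sandwich M N = (\<chi> I J. M $ fst I $ fst J * N $ snd J $ snd I)"

lemma sum_UNIV_prod: "(\<Sum>J\<in>UNIV. f J) = (\<Sum>k\<in>UNIV. \<Sum>l\<in>UNIV. f (k, l))"
  by (simp add: sum.cartesian_product UNIV_Times_UNIV[symmetric] del: UNIV_Times_UNIV)

lemma sandwich_vec: "sandwich M N *v vec_of_mat B = vec_of_mat (M ** B ** N)"
proof -
  have "(sandwich M N *v vec_of_mat B) $ (i, j) = vec_of_mat (M ** B ** N) $ (i, j)" for i j
  proof -
    have "(sandwich M N *v vec_of_mat B) $ (i, j) = (\<Sum>k\<in>UNIV. \<Sum>l\<in>UNIV. M $ i $ k * N $ l $ j * B $ k $ l)"
      by (simp add: sandwich_def matrix_vector_mult_def vec_of_mat_def sum_UNIV_prod)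
    also have "\<dots> = (\<Sum>l\<in>UNIV. \<Sum>k\<in>UNIV. M $ i $ k * N $ l $ j * B $ k $ l)" by (rule sum.swap)
    also have "\<dots> = vec_of_mat (M ** B ** N) $ (i, j)"
      by (simp add: vec_of_mat_def matrix_matrix_mult_def sum_distrib_left mult_ac)
    finally show ?thesis .
  qed
  then show ?thesis by (auto simp: vec_eq_iff)
qed

lemma matrix_eq_vec_of_matI:
  fixes A B :: "complex^('r::finite \<times> 'r)^'k"
  assumes "\<And>C. A *v vec_of_mat C = B *v vec_of_mat C"
  shows "A = B"
  unfolding matrix_eq using assms[of "mat_of_vec x" for x] by simp

lemma sandwich_mult: "sandwich M N ** sandwich M' N' = sandwich (M ** M') (N' ** N)"
  by (rule matrix_eq_vec_of_matI) (simp add: matrix_vector_mul_assoc[symmetric] sandwich_vec matrix_mul_assoc)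

lemma sandwich_1 [simp]: "sandwich (mat 1) (mat 1) = mat 1"
  by (rule matrix_eq_vec_of_matI) (simp add: sandwich_vec)

lemma cadj_sandwich: "cadj (sandwich M N) = sandwich (cadj M) (cadj N)"
  by (simp add: cadj_def sandwich_def vec_eq_iff)

lemma sandwich_inv:
  assumes "invertible M" "invertible N"
  shows "matrix_inv (sandwich M N) = sandwich (matrix_inv M) (matrix_inv N)" "invertible (sandwich M N)"
proof -
  have "sandwich M N ** sandwich (matrix_inv M) (matrix_inv N) = mat 1"
    by (simp add: sandwich_mult matrix_inv_both assms)
  from matrix_inv_eqI[OF this]
  show "matrix_inv (sandwich M N) = sandwich (matrix_inv M) (matrix_inv N)" "invertible (sandwich M N)" .
qed

lemma End_frame_sandwich:
  "matrix (\<lambda>v. vec_of_mat (e ** mat_of_vec v ** f)) = sandwich e f"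
proof -
  have "(\<lambda>v. vec_of_mat (e ** mat_of_vec v ** f)) = (\<lambda>v. sandwich e f *v v)"
    by (rule ext) (simp add: sandwich_vec[symmetric])
  then show ?thesis by simp
qed

text \<open>Conjugation by \<open>e\<close>. The same formula yields the induced frame, the induced
  metric (\<open>End_metric_eq\<close>) and the induced Gram matrix (\<open>gram_End\<close>), so
  the construction can be iterated to End(End(E)).\<close>

definition End_frame :: "complex^'r^'r \<Rightarrow> complex^('r \<times> 'r)^('r \<times> 'r)" where
  "End_frame e = sandwich e (matrix_inv e)"

lemma End_bundle_eq: "End_bundle E = (\<lambda>(W, e). (W, \<lambda>p. End_frame (e p))) ` E"
  by (simp add: End_bundle_def End_frame_sandwich End_frame_def)

definition munit :: "'r \<Rightarrow> 'r \<Rightarrow> complex^'r^'r" where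
  "munit k l = (\<chi> a b. if a = k \<and> b = l then 1 else 0)"

lemma munit_mult: "(munit k l ** M) $ a $ b = (if a = k then M $ l $ b else 0)"
proof -
  have "(munit k l ** M) $ a $ b = (\<Sum>c\<in>UNIV. if c = l then (if a = k then M $ l $ b else 0) else 0)"
    unfolding matrix_matrix_mult_def munit_def vec_lambda_beta by (rule sum.cong) auto
  then show ?thesis by simp
qed

lemma mult_munit: "(M ** munit k l) $ a $ b = (if b = l then M $ a $ k else 0)"
proof -
  have "(M ** munit k l) $ a $ b = (\<Sum>c\<in>UNIV. if c = k then (if b = l then M $ a $ k else 0) else 0)"
    unfolding matrix_matrix_mult_def munit_def vec_lambda_beta by (rule sum.cong) auto
  then show ?thesis by simp
qed

lemma trace_munit: "trace (munit k l ** M) = M $ l $ k"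
  by (simp add: trace_def munit_mult)

text \<open>A trace against an elementary matrix picks out one entry, so each coefficient is a
  product of an entry of \<open>h\<close> and one of its inverse. The induced metric is thus
  \<open>End_frame (h p)\<close>.\<close>

lemma End_metric_eq:
  fixes h :: "'p \<Rightarrow> complex^'r^'r"
  shows "End_metric h p = sandwich (h p) (matrix_inv (h p))"
proof -
  have m: "mat_of_vec (axis J 1) = munit (fst J) (snd J)" for J :: "'r \<times> 'r"
    by (auto simp: vec_eq_iff mat_of_vec_def axis_def munit_def)
  have c: "cadj (munit i j) = munit j i" for i j :: 'r
    by (auto simp: vec_eq_iff cadj_def munit_def)
  have "(P ** munit j i ** M) $ l $ k = P $ l $ j * M $ i $ k" for P M :: "complex^'r^'r" and i j k l
  proof -
    have "(P ** munit j i ** M) $ l $ k = (\<Sum>c\<in>UNIV. if c = i then P $ l $ j * M $ i $ k else 0)"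
      unfolding matrix_matrix_mult_def[of "P ** munit j i"] vec_lambda_beta
      by (rule sum.cong) (auto simp: mult_munit)
    then show ?thesis by simp
  qed
  then show ?thesis
    unfolding End_metric_def End_inner_def m c trace_munit by (simp add: vec_eq_iff sandwich_def)
qed

lemma invertible_End_frame: "invertible e \<Longrightarrow> invertible (End_frame e)"
  by (simp add: End_frame_def sandwich_inv invertible_matrix_inv)

lemma End_frame_inv: "invertible e \<Longrightarrow> matrix_inv (End_frame e) = sandwich (matrix_inv e) e"
  by (simp add: End_frame_def sandwich_inv invertible_matrix_inv matrix_inv_inv)

text \<open>Conjugation is multiplicative and compatible with adjoints, so the factor of
  \<open>End_frame h\<close> is \<open>End_frame Q\<close>.\<close>

lemma End_frame_posdef:
  assumes "hermitian_posdef (h :: complex^'r^'r)"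
  shows "hermitian_posdef (End_frame h)"
proof -
  obtain Q :: "complex^'r^'r" where Q: "invertible Q" "h = cadj Q ** Q" using posdef_factor[OF assms] by blast
  have "End_frame h = cadj (End_frame Q) ** End_frame Q"
    unfolding End_frame_def
    by (simp add: cadj_sandwich sandwich_mult Q matrix_inv_mult cadj_inv)
  then show ?thesis using posdef_cadj_mult[OF invertible_End_frame[OF Q(1)]] by simp
qed

lemma gram_End:
  assumes "invertible (e p)" "invertible (h p)"
  shows "gram (\<lambda>p. End_frame (e p)) (End_metric h) p = End_frame (gram e h p)"
  unfolding gram_def End_metric_eq End_frame_def
  by (simp add: cadj_sandwich sandwich_mult assms matrix_inv_mult cadj_inv matrix_mul_assoc)

text \<open>The matrix of the commutator map taking B to M B - B M.\<close>

definition ad :: "complex^'r^'r \<Rightarrow> complex^('r \<times> 'r)^('r \<times> 'r)" where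
  "ad M = sandwich M (mat 1) - sandwich (mat 1) M"

lemma vec_of_mat_diff: "vec_of_mat (A - B) = vec_of_mat A - vec_of_mat B"
  by (simp add: vec_of_mat_def vec_eq_iff)

lemma ad_vec: "ad M *v vec_of_mat B = vec_of_mat (M ** B - B ** M)"
  by (simp add: ad_def matrix_vector_mult_diff_rdistrib sandwich_vec vec_of_mat_diff)

lemma matrix_mult_diff:
  fixes A :: "complex^'n^'m"
  shows "A ** (B - C) = A ** B - A ** C" "(D - E) ** F = D ** F - E ** (F :: complex^'k^'l)"
  by (simp_all add: matrix_matrix_mult_def vec_eq_iff sum_subtractf algebra_simps)

lemma matrix_mult_minus:
  fixes A :: "complex^'n^'m"
  shows "A ** (- B) = - (A ** B)" "(- D) ** F = - (D ** (F :: complex^'k^'l))"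
  by (simp_all add: matrix_matrix_mult_def vec_eq_iff sum_negf)

text \<open>Equivariance of the commutator under change of frame. It carries identities computed in
  a frame over to the fibre, and in \<open>ad_orthogonal\<close> it moves a frame from the
  endomorphism onto End(End(E)).\<close>

lemma ad_conj:
  fixes e M :: "complex^'r^'r"
  assumes "invertible e"
  shows "End_frame e ** ad M ** matrix_inv (End_frame e) = ad (e ** M ** matrix_inv e)"
proof -
  define f where "f = matrix_inv e"
  have f: "e ** f = mat 1" by (simp add: f_def matrix_inv_both[OF assms])
  have "sandwich e f ** ad M ** sandwich f e = ad (e ** M ** f)"
  proof (rule matrix_eq_vec_of_matI)
    fix C :: "complex^'r^'r"
    have "e ** (M ** (f ** C ** e) - (f ** C ** e) ** M) ** f
        = e ** M ** f ** C ** (e ** f) - (e ** f) ** C ** e ** M ** f"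
      by (simp add: matrix_mul_assoc matrix_mult_diff)
    also have "\<dots> = (e ** M ** f) ** C - C ** (e ** M ** f)"
      by (simp add: f matrix_mul_assoc)
    finally show "(sandwich e f ** ad M ** sandwich f e) *v vec_of_mat C = ad (e ** M ** f) *v vec_of_mat C"
      by (simp add: matrix_vector_mul_assoc[symmetric] sandwich_vec ad_vec)
  qed
  then show ?thesis unfolding End_frame_inv[OF assms] unfolding End_frame_def f_def .
qed

lemma mat_commute: "mat c ** (B :: complex^'r^'r) = B ** mat c"
  by (simp add: mat_def vec_eq_iff matrix_matrix_mult_def if_distrib if_distribR mult.commute cong: if_cong)

lemma ad_mat: "ad (mat c) = 0"
  by (rule matrix_eq_vec_of_matI) (simp add: ad_vec mat_commute)

section \<open>Smooth dependence of the inverse matrix, by Cramer's rule\<close>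

lemma Ck_on_det:
  fixes A :: "complex^'m \<Rightarrow> complex^'r^'r"
  assumes "open Z" "\<And>i j. Ck_on k Z (\<lambda>z. A z $ i $ j)"
  shows "Ck_on k Z (\<lambda>z. det (A z))"
  unfolding det_def by (intro Ck_on_sum Ck_on_mult Ck_on_prod Ck_on_const assms)

lemma matrix_inv_entry:
  fixes A :: "complex^'r^'r"
  assumes "invertible A"
  shows "matrix_inv A $ k $ l = det (\<chi> i j. if j = k then axis l 1 $ i else A $ i $ j) / det A"
proof -
  have "det A \<noteq> 0" using assms invertible_det_nz by blast
  then have "matrix_inv A *v axis l 1 = (\<chi> k. det (\<chi> i j. if j = k then axis l 1 $ i else A $ i $ j) / det A)"
    using cramer[of A "matrix_inv A *v axis l 1" "axis l 1"] matrix_inv_left_vec(1)[OF assms] by simp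
  moreover have "(matrix_inv A *v axis l 1) $ k = matrix_inv A $ k $ l"
    by (simp add: matrix_vector_mult_def axis_def if_distrib cong: if_cong)
  ultimately show ?thesis by (metis (no_types, lifting) vec_lambda_beta)
qed

lemma Ck_on_matrix_inv:
  fixes A :: "complex^'m \<Rightarrow> complex^'r^'r"
  assumes Z: "open Z" and A: "\<And>i j. Ck_on k Z (\<lambda>z. A z $ i $ j)" and inv: "\<And>z. z \<in> Z \<Longrightarrow> invertible (A z)"
  shows "Ck_on k Z (\<lambda>z. matrix_inv (A z) $ a $ b)"
proof (subst Ck_on_cong_open[OF Z])
  show "matrix_inv (A z) $ a $ b = det (\<chi> i j. if j = a then axis b 1 $ i else A z $ i $ j) * inverse (det (A z))"
    if "z \<in> Z" for z
    using matrix_inv_entry[OF inv[OF that]] by (simp add: divide_inverse)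
  have "Ck_on k Z (\<lambda>z. (\<chi> i j. if j = a then axis b 1 $ i else A z $ i $ j) $ i $ j)" for i j
    by (cases "j = a") (simp_all add: A)
  then show "Ck_on k Z (\<lambda>z. det (\<chi> i j. if j = a then axis b 1 $ i else A z $ i $ j) * inverse (det (A z)))"
    by (intro Ck_on_mult Ck_on_inverse Ck_on_det Z A) (use inv invertible_det_nz in blast)+
qed

section \<open>Charts and products\<close>

abbreviation chart_inv :: "('p, 'n) cchart \<Rightarrow> complex^'n \<Rightarrow> 'p" where
  "chart_inv c \<equiv> inv_into (fst c) (snd c)"

lemma chart_facts:
  assumes "complex_manifold A" "c \<in> A"
  shows chart_open: "open (fst c)"
    and chart_range_open: "open (snd c ` fst c)"
    and chart_inj: "inj_on (snd c) (fst c)"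
    and chart_cont: "continuous_on (fst c) (snd c)"
    and chart_inv_cont: "continuous_on (snd c ` fst c) (chart_inv c)"
    and chart_homeo: "homeomorphism (fst c) (snd c ` fst c) (snd c) (chart_inv c)"
proof -
  obtain U \<phi> where c: "c = (U, \<phi>)" by (cases c)
  have *: "open U \<and> open (\<phi> ` U) \<and> (\<exists>\<psi>. homeomorphism U (\<phi> ` U) \<phi> \<psi>)"
    using assms unfolding complex_manifold_def c by blast
  then obtain \<psi> where h: "homeomorphism U (\<phi> ` U) \<phi> \<psi>" by blast
  show "open (fst c)" "open (snd c ` fst c)" using * by (simp_all add: c)
  have inj: "inj_on \<phi> U" using homeomorphism_apply1[OF h] by (metis inj_onI)
  then show "inj_on (snd c) (fst c)" by (simp add: c)
  \<comment> \<open>A chart comes only with some continuous inverse \<psi>; it agrees with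
    \<open>inv_into\<close> on the image, so \<open>chart_inv\<close> inherits its
    continuity.\<close>
  have eq: "inv_into U \<phi> z = \<psi> z" if z: "z \<in> \<phi> ` U" for z
    using z homeomorphism_apply1[OF h] inv_into_f_f[OF inj] by auto
  show "continuous_on (fst c) (snd c)" using homeomorphism_cont1[OF h] by (simp add: c)
  show cinv: "continuous_on (snd c ` fst c) (chart_inv c)"
    using homeomorphism_cont2[OF h] by (simp add: c eq cong: continuous_on_cong)
  show "homeomorphism (fst c) (snd c ` fst c) (snd c) (chart_inv c)"
    using h cinv eq unfolding homeomorphism_def c by auto
qed

lemma chart_inv_apply:
  assumes "complex_manifold A" "c \<in> A"
  shows "x \<in> fst c \<Longrightarrow> chart_inv c (snd c x) = x"
    and "z \<in> snd c ` fst c \<Longrightarrow> chart_inv c z \<in> fst c"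
    and "z \<in> snd c ` fst c \<Longrightarrow> snd c (chart_inv c z) = z"
  using inv_into_f_f[OF chart_inj[OF assms]] inv_into_into f_inv_into_f by metis+

lemma chart_image_open:
  assumes "complex_manifold A" "c \<in> A" "open V"
  shows "open (snd c ` (fst c \<inter> V))"
proof -
  have "openin (top_of_set (fst c)) (fst c \<inter> V)" using assms(3) by (rule openin_open_Int)
  then have "openin (top_of_set (snd c ` fst c)) (snd c ` (fst c \<inter> V))"
    by (rule homeomorphism_imp_open_map[OF chart_homeo[OF assms(1,2)]])
  then show ?thesis using chart_range_open[OF assms(1,2)] openin_open_eq by blast
qed

lemma chart_covers:
  assumes "complex_manifold A" shows "\<exists>c\<in>A. x \<in> fst c"
proof -
  have "x \<in> (\<Union>(U, \<phi>)\<in>A. U)" using assms by (simp add: complex_manifold_def)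
  then show ?thesis by force
qed

lemma chart_at:
  assumes "complex_manifold A" shows "chart_at A x \<in> A" "x \<in> fst (chart_at A x)"
proof -
  have "\<exists>c. c \<in> A \<and> x \<in> fst c" using chart_covers[OF assms] by blast
  then have "chart_at A x \<in> A \<and> x \<in> fst (chart_at A x)" unfolding chart_at_def by (rule someI_ex)
  then show "chart_at A x \<in> A" "x \<in> fst (chart_at A x)" by auto
qed

lemma transition_holo:
  assumes "complex_manifold A" "c \<in> A" "c' \<in> A"
  shows "holo_on (snd c ` (fst c \<inter> fst c')) (\<lambda>z. snd c' (chart_inv c z) $ i)"
  using assms unfolding complex_manifold_def by (cases c, cases c') fastforce

lemma smooth_funD:
  assumes "smooth_fun A W f" "c \<in> A"
  shows "Ck_on k (snd c ` (fst c \<inter> W)) (\<lambda>z. f (chart_inv c z))"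
  using assms unfolding smooth_fun_def smooth_on_def o_def by (cases c) fastforce

lemma smooth_funI:
  assumes "\<And>c k. c \<in> A \<Longrightarrow> Ck_on k (snd c ` (fst c \<inter> W)) (\<lambda>z. f (chart_inv c z))"
  shows "smooth_fun A W f"
  using assms unfolding smooth_fun_def smooth_on_def o_def by fastforce

lemma holo_funD:
  assumes "holo_fun A W f" "c \<in> A"
  shows "holo_on (snd c ` (fst c \<inter> W)) (\<lambda>z. f (chart_inv c z))"
  using assms unfolding holo_fun_def o_def by (cases c) fastforce

lemma holo_funI:
  assumes "\<And>c. c \<in> A \<Longrightarrow> holo_on (snd c ` (fst c \<inter> W)) (\<lambda>z. f (chart_inv c z))"
  shows "holo_fun A W f"
  using assms unfolding holo_fun_def o_def by fastforce

lemma Ck_on_local: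
  "(\<And>z. z \<in> Z \<Longrightarrow> \<exists>Y. open Y \<and> z \<in> Y \<and> Ck_on k Y f) \<Longrightarrow> Ck_on k Z f"
proof (induction k arbitrary: f)
  case 0
  show ?case unfolding Ck_on.simps
  proof (rule continuous_at_imp_continuous_on, rule ballI)
    fix z assume "z \<in> Z"
    with 0 obtain Y where "open Y" "z \<in> Y" "continuous_on Y f" by auto
    then show "isCont f z" by (simp add: continuous_on_eq_continuous_at)
  qed
next
  case (Suc k)
  have "f differentiable (at z)" if "z \<in> Z" for z using Suc.prems[OF that] by auto
  moreover have "Ck_on k Z (\<lambda>z. frechet_derivative f (at z) v)" for v
  proof (rule Suc.IH)
    fix z assume "z \<in> Z"
    with Suc.prems obtain Y where "open Y" "z \<in> Y" "Ck_on (Suc k) Y f" by blast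
    then show "\<exists>Y. open Y \<and> z \<in> Y \<and> Ck_on k Y (\<lambda>z. frechet_derivative f (at z) v)" by auto
  qed
  ultimately show ?case by simp
qed

text \<open>Transition maps are holomorphic, hence smooth, so smoothness tested in the charts of
  \<open>A\<close> persists in a larger atlas. This admits coordinates on S outside the given
  atlas.\<close>

lemma smooth_fun_mono_atlas:
  assumes A': "complex_manifold A'" and A: "complex_manifold A" and sub: "A \<subseteq> A'"
    and W: "open W" and f: "smooth_fun A W f"
  shows "smooth_fun A' W f"
proof (rule smooth_funI, rule Ck_on_local)
  fix c' k z assume c': "c' \<in> A'" and "z \<in> snd c' ` (fst c' \<inter> W)"
  then obtain x where x: "x \<in> fst c'" "x \<in> W" "z = snd c' x" by auto
  obtain c where c: "c \<in> A" "x \<in> fst c" using chart_covers[OF A] by blast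
  have cA': "c \<in> A'" using c sub by auto
  let ?Y = "snd c' ` (fst c' \<inter> (W \<inter> fst c))"
  have Y: "open ?Y" by (rule chart_image_open[OF A' c'] open_Int W chart_open[OF A c(1)])+
  have Y1: "open (snd c ` (fst c \<inter> W))" by (rule chart_image_open[OF A c(1) W])
  have "Ck_on k ?Y (\<lambda>y. (f \<circ> chart_inv c) (snd c (chart_inv c' y)))"
  proof (rule Ck_on_compose[where f = "f \<circ> chart_inv c" and \<phi> = "\<lambda>y. snd c (chart_inv c' y)", OF Y1 Y])
    show "(\<lambda>y. snd c (chart_inv c' y)) ` ?Y \<subseteq> snd c ` (fst c \<inter> W)"
      using chart_inv_apply(1)[OF A' c'] by auto
    show "Ck_on k (snd c ` (fst c \<inter> W)) (f \<circ> chart_inv c)"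
      using smooth_funD[OF f c(1)] by (simp add: o_def)
    show "Ck_on k ?Y (\<lambda>y. snd c (chart_inv c' y) $ j)" for j
      by (rule holo_on_imp_Ck_on[OF Y], rule holo_on_subset[OF transition_holo[OF A' c' cA']]) auto
  qed
  moreover have "(f \<circ> chart_inv c) (snd c (chart_inv c' y)) = f (chart_inv c' y)" if "y \<in> ?Y" for y
    using that chart_inv_apply(1)[OF A' c'] chart_inv_apply(1)[OF A c(1)] by auto
  ultimately have "Ck_on k ?Y (\<lambda>y. f (chart_inv c' y))"
    using Ck_on_cong_open[OF Y, of "\<lambda>y. (f \<circ> chart_inv c) (snd c (chart_inv c' y))" "\<lambda>y. f (chart_inv c' y)"] by blast
  moreover have "z \<in> ?Y" using x c by auto
  ultimately show "\<exists>Y. open Y \<and> z \<in> Y \<and> Ck_on k Y (\<lambda>z. f (chart_inv c' z))" using Y by blast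
qed

lemma holo_on_coord: "holo_on Z (\<lambda>z. z $ i)"
proof -
  have l: "bounded_linear (\<lambda>z::complex^'a. z $ i)" by (rule bounded_linear_vec_nth)
  have "((\<lambda>z::complex^'a. z $ i) has_derivative (\<lambda>v. v $ i)) (at z)" for z
    by (rule bounded_linear_imp_has_derivative[OF l])
  then show ?thesis unfolding holo_on_def by (intro ballI exI[of _ "\<lambda>v. v $ i"]) simp
qed

section \<open>Product charts and restriction to slices\<close>

definition vpair :: "complex^'n::finite \<Rightarrow> complex^'m::finite \<Rightarrow> complex^('n + 'm)" where
  "vpair z w = (\<chi> i. case i of Inl a \<Rightarrow> z $ a | Inr k \<Rightarrow> w $ k)"

definition vfst :: "complex^('n::finite + 'm::finite) \<Rightarrow> complex^'n" where "vfst z = (\<chi> a. z $ Inl a)"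
definition vsnd :: "complex^('n::finite + 'm::finite) \<Rightarrow> complex^'m" where "vsnd z = (\<chi> k. z $ Inr k)"

lemma vpair_simps [simp]: "vfst (vpair z w) = z" "vsnd (vpair z w) = w" "vpair (vfst y) (vsnd y) = y"
  by (simp_all add: vpair_def vfst_def vsnd_def vec_eq_iff split: sum.split)

lemma prod_chart_eq: "prod_chart c d = (fst c \<times> fst d, \<lambda>(x, s). vpair (snd c x) (snd d s))"
  by (simp add: prod_chart_def vpair_def)

lemma prod_chart_sel [simp]:
  "fst (prod_chart c d) = fst c \<times> fst d" "snd (prod_chart c d) (x, s) = vpair (snd c x) (snd d s)"
  by (simp_all add: prod_chart_eq)

lemma continuous_on_vpair: "continuous_on S f \<Longrightarrow> continuous_on S g \<Longrightarrow> continuous_on S (\<lambda>x. vpair (f x) (g x))"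
  unfolding vpair_def
proof (rule continuous_on_vec_lambda)
  fix i
  assume "continuous_on S f" "continuous_on S g"
  then show "continuous_on S (\<lambda>x. case i of Inl a \<Rightarrow> f x $ a | Inr k \<Rightarrow> g x $ k)"
    by (cases i) (simp_all add: continuous_on_component)
qed

lemma continuous_on_vfst: "continuous_on S vfst" and continuous_on_vsnd: "continuous_on S vsnd"
  unfolding vfst_def vsnd_def by (intro continuous_on_vec_lambda continuous_intros)+

lemma prod_chart_image:
  "snd (prod_chart c d) ` (U \<times> V) = {z. vfst z \<in> snd c ` U \<and> vsnd z \<in> snd d ` V}"
proof (intro equalityI subsetI)
  fix z assume "z \<in> {z. vfst z \<in> snd c ` U \<and> vsnd z \<in> snd d ` V}"
  then obtain x s where "x \<in> U" "s \<in> V" "vfst z = snd c x" "vsnd z = snd d s" by blast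
  then have "z = snd (prod_chart c d) (x, s)" "(x, s) \<in> U \<times> V"
    using vpair_simps(3)[of z] by simp_all
  then show "z \<in> snd (prod_chart c d) ` (U \<times> V)" by blast
qed auto

lemma open_vsplit: "open U \<Longrightarrow> open V \<Longrightarrow> open {z. vfst z \<in> U \<and> vsnd z \<in> V}"
  using open_Int[OF open_vimage[OF _ continuous_on_vfst] open_vimage[OF _ continuous_on_vsnd], of U V]
  by (simp add: vimage_def Collect_conj_eq)

lemma prod_chart_inv:
  assumes A: "complex_manifold A" "c \<in> A" and B: "complex_manifold B" "d \<in> B"
    and z: "z \<in> snd (prod_chart c d) ` (fst c \<times> fst d)"
  shows "chart_inv (prod_chart c d) z = (chart_inv c (vfst z), chart_inv d (vsnd z))"
proof -
  obtain x s where xs: "x \<in> fst c" "s \<in> fst d" "z = vpair (snd c x) (snd d s)" using z by auto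
  have inj: "inj_on (snd (prod_chart c d)) (fst c \<times> fst d)"
  proof (rule inj_onI)
    fix p q assume pq: "p \<in> fst c \<times> fst d" "q \<in> fst c \<times> fst d"
      "snd (prod_chart c d) p = snd (prod_chart c d) q"
    obtain a b a' b' where p: "p = (a, b)" and q: "q = (a', b')" by (cases p, cases q)
    have "vpair (snd c a) (snd d b) = vpair (snd c a') (snd d b')" using pq p q by simp
    then have "snd c a = snd c a'" "snd d b = snd d b'" by (metis vpair_simps(1), metis vpair_simps(2))
    then show "p = q" using pq p q chart_inj[OF A] chart_inj[OF B] by (simp add: inj_on_eq_iff)
  qed
  have "chart_inv (prod_chart c d) (snd (prod_chart c d) (x, s)) = (x, s)"
    using inv_into_f_f[OF inj, of "(x, s)"] xs by simp
  then show ?thesis using xs chart_inv_apply(1)[OF A] chart_inv_apply(1)[OF B] by simp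
qed

lemma prod_chart_in: "c \<in> A \<Longrightarrow> d \<in> B \<Longrightarrow> prod_chart c d \<in> prod_atlas A B"
  unfolding prod_atlas_def by blast

lemma complex_manifold_prod:
  assumes A: "complex_manifold A" and B: "complex_manifold B"
  shows "complex_manifold (prod_atlas A B)"
proof -
  have cov: "\<exists>C\<in>prod_atlas A B. p \<in> fst C" for p
  proof -
    obtain x s where p: "p = (x, s)" by (cases p)
    obtain c d where "c \<in> A" "x \<in> fst c" "d \<in> B" "s \<in> fst d"
      using chart_covers[OF A, of x] chart_covers[OF B, of s] by blast
    then show ?thesis unfolding p
      by (intro bexI[of _ "prod_chart c d"] prod_chart_in) auto
  qed
  have ch: "open (fst C) \<and> open (snd C ` fst C) \<and> (\<exists>\<psi>. homeomorphism (fst C) (snd C ` fst C) (snd C) \<psi>)"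
    if Cin: "C \<in> prod_atlas A B" for C
  proof -
    obtain c d where C: "C = prod_chart c d" and c: "c \<in> A" and d: "d \<in> B"
      using Cin unfolding prod_atlas_def by blast
    have 1: "open (fst C)" using chart_open[OF A c] chart_open[OF B d] by (simp add: C open_Times)
    have im: "snd C ` fst C = {z. vfst z \<in> snd c ` fst c \<and> vsnd z \<in> snd d ` fst d}"
      by (simp add: C prod_chart_image)
    have 2: "open (snd C ` fst C)" unfolding im
      by (rule open_vsplit[OF chart_range_open[OF A c] chart_range_open[OF B d]])
    have "homeomorphism (fst C) (snd C ` fst C) (snd C) (\<lambda>z. (chart_inv c (vfst z), chart_inv d (vsnd z)))"
    proof (rule homeomorphismI)
      show "continuous_on (fst C) (snd C)"
        unfolding C prod_chart_eq fst_conv snd_conv case_prod_beta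
        by (intro continuous_on_vpair continuous_on_compose2[OF chart_cont[OF A c]]
          continuous_on_compose2[OF chart_cont[OF B d]] continuous_intros) auto
      show "continuous_on (snd C ` fst C) (\<lambda>z. (chart_inv c (vfst z), chart_inv d (vsnd z)))"
        unfolding im
        by (intro continuous_on_Pair continuous_on_compose2[OF chart_inv_cont[OF A c] continuous_on_vfst]
          continuous_on_compose2[OF chart_inv_cont[OF B d] continuous_on_vsnd]) auto
    qed (use chart_inv_apply[OF A c] chart_inv_apply[OF B d] in \<open>auto simp: C\<close>)
    with 1 2 show ?thesis by blast
  qed
  have tr: "holo_on (snd C ` (fst C \<inter> fst C')) (\<lambda>z. snd C' (chart_inv C z) $ i)"
    if Cin: "C \<in> prod_atlas A B" "C' \<in> prod_atlas A B" for C C' i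
  proof -
    obtain c d where C: "C = prod_chart c d" and c: "c \<in> A" and d: "d \<in> B"
      using Cin unfolding prod_atlas_def by blast
    obtain c' d' where C': "C' = prod_chart c' d'" and c': "c' \<in> A" and d': "d' \<in> B"
      using Cin unfolding prod_atlas_def by blast
    have int: "fst C \<inter> fst C' = (fst c \<inter> fst c') \<times> (fst d \<inter> fst d')" by (auto simp: C C')
    let ?Z = "snd C ` (fst C \<inter> fst C')"
    have Z: "?Z = {z. vfst z \<in> snd c ` (fst c \<inter> fst c') \<and> vsnd z \<in> snd d ` (fst d \<inter> fst d')}"
      unfolding int unfolding C prod_chart_image ..
    have Zo: "open ?Z" unfolding Z
      by (intro open_vsplit chart_image_open[OF A c] chart_image_open[OF B d] chart_open[OF A c'] chart_open[OF B d'])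
    have eq: "snd C' (chart_inv C z) $ i = (case i of Inl a \<Rightarrow> snd c' (chart_inv c (vfst z)) $ a
        | Inr k \<Rightarrow> snd d' (chart_inv d (vsnd z)) $ k)" if "z \<in> ?Z" for z
    proof -
      have "z \<in> snd (prod_chart c d) ` (fst c \<times> fst d)" using that by (auto simp: C C')
      from prod_chart_inv[OF A c B d this] show ?thesis by (simp add: C C' vpair_def)
    qed
    have "holo_on ?Z (\<lambda>z. case i of Inl a \<Rightarrow> snd c' (chart_inv c (vfst z)) $ a
        | Inr k \<Rightarrow> snd d' (chart_inv d (vsnd z)) $ k)"
    proof (cases i)
      case (Inl a)
      have "holo_on ?Z (\<lambda>z. snd c' (chart_inv c (vfst z)) $ a)"
        by (rule holo_on_compose[where \<phi> = vfst and f = "\<lambda>w. snd c' (chart_inv c w) $ a", OF transition_holo[OF A c c']])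
          (auto simp: Z vfst_def[of z for z] holo_on_coord)
      then show ?thesis by (simp add: Inl)
    next
      case (Inr k)
      have "holo_on ?Z (\<lambda>z. snd d' (chart_inv d (vsnd z)) $ k)"
        by (rule holo_on_compose[where \<phi> = vsnd and f = "\<lambda>w. snd d' (chart_inv d w) $ k", OF transition_holo[OF B d d']])
          (auto simp: Z vsnd_def[of z for z] holo_on_coord)
      then show ?thesis by (simp add: Inr)
    qed
    then show ?thesis
      by (subst holo_on_cong_open[OF Zo, where g = "\<lambda>z. case i of Inl a \<Rightarrow> snd c' (chart_inv c (vfst z)) $ a
        | Inr k \<Rightarrow> snd d' (chart_inv d (vsnd z)) $ k"]) (rule eq)
  qed
  show ?thesis
    unfolding complex_manifold_def
  proof (intro conjI)
    show "(\<Union>(U, \<phi>)\<in>prod_atlas A B. U) = UNIV" using cov by (auto simp: case_prod_beta)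
    show "\<forall>(U, \<phi>)\<in>prod_atlas A B. open U \<and> open (\<phi> ` U) \<and> (\<exists>\<psi>. homeomorphism U (\<phi> ` U) \<phi> \<psi>)"
      using ch by (simp add: case_prod_beta)
    show "\<forall>(U, \<phi>)\<in>prod_atlas A B. \<forall>(V, \<psi>)\<in>prod_atlas A B. \<forall>i. holo_on (\<phi> ` (U \<inter> V)) (\<lambda>z. \<psi> (inv_into U \<phi> z) $ i)"
      using tr by (simp add: case_prod_beta)
  qed
qed

lemma slice_chart:
  assumes A: "complex_manifold A" "c \<in> A" and B: "complex_manifold B" "d \<in> B" "s \<in> fst d"
  shows "z \<in> snd c ` (fst c \<inter> {x. (x, s) \<in> W}) \<Longrightarrow>
      vpair z (snd d s) \<in> snd (prod_chart c d) ` (fst (prod_chart c d) \<inter> W)"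
    and "z \<in> snd c ` (fst c \<inter> {x. (x, s) \<in> W}) \<Longrightarrow>
      chart_inv (prod_chart c d) (vpair z (snd d s)) = (chart_inv c z, s)"
proof -
  assume "z \<in> snd c ` (fst c \<inter> {x. (x, s) \<in> W})"
  then obtain x where x: "x \<in> fst c" "(x, s) \<in> W" "z = snd c x" by auto
  then have "vpair z (snd d s) = snd (prod_chart c d) (x, s)" "(x, s) \<in> fst (prod_chart c d) \<inter> W"
    using B by simp_all
  then show 1: "vpair z (snd d s) \<in> snd (prod_chart c d) ` (fst (prod_chart c d) \<inter> W)" by blast
  then have "vpair z (snd d s) \<in> snd (prod_chart c d) ` (fst c \<times> fst d)" by auto
  from prod_chart_inv[OF A B(1,2) this]
  show "chart_inv (prod_chart c d) (vpair z (snd d s)) = (chart_inv c z, s)"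
    using chart_inv_apply(1)[OF B(1,2,3)] by simp
qed

lemma open_slice: "open W \<Longrightarrow> open {x. (x, s) \<in> W}"
  using open_vimage[of W "\<lambda>x. (x, s)"] by (simp add: vimage_def continuous_on_Pair)

lemma holo_on_vpair: "holo_on Z (\<lambda>z. vpair z w $ i)"
  by (cases i) (simp_all add: vpair_def holo_on_coord)

lemma holo_fun_slice:
  assumes A: "complex_manifold A" and B: "complex_manifold B"
    and W: "open W" and f: "holo_fun (prod_atlas A B) W f"
  shows "holo_fun A {x. (x, s) \<in> W} (\<lambda>x. f (x, s))"
proof (rule holo_funI)
  fix c assume c: "c \<in> A"
  obtain d where d: "d \<in> B" "s \<in> fst d" using chart_covers[OF B] by blast
  let ?Z = "snd c ` (fst c \<inter> {x. (x, s) \<in> W})"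
  note sl = slice_chart[OF A c B d, of _ W]
  have Z: "open ?Z" by (rule chart_image_open[OF A c open_slice[OF W]])
  have "holo_on ?Z (\<lambda>z. f (chart_inv (prod_chart c d) (vpair z (snd d s))))"
    by (rule holo_on_compose[where \<phi> = "\<lambda>z. vpair z (snd d s)" and f = "\<lambda>y. f (chart_inv (prod_chart c d) y)",
        OF holo_funD[OF f prod_chart_in[OF c d(1)]] holo_on_vpair]) (use sl(1) in blast)
  then show "holo_on ?Z (\<lambda>z. f (chart_inv c z, s))"
    using holo_on_cong_open[OF Z, of "\<lambda>z. f (chart_inv (prod_chart c d) (vpair z (snd d s)))" "\<lambda>z. f (chart_inv c z, s)"] sl(2) by simp
qed

lemma smooth_fun_slice:
  assumes A: "complex_manifold A" and B: "complex_manifold B"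
    and W: "open W" and f: "smooth_fun (prod_atlas A B) W f"
  shows "smooth_fun A {x. (x, s) \<in> W} (\<lambda>x. f (x, s))"
proof (rule smooth_funI)
  fix c k assume c: "c \<in> A"
  obtain d where d: "d \<in> B" "s \<in> fst d" using chart_covers[OF B] by blast
  let ?Z = "snd c ` (fst c \<inter> {x. (x, s) \<in> W})"
  note sl = slice_chart[OF A c B d, of _ W]
  have Z: "open ?Z" by (rule chart_image_open[OF A c open_slice[OF W]])
  have Y: "open (snd (prod_chart c d) ` (fst (prod_chart c d) \<inter> W))"
    by (rule chart_image_open[OF complex_manifold_prod[OF A B] prod_chart_in[OF c d(1)] W])
  have "Ck_on k ?Z (\<lambda>z. f (chart_inv (prod_chart c d) (vpair z (snd d s))))"
    by (rule Ck_on_compose[where \<phi> = "\<lambda>z. vpair z (snd d s)" and f = "\<lambda>y. f (chart_inv (prod_chart c d) y)",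
        OF Y Z _ smooth_funD[OF f prod_chart_in[OF c d(1)]] holo_on_imp_Ck_on[OF Z holo_on_vpair]]) (use sl(1) in blast)
  then show "Ck_on k ?Z (\<lambda>z. f (chart_inv c z, s))"
    using Ck_on_cong_open[OF Z, of "\<lambda>z. f (chart_inv (prod_chart c d) (vpair z (snd d s)))" "\<lambda>z. f (chart_inv c z, s)"] sl(2) by simp
qed

lemma holo_bundle_slice:
  assumes A: "complex_manifold A" and B: "complex_manifold B" and F: "holo_bundle (prod_atlas A B) F"
  shows "holo_bundle A (restr_bundle F s)"
proof -
  have cov: "\<exists>We\<in>F. (x, s) \<in> fst We" for x
  proof -
    have "(x, s) \<in> (\<Union>(W, e)\<in>F. W)" using F by (simp add: holo_bundle_def)
    then show ?thesis by force
  qed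
  have ow: "open W" "\<And>p. p \<in> W \<Longrightarrow> invertible (e p)" if "(W, e) \<in> F" for W e
    using F that unfolding holo_bundle_def by blast+
  have "holo_fun A ({x. (x, s) \<in> W} \<inter> {x. (x, s) \<in> W'}) (\<lambda>p. (matrix_inv (e (p, s)) ** e' (p, s)) $ a $ b)"
    if "(W, e) \<in> F" "(W', e') \<in> F" for W e W' e' a b
  proof -
    have "holo_fun (prod_atlas A B) (W \<inter> W') (\<lambda>p. (matrix_inv (e p) ** e' p) $ a $ b)"
      using F that unfolding holo_bundle_def by blast
    from holo_fun_slice[OF A B _ this, of s] show ?thesis
      using ow(1)[OF that(1)] ow(1)[OF that(2)] by (simp add: Collect_conj_eq open_Int)
  qed
  note tr = this
  show ?thesis
    unfolding holo_bundle_def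
  proof (intro conjI)
    show "(\<Union>(W, e)\<in>restr_bundle F s. W) = UNIV"
    proof (intro equalityI subsetI UNIV_I)
      fix x
      obtain W e where "(W, e) \<in> F" "(x, s) \<in> W" using cov[of x] by auto
      then show "x \<in> (\<Union>(W, e)\<in>restr_bundle F s. W)" unfolding restr_bundle_def by force
    qed
    show "\<forall>(W, e)\<in>restr_bundle F s. open W \<and> (\<forall>p\<in>W. invertible (e p))"
    proof (rule ballI)
      fix We assume "We \<in> restr_bundle F s"
      then obtain W e where We: "(W, e) \<in> F" "We = ({x. (x, s) \<in> W}, \<lambda>x. e (x, s))"
        unfolding restr_bundle_def by auto
      then show "case We of (W, e) \<Rightarrow> open W \<and> (\<forall>p\<in>W. invertible (e p))"
        using ow[OF We(1)] open_slice by auto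
    qed
    show "\<forall>(W, e)\<in>restr_bundle F s. \<forall>(W', e')\<in>restr_bundle F s. \<forall>a b.
      holo_fun A (W \<inter> W') (\<lambda>p. (matrix_inv (e p) ** e' p) $ a $ b)"
      unfolding case_prod_beta
    proof (intro ballI)
      fix We We' assume "We \<in> restr_bundle F s" "We' \<in> restr_bundle F s"
      then obtain W e W' e' where We: "(W, e) \<in> F" "We = ({x. (x, s) \<in> W}, \<lambda>x. e (x, s))"
        and We': "(W', e') \<in> F" "We' = ({x. (x, s) \<in> W'}, \<lambda>x. e' (x, s))"
        unfolding restr_bundle_def by auto
      show "\<forall>a b. holo_fun A (fst We \<inter> fst We') (\<lambda>p. (matrix_inv (snd We p) ** snd We' p) $ a $ b)"
        unfolding We(2) We'(2) fst_conv snd_conv using tr[OF We(1) We'(1)] by blast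
    qed
  qed
qed

lemma bundle_metric_slice:
  assumes A: "complex_manifold A" and B: "complex_manifold B" and F: "holo_bundle (prod_atlas A B) F"
    and h: "bundle_metric (prod_atlas A B) F h"
  shows "bundle_metric A (restr_bundle F s) (restr_metric h s)"
proof -
  have "smooth_fun A {x. (x, s) \<in> W} (\<lambda>x. gram (\<lambda>x. e (x, s)) (restr_metric h s) x $ a $ b)"
    if "(W, e) \<in> F" for W e a b
  proof -
    have "open W" using F that unfolding holo_bundle_def by blast
    moreover have "smooth_fun (prod_atlas A B) W (\<lambda>p. gram e h p $ a $ b)"
      using h that unfolding bundle_metric_def by blast
    ultimately show ?thesis
      using smooth_fun_slice[OF A B, of W "\<lambda>p. gram e h p $ a $ b" s] by (simp add: gram_def restr_metric_def)
  qed
  then show ?thesis using h unfolding bundle_metric_def restr_bundle_def restr_metric_def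
    by (auto simp: case_prod_beta)
qed

section \<open>The Chern curvature in a frame\<close>

definition mdiff :: "(complex^'n \<Rightarrow> complex^'a^'b) \<Rightarrow> complex^'n \<Rightarrow> bool" where
  "mdiff M z \<longleftrightarrow> (\<forall>a b. (\<lambda>z. M z $ a $ b) differentiable (at z))"

lemma mdiff_mult: "mdiff M z \<Longrightarrow> mdiff N z \<Longrightarrow> mdiff (\<lambda>z. M z ** N z) z"
  unfolding mdiff_def matrix_matrix_mult_def by (simp add: differentiable_sum_fun differentiable_mult)

lemma mdiff_const [simp]: "mdiff (\<lambda>z. C) z"
  by (simp add: mdiff_def)

lemma mwirt_mult:
  assumes "mdiff M z" "mdiff N z"
  shows "mwirt i (\<lambda>z. M z ** N z) z = mwirt i M z ** N z + M z ** mwirt i N z"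
    and "mwirt_bar i (\<lambda>z. M z ** N z) z = mwirt_bar i M z ** N z + M z ** mwirt_bar i N z"
  using assms unfolding mdiff_def
  by (simp_all add: mwirt_def mwirt_bar_def matrix_matrix_mult_def vec_eq_iff wirt_sum wirt_mult
      differentiable_mult sum.distrib)

lemma mwirt_add:
  assumes "mdiff M z" "mdiff N z"
  shows "mwirt i (\<lambda>z. M z + N z) z = mwirt i M z + mwirt i N z"
    and "mwirt_bar i (\<lambda>z. M z + N z) z = mwirt_bar i M z + mwirt_bar i N z"
  using assms unfolding mdiff_def
  by (simp_all add: mwirt_def mwirt_bar_def vec_eq_iff wirt_add)

lemma mwirt_const [simp]: "mwirt i (\<lambda>z. C) z = 0" "mwirt_bar i (\<lambda>z. C) z = 0"
  by (simp_all add: mwirt_def mwirt_bar_def vec_eq_iff)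

lemma mwirt_cong:
  assumes "open Z" "z \<in> Z" "\<And>y. y \<in> Z \<Longrightarrow> M y = N y"
  shows "mwirt i M z = mwirt i N z" "mwirt_bar i M z = mwirt_bar i N z"
  unfolding mwirt_def mwirt_bar_def vec_eq_iff
  using wirt_cong[OF assms(1,2), of "\<lambda>y. M y $ a $ b" "\<lambda>y. N y $ a $ b" i for a b] assms(3) by simp_all

lemma mwirt_cadj:
  assumes "mdiff M z"
  shows "mwirt i (\<lambda>z. cadj (M z)) z = cadj (mwirt_bar i M z)"
    and "mwirt_bar i (\<lambda>z. cadj (M z)) z = cadj (mwirt i M z)" and "mdiff (\<lambda>z. cadj (M z)) z"
  using assms unfolding mdiff_def
  by (simp_all add: mwirt_def mwirt_bar_def cadj_def vec_eq_iff wirt_cnj differentiable_cnj)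

lemma mwirt_sandwich:
  assumes "mdiff M z" "mdiff N z"
  shows "mwirt i (\<lambda>z. sandwich (M z) (N z)) z = sandwich (mwirt i M z) (N z) + sandwich (M z) (mwirt i N z)"
    and "mwirt_bar i (\<lambda>z. sandwich (M z) (N z)) z = sandwich (mwirt_bar i M z) (N z) + sandwich (M z) (mwirt_bar i N z)"
    and "mdiff (\<lambda>z. sandwich (M z) (N z)) z"
  using assms unfolding mdiff_def
  by (simp_all add: mwirt_def mwirt_bar_def sandwich_def vec_eq_iff wirt_mult differentiable_mult)

lemma sandwich_0 [simp]: "sandwich 0 N = 0" "sandwich M 0 = 0"
  by (simp_all add: sandwich_def vec_eq_iff)

lemma sandwich_minus: "sandwich (- M) N = - sandwich M N" "sandwich M (- N) = - sandwich M N"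
  by (simp_all add: sandwich_def vec_eq_iff)

lemma ad_minus: "ad (- M) = - ad M"
  by (simp add: ad_def sandwich_minus)

lemma mwirt_bar_diff:
  assumes "mdiff M z" "mdiff N z"
  shows "mwirt_bar i (\<lambda>z. M z - N z) z = mwirt_bar i M z - mwirt_bar i N z"
proof -
  have "wirt_bar i (\<lambda>z. M z $ a $ b - N z $ a $ b) z = wirt_bar i (\<lambda>z. M z $ a $ b) z - wirt_bar i (\<lambda>z. N z $ a $ b) z" for a b
    using wirt_add(2)[of "\<lambda>z. M z $ a $ b" z "\<lambda>z. - N z $ a $ b" i] wirt_minus(2)[of "\<lambda>z. N z $ a $ b" z i] assms
    by (simp add: mdiff_def)
  then show ?thesis by (simp add: mwirt_bar_def vec_eq_iff)
qed

lemma mwirt_bar_ad: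
  assumes "mdiff M z"
  shows "mwirt_bar i (\<lambda>z. ad (M z)) z = ad (mwirt_bar i M z)"
proof -
  note s = mwirt_sandwich[OF assms mdiff_const[of "mat 1"]] mwirt_sandwich[OF mdiff_const[of "mat 1"] assms]
  show ?thesis unfolding ad_def mwirt_bar_diff[OF s(3) s(6)] s(2) s(5) by simp
qed

text \<open>Order 2 because the curvature takes two derivatives of the Gram matrix. Hermitian
  symmetry is a separate assumption of \<open>bochner\<close>.\<close>

definition smooth_gram :: "(complex^'n) set \<Rightarrow> (complex^'n \<Rightarrow> complex^'r^'r) \<Rightarrow> bool" where
  "smooth_gram Z G \<longleftrightarrow> open Z \<and> (\<forall>a b. Ck_on 2 Z (\<lambda>z. G z $ a $ b)) \<and> (\<forall>z\<in>Z. invertible (G z))"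

definition theta :: "'n \<Rightarrow> (complex^'n \<Rightarrow> complex^'r^'r) \<Rightarrow> complex^'n \<Rightarrow> complex^'r^'r" where
  "theta i G z = matrix_inv (G z) ** mwirt i G z"

definition curv :: "'n \<Rightarrow> 'n \<Rightarrow> (complex^'n \<Rightarrow> complex^'r^'r) \<Rightarrow> complex^'n \<Rightarrow> complex^'r^'r" where
  "curv i j G z = - mwirt_bar j (theta i G) z"

lemma Ck_on_imp_mdiff:
  assumes "\<And>a b. Ck_on (Suc k) Z (\<lambda>z. M z $ a $ b)" "z \<in> Z"
  shows "mdiff M z"
  using assms by (simp add: mdiff_def)

lemma smooth_gram_facts:
  assumes "smooth_gram Z G"
  shows "open Z" and "z \<in> Z \<Longrightarrow> invertible (G z)" and "z \<in> Z \<Longrightarrow> mdiff G z"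
    and "z \<in> Z \<Longrightarrow> mdiff (\<lambda>z. matrix_inv (G z)) z" and "z \<in> Z \<Longrightarrow> mdiff (mwirt i G) z"
    and "z \<in> Z \<Longrightarrow> mdiff (theta i G) z"
proof -
  have Z: "open Z" and G: "\<And>a b. Ck_on (Suc 1) Z (\<lambda>z. G z $ a $ b)" and inv: "\<And>z. z \<in> Z \<Longrightarrow> invertible (G z)"
    using assms by (simp_all add: smooth_gram_def numeral_2_eq_2)
  have Gi: "Ck_on (Suc 1) Z (\<lambda>z. matrix_inv (G z) $ a $ b)" for a b
    by (rule Ck_on_matrix_inv[OF Z G inv])
  have Gw: "Ck_on (Suc 0) Z (\<lambda>z. mwirt i G z $ a $ b)" for a b i
    using Ck_on_wirt(1)[OF Z, of "Suc 0" "\<lambda>z. G z $ a $ b" i] G by (simp add: mwirt_def del: Ck_on.simps)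
  show "open Z" by (rule Z)
  show "invertible (G z)" if "z \<in> Z" by (rule inv[OF that])
  show 1: "mdiff G z" if "z \<in> Z" by (rule Ck_on_imp_mdiff[OF G that])
  show 2: "mdiff (\<lambda>z. matrix_inv (G z)) z" if "z \<in> Z" by (rule Ck_on_imp_mdiff[OF Gi that])
  show 3: "mdiff (mwirt i G) z" if "z \<in> Z" by (rule Ck_on_imp_mdiff[OF Gw that])
  show "mdiff (theta i G) z" if "z \<in> Z"
    unfolding theta_def[abs_def] by (rule mdiff_mult[OF 2[OF that] 3[OF that]])
qed

lemma mwirt_inv:
  fixes G :: "complex^'n \<Rightarrow> complex^'r^'r"
  assumes Z: "open Z" "z \<in> Z" and inv: "\<And>z. z \<in> Z \<Longrightarrow> invertible (G z)"
    and d: "mdiff G z" "mdiff (\<lambda>z. matrix_inv (G z)) z"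
  shows "mwirt i (\<lambda>z. matrix_inv (G z)) z = - (matrix_inv (G z) ** mwirt i G z ** matrix_inv (G z))"
    and "mwirt_bar i (\<lambda>z. matrix_inv (G z)) z = - (matrix_inv (G z) ** mwirt_bar i G z ** matrix_inv (G z))"
proof -
  have e: "G y ** matrix_inv (G y) = mat 1" if "y \<in> Z" for y using matrix_inv_both inv that by blast
  have solve: "X = - (matrix_inv (G z) ** D ** matrix_inv (G z))"
    if "D ** matrix_inv (G z) + G z ** X = 0" for X D
  proof -
    have "G z ** X = - (D ** matrix_inv (G z))" using that by (simp add: eq_neg_iff_add_eq_0 add.commute)
    then have "matrix_inv (G z) ** (G z ** X) = matrix_inv (G z) ** (- (D ** matrix_inv (G z)))" by simp
    then show ?thesis using matrix_inv_cancel(2)[OF inv[OF Z(2)], of X]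
      by (simp add: matrix_mult_minus matrix_mul_assoc)
  qed
  show "mwirt i (\<lambda>z. matrix_inv (G z)) z = - (matrix_inv (G z) ** mwirt i G z ** matrix_inv (G z))"
    by (rule solve) (use mwirt_mult(1)[OF d, of i] mwirt_cong(1)[OF Z e, where i = i] in simp)
  show "mwirt_bar i (\<lambda>z. matrix_inv (G z)) z = - (matrix_inv (G z) ** mwirt_bar i G z ** matrix_inv (G z))"
    by (rule solve) (use mwirt_mult(2)[OF d, of i] mwirt_cong(2)[OF Z e, where i = i] in simp)
qed

lemma smooth_gram_subset: "smooth_gram Z G \<Longrightarrow> open Y \<Longrightarrow> Y \<subseteq> Z \<Longrightarrow> smooth_gram Y G"
  unfolding smooth_gram_def using Ck_on_subset by blast

text \<open>The gauge transformation rule: the connection matrix changes to a^{-1} \<theta> a +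
  a^{-1} d_i a. The inhomogeneous term is holomorphic, since a and its derivative are
  (\<open>holo_on_wirt\<close>), so differentiating by \<open>mwirt_bar j\<close> leaves only the
  conjugate of the curvature.\<close>

lemma curv_congruence:
  fixes G G' a :: "complex^'n \<Rightarrow> complex^'r^'r"
  assumes G: "smooth_gram Z G" and a: "\<And>k l. holo_on Z (\<lambda>z. a z $ k $ l)"
    and ainv: "\<And>z. z \<in> Z \<Longrightarrow> invertible (a z)"
    and G': "\<And>z. z \<in> Z \<Longrightarrow> G' z = cadj (a z) ** G z ** a z" and z: "z \<in> Z"
  shows "curv i j G' z = matrix_inv (a z) ** curv i j G z ** a z"
proof -
  note F = smooth_gram_facts[OF G]
  have Z: "open Z" by (rule F(1))
  have aC: "Ck_on k Z (\<lambda>z. a z $ p $ q)" for p q k by (rule holo_on_imp_Ck_on[OF Z a])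
  have ad: "mdiff a y" if "y \<in> Z" for y using Ck_on_imp_mdiff[OF aC that] .
  have aid: "mdiff (\<lambda>z. matrix_inv (a z)) y" if "y \<in> Z" for y
    by (rule Ck_on_imp_mdiff[OF Ck_on_matrix_inv[OF Z aC ainv] that])
  have ab: "mwirt_bar k a y = 0" if "y \<in> Z" for y k
    using a that by (simp add: mwirt_bar_def holo_on_iff vec_eq_iff)
  have wh: "holo_on Z (\<lambda>z. mwirt i a z $ k $ l)" for k l
    using holo_on_wirt[OF Z a, of i k l] by (simp add: mwirt_def)
  have wd: "mdiff (mwirt i a) y" if "y \<in> Z" for y
    using Ck_on_imp_mdiff[OF holo_on_imp_Ck_on[OF Z wh] that] .
  have wb: "mwirt_bar k (mwirt i a) y = 0" if "y \<in> Z" for y k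
    using wh that by (simp add: mwirt_bar_def[of _ "mwirt i a"] holo_on_iff vec_eq_iff)
  have th: "theta i G' y = matrix_inv (a y) ** theta i G y ** a y + matrix_inv (a y) ** mwirt i a y" if y: "y \<in> Z" for y
  proof -
    note cd = mwirt_cadj[OF ad[OF y]]
    have "mwirt i G' y = mwirt i (\<lambda>z. cadj (a z) ** G z ** a z) y" by (rule mwirt_cong(1)[OF Z y G'])
    also have "\<dots> = cadj (a y) ** mwirt i G y ** a y + cadj (a y) ** G y ** mwirt i a y"
      using ab[OF y, of i]
      by (simp add: mwirt_mult(1)[OF mdiff_mult[OF cd(3) F(3)[OF y]] ad[OF y]] mwirt_mult(1)[OF cd(3) F(3)[OF y]] cd(1))
        (simp add: cadj_def vec_eq_iff matrix_matrix_mult_def)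
    finally have m: "mwirt i G' y = cadj (a y) ** mwirt i G y ** a y + cadj (a y) ** G y ** mwirt i a y" .
    have ca: "invertible (cadj (a y))" by (rule cadj_inv(2)[OF ainv[OF y]])
    have ig: "matrix_inv (G' y) = matrix_inv (a y) ** (matrix_inv (G y) ** matrix_inv (cadj (a y)))"
      by (simp only: G'[OF y] matrix_inv_mult[OF matrix_inv_mult(2)[OF ca F(2)[OF y]] ainv[OF y]] matrix_inv_mult(1)[OF ca F(2)[OF y]])
    have "theta i G' y = matrix_inv (a y) ** (matrix_inv (G y) ** (matrix_inv (cadj (a y)) ** (cadj (a y) ** (mwirt i G y ** a y))))
       + matrix_inv (a y) ** (matrix_inv (G y) ** (matrix_inv (cadj (a y)) ** (cadj (a y) ** (G y ** mwirt i a y))))"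
      by (simp only: theta_def m ig matrix_add_ldistrib matrix_mul_assoc)
    also have "\<dots> = matrix_inv (a y) ** (matrix_inv (G y) ** (mwirt i G y ** a y)) + matrix_inv (a y) ** mwirt i a y"
      by (simp only: matrix_inv_cancel[OF ca] matrix_inv_cancel[OF F(2)[OF y]])
    finally show ?thesis by (simp only: theta_def matrix_mul_assoc)
  qed
  note d1 = mdiff_mult[OF aid[OF z] F(6)[OF z, of i]]
  note d2 = mdiff_mult[OF d1 ad[OF z]] mdiff_mult[OF aid[OF z] wd[OF z]]
  have ib: "mwirt_bar j (\<lambda>z. matrix_inv (a z)) z = 0"
  proof -
    have "mwirt_bar j (\<lambda>z. matrix_inv (a z)) z = - (matrix_inv (a z) ** mwirt_bar j a z ** matrix_inv (a z))"
      by (rule mwirt_inv(2)[OF Z z ainv ad[OF z] aid[OF z]])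
    also have "\<dots> = 0" unfolding ab[OF z] by (simp add: matrix_matrix_mult_def vec_eq_iff)
    finally show ?thesis .
  qed
  have "mwirt_bar j (theta i G') z = mwirt_bar j (\<lambda>y. matrix_inv (a y) ** theta i G y ** a y + matrix_inv (a y) ** mwirt i a y) z"
    by (rule mwirt_cong(2)[OF Z z th])
  also have "\<dots> = matrix_inv (a z) ** mwirt_bar j (theta i G) z ** a z"
    by (simp add: mwirt_add(2)[OF d2] mwirt_mult(2)[OF d1 ad[OF z]] mwirt_mult(2)[OF aid[OF z] F(6)[OF z]]
        mwirt_mult(2)[OF aid[OF z] wd[OF z]] ib wb[OF z] ab[OF z])
  finally show ?thesis by (simp add: curv_def matrix_mult_minus)
qed

lemma Ck_on_End_frame:
  assumes "open Z" "\<And>a b. Ck_on k Z (\<lambda>z. G z $ a $ b)" "\<And>z. z \<in> Z \<Longrightarrow> invertible (G z)"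
  shows "Ck_on k Z (\<lambda>z. End_frame (G z) $ I $ J)"
  unfolding End_frame_def sandwich_def
  using Ck_on_mult[OF assms(1) assms(2) Ck_on_matrix_inv[OF assms]] by simp

text \<open>Differentiating G and its inverse inside \<open>sandwich\<close> shows that the
  connection matrix of the induced metric is \<open>ad (theta i G y)\<close>. Since
  \<open>ad\<close> is linear with constant coefficients, it commutes with
  \<open>mwirt_bar j\<close>.\<close>

lemma curv_End:
  fixes G :: "complex^'n \<Rightarrow> complex^'r^'r"
  assumes G: "smooth_gram Z G" and z: "z \<in> Z"
  shows "curv i j (\<lambda>z. End_frame (G z)) z = ad (curv i j G z)"
proof -
  note F = smooth_gram_facts[OF G]
  have Z: "open Z" by (rule F(1))
  have th: "theta i (\<lambda>z. End_frame (G z)) y = ad (theta i G y)" if y: "y \<in> Z" for y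
  proof -
    let ?H = "matrix_inv (G y)"
    have "mwirt i (\<lambda>z. End_frame (G z)) y = sandwich (mwirt i G y) ?H - sandwich (G y) (?H ** mwirt i G y ** ?H)"
    proof -
      have "mwirt i (\<lambda>z. matrix_inv (G z)) y = - (?H ** mwirt i G y ** ?H)"
        by (rule mwirt_inv(1)[OF Z y F(2) F(3)[OF y] F(4)[OF y]])
      then show ?thesis unfolding End_frame_def mwirt_sandwich(1)[OF F(3)[OF y] F(4)[OF y]]
        by (simp only: sandwich_minus add_uminus_conv_diff)
    qed
    then have "theta i (\<lambda>z. End_frame (G z)) y
       = sandwich (?H ** mwirt i G y) (?H ** G y) - sandwich (?H ** G y) (?H ** mwirt i G y ** ?H ** G y)"
      by (simp add: theta_def End_frame_inv[OF F(2)[OF y]] matrix_mult_diff sandwich_mult matrix_mul_assoc)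
    then show ?thesis
      by (simp add: ad_def theta_def matrix_inv_both[OF F(2)[OF y]] matrix_inv_cancel(4)[OF F(2)[OF y]])
  qed
  have "mwirt_bar j (theta i (\<lambda>z. End_frame (G z))) z = mwirt_bar j (\<lambda>y. ad (theta i G y)) z"
    by (rule mwirt_cong(2)[OF Z z th])
  then show ?thesis by (simp add: curv_def mwirt_bar_ad[OF F(6)[OF z]] ad_minus)
qed

section \<open>Derivatives of vector-valued functions and the Bochner formula\<close>

definition vwirt :: "'n \<Rightarrow> (complex^'n \<Rightarrow> complex^'r) \<Rightarrow> complex^'n \<Rightarrow> complex^'r" where
  "vwirt i t z = (\<chi> a. wirt i (\<lambda>z. t z $ a) z)"

definition vwirt_bar :: "'n \<Rightarrow> (complex^'n \<Rightarrow> complex^'r) \<Rightarrow> complex^'n \<Rightarrow> complex^'r" where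
  "vwirt_bar i t z = (\<chi> a. wirt_bar i (\<lambda>z. t z $ a) z)"

definition vdiff :: "(complex^'n \<Rightarrow> complex^'r) \<Rightarrow> complex^'n \<Rightarrow> bool" where
  "vdiff t z \<longleftrightarrow> (\<forall>a. (\<lambda>z. t z $ a) differentiable (at z))"

lemma vwirt_mult:
  assumes "mdiff M z" "vdiff t z"
  shows "vwirt i (\<lambda>z. M z *v t z) z = mwirt i M z *v t z + M z *v vwirt i t z"
    and "vwirt_bar i (\<lambda>z. M z *v t z) z = mwirt_bar i M z *v t z + M z *v vwirt_bar i t z"
    and "vdiff (\<lambda>z. M z *v t z) z"
  using assms unfolding mdiff_def vdiff_def
  by (simp_all add: vwirt_def vwirt_bar_def mwirt_def mwirt_bar_def matrix_vector_mult_def vec_eq_iff wirt_sum wirt_mult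
      differentiable_mult sum.distrib differentiable_sum_fun)

lemma vwirt_add:
  assumes "vdiff t z" "vdiff u z"
  shows "vwirt_bar i (\<lambda>z. t z + u z) z = vwirt_bar i t z + vwirt_bar i u z" "vdiff (\<lambda>z. t z + u z) z"
  using assms unfolding vdiff_def by (simp_all add: vwirt_bar_def vec_eq_iff wirt_add)

lemma vwirt_cong:
  assumes "open Z" "z \<in> Z" "\<And>y. y \<in> Z \<Longrightarrow> t y = u y"
  shows "vwirt i t z = vwirt i u z" "vwirt_bar i t z = vwirt_bar i u z"
  unfolding vwirt_def vwirt_bar_def vec_eq_iff
  using wirt_cong[OF assms(1,2), of "\<lambda>y. t y $ a" "\<lambda>y. u y $ a" i for a] assms(3) by simp_all

lemma wirt_cdot:
  assumes "vdiff t z" "vdiff u z"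
  shows "wirt i (\<lambda>z. cdot (t z) (u z)) z = cdot (vwirt i t z) (u z) + cdot (t z) (vwirt_bar i u z)"
    and "wirt_bar i (\<lambda>z. cdot (t z) (u z)) z = cdot (vwirt_bar i t z) (u z) + cdot (t z) (vwirt i u z)"
  using assms unfolding vdiff_def
  by (simp_all add: cdot_def vwirt_def vwirt_bar_def wirt_sum wirt_mult wirt_cnj differentiable_cnj
      differentiable_mult sum.distrib)

text \<open>As t is holomorphic, d_i |t|^2 is the pairing of D_i t with t. The conjugate derivative
  then hits G, where hermitian symmetry gives \<open>cadj (theta j G z) ** G z\<close> and completes
  D_j t in the second slot, and hits D_i t, where it gives minus the curvature applied to t. The
  second claim links parallelism to antiholomorphy: D t = 0 means that G t has vanishing holomorphic
  derivatives.\<close>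

lemma bochner:
  fixes G :: "complex^'n \<Rightarrow> complex^'r^'r"
  assumes G: "smooth_gram Z G" and herm: "\<And>z. z \<in> Z \<Longrightarrow> cadj (G z) = G z"
    and t: "\<And>a. holo_on Z (\<lambda>z. t z $ a)" and z: "z \<in> Z"
  defines "D \<equiv> \<lambda>i z. theta i G z *v t z + vwirt i t z"
  shows "wirt_bar j (wirt i (\<lambda>z. hinner (G z) (t z) (t z))) z
      = hinner (G z) (D i z) (D j z) - hinner (G z) (curv i j G z *v t z) (t z)"
    and "vwirt i (\<lambda>z. G z *v t z) z = G z *v D i z"
proof -
  note F = smooth_gram_facts[OF G]
  have Z: "open Z" by (rule F(1))
  have td: "vdiff t y" and tb: "vwirt_bar k t y = 0" if "y \<in> Z" for y k
    using t that by (simp_all add: vdiff_def vwirt_bar_def holo_on_iff vec_eq_iff)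
  have wh: "holo_on Z (\<lambda>z. vwirt i t z $ a)" for a i
    using holo_on_wirt[OF Z t, of i a] by (simp add: vwirt_def)
  have wd: "vdiff (vwirt k t) y" and wb: "vwirt_bar l (vwirt k t) y = 0" if "y \<in> Z" for y k l
    using wh that by (simp_all add: vdiff_def vwirt_bar_def[of _ "vwirt k t"] holo_on_iff vec_eq_iff)
  have Gth: "mwirt k G y = G y ** theta k G y" if "y \<in> Z" for y k
    by (simp add: theta_def matrix_inv_cancel(1)[OF F(2)[OF that]])
  have q: "vwirt k (\<lambda>z. G z *v t z) y = G y *v D k y" if "y \<in> Z" for y k
    unfolding vwirt_mult(1)[OF F(3)[OF that] td[OF that]] Gth[OF that] D_def
    by (simp add: matrix_vector_right_distrib matrix_vector_mul_assoc)
  show "vwirt i (\<lambda>z. G z *v t z) z = G z *v D i z" by (rule q[OF z])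
  have f1: "wirt i (\<lambda>z. hinner (G z) (t z) (t z)) y = cdot (G y *v D i y) (t y)" if "y \<in> Z" for y
    unfolding hinner_cdot wirt_cdot(1)[OF vwirt_mult(3)[OF F(3)[OF that] td[OF that]] td[OF that]]
    by (simp add: q[OF that] tb[OF that])
  have tht: "vdiff (\<lambda>z. theta i G z *v t z) z" by (rule vwirt_mult(3)[OF F(6)[OF z] td[OF z]])
  have Dd: "vdiff (D i) z" unfolding D_def by (rule vwirt_add(2)[OF tht wd[OF z]])
  have Db: "vwirt_bar j (D i) z = - (curv i j G z *v t z)"
    unfolding D_def vwirt_add(1)[OF tht wd[OF z]] vwirt_mult(2)[OF F(6)[OF z] td[OF z]]
    by (simp add: wb[OF z] tb[OF z] curv_def matrix_vector_mult_def vec_eq_iff sum_negf)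
  have Gb: "mwirt_bar j G z = cadj (theta j G z) ** G z"
  proof -
    have "mwirt_bar j G z = mwirt_bar j (\<lambda>z. cadj (G z)) z"
      by (rule mwirt_cong(2)[OF Z z]) (simp add: herm)
    then show ?thesis by (simp add: mwirt_cadj(2)[OF F(3)[OF z]] Gth[OF z] cadj_mult herm[OF z])
  qed
  have "wirt_bar j (wirt i (\<lambda>z. hinner (G z) (t z) (t z))) z = wirt_bar j (\<lambda>y. cdot (G y *v D i y) (t y)) z"
    by (rule wirt_cong(2)[OF Z z f1])
  also have "\<dots> = cdot (cadj (theta j G z) *v (G z *v D i z)) (t z) + cdot (G z *v (- (curv i j G z *v t z))) (t z)
      + cdot (G z *v D i z) (vwirt j t z)"
    unfolding wirt_cdot(2)[OF vwirt_mult(3)[OF F(3)[OF z] Dd] td[OF z]] vwirt_mult(2)[OF F(3)[OF z] Dd] Gb Db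
    by (simp add: cdot_add matrix_vector_mul_assoc)
  also have "cdot (cadj (theta j G z) *v (G z *v D i z)) (t z) = cdot (G z *v D i z) (theta j G z *v t z)"
    by (simp add: cdot_cadj[of "cadj (theta j G z)"])
  also have "cdot (G z *v (- (curv i j G z *v t z))) (t z) = - hinner (G z) (curv i j G z *v t z) (t z)"
  proof -
    have "G z *v (- v) = - (G z *v v)" for v by (simp add: matrix_vector_mult_def vec_eq_iff sum_negf)
    moreover have "cdot (- v) w = - cdot v w" for v w :: "complex^'r" by (simp add: cdot_def sum_negf)
    ultimately show ?thesis by (simp add: hinner_cdot)
  qed
  moreover have Dj: "D j z = theta j G z *v t z + vwirt j t z" by (simp add: D_def)
  ultimately show "wirt_bar j (wirt i (\<lambda>z. hinner (G z) (t z) (t z))) z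
      = hinner (G z) (D i z) (D j z) - hinner (G z) (curv i j G z *v t z) (t z)"
    by (simp add: hinner_cdot[of _ "D i z"] Dj cdot_add(2))
qed

section \<open>Endomorphism bundles\<close>

lemma holo_bundleD:
  assumes "holo_bundle A E"
  shows "\<exists>W e. (W, e) \<in> E \<and> p \<in> W"
    and "(W, e) \<in> E \<Longrightarrow> open W"
    and "(W, e) \<in> E \<Longrightarrow> p \<in> W \<Longrightarrow> invertible (e p)"
    and "(W, e) \<in> E \<Longrightarrow> (W', e') \<in> E \<Longrightarrow> holo_fun A (W \<inter> W') (\<lambda>p. (matrix_inv (e p) ** e' p) $ a $ b)"
proof -
  have "p \<in> (\<Union>(W, e)\<in>E. W)" using assms by (simp add: holo_bundle_def)
  then show "\<exists>W e. (W, e) \<in> E \<and> p \<in> W" by auto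
  show "(W, e) \<in> E \<Longrightarrow> open W" using assms unfolding holo_bundle_def by blast
  show "(W, e) \<in> E \<Longrightarrow> p \<in> W \<Longrightarrow> invertible (e p)" using assms unfolding holo_bundle_def by blast
  show "(W, e) \<in> E \<Longrightarrow> (W', e') \<in> E \<Longrightarrow> holo_fun A (W \<inter> W') (\<lambda>p. (matrix_inv (e p) ** e' p) $ a $ b)"
  proof -
    assume W: "(W, e) \<in> E" and W': "(W', e') \<in> E"
    have H: "\<forall>We\<in>E. \<forall>We'\<in>E. \<forall>a b.
        holo_fun A (fst We \<inter> fst We') (\<lambda>p. (matrix_inv (snd We p) ** snd We' p) $ a $ b)"
      using assms unfolding holo_bundle_def case_prod_beta by (elim conjE)
    from bspec[OF bspec[OF H W] W']
    show ?thesis by (simp only: fst_conv snd_conv simp_thms)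
  qed
qed

lemma frame_at:
  assumes "holo_bundle A E"
  shows "\<exists>W. (W, frame_at E p) \<in> E \<and> p \<in> W"
proof -
  have "\<exists>We. We \<in> E \<and> p \<in> fst We" using holo_bundleD(1)[OF assms, of p] by force
  then have *: "(SOME We. We \<in> E \<and> p \<in> fst We) \<in> E \<and> p \<in> fst (SOME We. We \<in> E \<and> p \<in> fst We)"
    by (rule someI_ex)
  show ?thesis unfolding frame_at_def
    by (rule exI[of _ "fst (SOME We. We \<in> E \<and> p \<in> fst We)"]) (simp only: prod.collapse *)
qed

lemma bundle_metricD:
  assumes "bundle_metric A E h"
  shows "hermitian_posdef (h p)"
    and "(W, e) \<in> E \<Longrightarrow> smooth_fun A W (\<lambda>p. gram e h p $ a $ b)"
proof -
  show "hermitian_posdef (h p)" using assms unfolding bundle_metric_def by (elim conjE allE)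
  have H: "\<forall>We\<in>E. \<forall>a b. smooth_fun A (fst We) (\<lambda>p. gram (snd We) h p $ a $ b)"
    using assms unfolding bundle_metric_def case_prod_beta by (elim conjE)
  show "smooth_fun A W (\<lambda>p. gram e h p $ a $ b)" if "(W, e) \<in> E"
    using bspec[OF H that] by (simp only: fst_conv snd_conv simp_thms)
qed

lemma gram_posdef:
  assumes "hermitian_posdef (h p)" "invertible (e p)" shows "hermitian_posdef (gram e h p)"
  unfolding gram_def by (rule posdef_congruence[OF assms])

lemma smooth_gram_chart:
  assumes A: "complex_manifold A" "c \<in> A" and h: "bundle_metric A E h" and We: "(W, e) \<in> E"
    and W: "open W" "\<And>p. p \<in> W \<Longrightarrow> invertible (e p)"
  shows "smooth_gram (snd c ` (fst c \<inter> W)) (\<lambda>z. gram e h (chart_inv c z))"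
  unfolding smooth_gram_def
proof (intro conjI allI ballI)
  show "open (snd c ` (fst c \<inter> W))" by (rule chart_image_open[OF A W(1)])
  show "Ck_on 2 (snd c ` (fst c \<inter> W)) (\<lambda>z. gram e h (chart_inv c z) $ a $ b)" for a b
    using smooth_funD[OF bundle_metricD(2)[OF h We, of a b] A(2)] .
  fix z assume "z \<in> snd c ` (fst c \<inter> W)"
  then have "chart_inv c z \<in> W" using chart_inv_apply(1)[OF A] by auto
  then show "invertible (gram e h (chart_inv c z))"
    using posdef_invertible[OF gram_posdef[of h _ e, OF bundle_metricD(1)[OF h] W(2)]] by blast
qed

lemma chern_curvature_frame_at:
  "chern_curvature c E h i j p =
     frame_at E p p ** curv i j (\<lambda>z. gram (frame_at E p) h (chart_inv c z)) (snd c p) ** matrix_inv (frame_at E p p)"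
  by (simp add: chern_curvature_def curv_def theta_def[abs_def] Let_def)

lemma gram_change:
  assumes "invertible (e p :: complex^'r^'r)"
  shows "gram e' h p = cadj (matrix_inv (e p) ** e' p) ** gram e h p ** (matrix_inv (e p) ** e' p)"
proof -
  have e: "e p ** (matrix_inv (e p) ** e' p) = e' p" by (rule matrix_inv_cancel(1)[OF assms])
  have "cadj (matrix_inv (e p) ** e' p) ** gram e h p ** (matrix_inv (e p) ** e' p)
      = cadj (e p ** (matrix_inv (e p) ** e' p)) ** h p ** (e p ** (matrix_inv (e p) ** e' p))"
    by (simp only: gram_def cadj_mult matrix_mul_assoc)
  then show ?thesis unfolding e gram_def[of e'] by (rule sym)
qed

text \<open>\<open>frame_at\<close> picks an arbitrary frame at each point. The transition matrix
  from \<open>e\<close> to it is holomorphic, so the conjugation produced by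
  \<open>curv_congruence\<close> cancels against the change of the outer factors.\<close>

lemma chern_curvature_frame:
  assumes A: "complex_manifold A" "c \<in> A" and E: "holo_bundle A E" and h: "bundle_metric A E h"
    and We: "(W, e) \<in> E" and p: "p \<in> W" "p \<in> fst c"
  shows "chern_curvature c E h i j p =
     e p ** curv i j (\<lambda>z. gram e h (chart_inv c z)) (snd c p) ** matrix_inv (e p)"
proof -
  define e0 where "e0 = frame_at E p"
  obtain W0 where W0: "(W0, e0) \<in> E" "p \<in> W0" using frame_at[OF E, of p] by (auto simp: e0_def)
  note inv = holo_bundleD(3)[OF E We] and inv0 = holo_bundleD(3)[OF E W0(1)]
  note opn = holo_bundleD(2)[OF E We] holo_bundleD(2)[OF E W0(1)]
  define Z where "Z = snd c ` (fst c \<inter> (W \<inter> W0))"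
  have Z: "open Z" unfolding Z_def by (rule chart_image_open[OF A open_Int[OF opn]])
  define a where "a z = matrix_inv (e (chart_inv c z)) ** e0 (chart_inv c z)" for z
  have inW: "chart_inv c z \<in> W" "chart_inv c z \<in> W0" if "z \<in> Z" for z
    using that chart_inv_apply(1)[OF A] by (auto simp: Z_def)
  have G: "smooth_gram Z (\<lambda>z. gram e h (chart_inv c z))"
    by (rule smooth_gram_subset[OF smooth_gram_chart[OF A h We opn(1) inv] Z]) (auto simp: Z_def)
  have pz: "snd c p \<in> Z" using p W0 by (auto simp: Z_def)
  have ap: "a (snd c p) = matrix_inv (e p) ** e0 p" by (simp add: a_def chart_inv_apply(1)[OF A p(2)])
  have cv: "curv i j (\<lambda>z. gram e0 h (chart_inv c z)) (snd c p)
      = matrix_inv (a (snd c p)) ** curv i j (\<lambda>z. gram e h (chart_inv c z)) (snd c p) ** a (snd c p)"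
  proof (rule curv_congruence[OF G _ _ _ pz])
    show "holo_on Z (\<lambda>z. a z $ k $ l)" for k l
      unfolding a_def Z_def using holo_funD[OF holo_bundleD(4)[OF E We W0(1)] A(2)] .
    show "invertible (a z)" if "z \<in> Z" for z
      unfolding a_def using inv[OF inW(1)[OF that]] inv0[OF inW(2)[OF that]]
      by (simp add: matrix_inv_mult(2) invertible_matrix_inv)
    show "gram e0 h (chart_inv c z) = cadj (a z) ** gram e h (chart_inv c z) ** a z" if "z \<in> Z" for z
      unfolding a_def by (rule gram_change[of e "chart_inv c z" e0 h, OF inv[OF inW(1)[OF that]]])
  qed
  have a1: "e0 p ** matrix_inv (a (snd c p)) = e p"
    using inv[OF p(1)] inv0[OF W0(2)]
    by (simp add: ap matrix_inv_mult(1) invertible_matrix_inv matrix_inv_inv matrix_inv_cancel(1))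
  have a2: "a (snd c p) ** matrix_inv (e0 p) = matrix_inv (e p)"
    using matrix_inv_cancel(3)[OF inv0[OF W0(2)]] by (simp add: ap)
  have "e0 p ** curv i j (\<lambda>z. gram e0 h (chart_inv c z)) (snd c p) ** matrix_inv (e0 p)
    = (e0 p ** matrix_inv (a (snd c p))) ** curv i j (\<lambda>z. gram e h (chart_inv c z)) (snd c p) ** (a (snd c p) ** matrix_inv (e0 p))"
    by (simp only: cv matrix_mul_assoc)
  then have "e0 p ** curv i j (\<lambda>z. gram e0 h (chart_inv c z)) (snd c p) ** matrix_inv (e0 p)
    = e p ** curv i j (\<lambda>z. gram e h (chart_inv c z)) (snd c p) ** matrix_inv (e p)"
    by (simp only: a1 a2)
  then show ?thesis unfolding chern_curvature_frame_at e0_def .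
qed

lemma End_bundleE:
  assumes "(W, f) \<in> End_bundle E"
  obtains e where "(W, e) \<in> E" "f = (\<lambda>p. End_frame (e p))"
  using assms unfolding End_bundle_eq by auto

lemma End_bundleI: "(W, e) \<in> E \<Longrightarrow> (W, \<lambda>p. End_frame (e p)) \<in> End_bundle E"
  unfolding End_bundle_eq by force

lemma smooth_fun_cong:
  assumes A: "complex_manifold A" and W: "open W" and eq: "\<And>p. p \<in> W \<Longrightarrow> f p = g p" and g: "smooth_fun A W g"
  shows "smooth_fun A W f"
proof (rule smooth_funI)
  fix c k assume c: "c \<in> A"
  show "Ck_on k (snd c ` (fst c \<inter> W)) (\<lambda>z. f (chart_inv c z))"
    by (subst Ck_on_cong_open[OF chart_image_open[OF A c W], where g = "\<lambda>z. g (chart_inv c z)"])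
      (use eq chart_inv_apply(1)[OF A c] smooth_funD[OF g c] in auto)
qed

lemma holo_fun_cong:
  assumes A: "complex_manifold A" and W: "open W" and eq: "\<And>p. p \<in> W \<Longrightarrow> f p = g p" and g: "holo_fun A W g"
  shows "holo_fun A W f"
proof (rule holo_funI)
  fix c assume c: "c \<in> A"
  show "holo_on (snd c ` (fst c \<inter> W)) (\<lambda>z. f (chart_inv c z))"
    by (subst holo_on_cong_open[OF chart_image_open[OF A c W], where g = "\<lambda>z. g (chart_inv c z)"])
      (use eq chart_inv_apply(1)[OF A c] holo_funD[OF g c] in auto)
qed

text \<open>The transition matrix is the sandwich of e^{-1} e' and its inverse e'^{-1} e. The latter
  is a transition matrix in the other direction, so its holomorphy is part of the bundle
  structure.\<close>

lemma holo_bundle_End: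
  assumes A: "complex_manifold A" and E: "holo_bundle A E"
  shows "holo_bundle A (End_bundle E)"
proof -
  have cov: "\<exists>We\<in>End_bundle E. p \<in> fst We" for p
  proof -
    obtain W e where "(W, e) \<in> E" "p \<in> W" using holo_bundleD(1)[OF E, of p] by blast
    then show ?thesis using End_bundleI[of W e E] by force
  qed
  have ow: "open (fst We) \<and> (\<forall>p\<in>fst We. invertible (snd We p))" if We: "We \<in> End_bundle E" for We
  proof -
    obtain W f where eq: "We = (W, f)" by (cases We)
    obtain e where "(W, e) \<in> E" "f = (\<lambda>p. End_frame (e p))"
      using We unfolding eq by (rule End_bundleE)
    then show ?thesis using holo_bundleD(2,3)[OF E] by (simp add: eq invertible_End_frame)
  qed
  have tr: "holo_fun A (fst We \<inter> fst We') (\<lambda>p. (matrix_inv (snd We p) ** snd We' p) $ I $ J)"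
    if We: "We \<in> End_bundle E" and We': "We' \<in> End_bundle E" for We We' I J
  proof -
    obtain W f W' f' where eq: "We = (W, f)" "We' = (W', f')" by (cases We, cases We')
    obtain e where e: "(W, e) \<in> E" "f = (\<lambda>p. End_frame (e p))"
      using We unfolding eq by (rule End_bundleE)
    obtain e' where e': "(W', e') \<in> E" "f' = (\<lambda>p. End_frame (e' p))"
      using We' unfolding eq by (rule End_bundleE)
    have "holo_fun A (W \<inter> W') (\<lambda>p. (matrix_inv (f p) ** f' p) $ I $ J)"
    proof (rule holo_fun_cong[OF A open_Int[OF holo_bundleD(2)[OF E e(1)] holo_bundleD(2)[OF E e'(1)]]])
      show "(matrix_inv (f p) ** f' p) $ I $ J =
          (matrix_inv (e p) ** e' p) $ fst I $ fst J * (matrix_inv (e' p) ** e p) $ snd J $ snd I"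
        if "p \<in> W \<inter> W'" for p
      proof -
        have "invertible (e p)" using holo_bundleD(3)[OF E e(1)] that by auto
        then have "matrix_inv (f p) ** f' p = sandwich (matrix_inv (e p) ** e' p) (matrix_inv (e' p) ** e p)"
          by (simp only: e e' End_frame_inv) (simp only: End_frame_def sandwich_mult)
        then show ?thesis by (simp add: sandwich_def)
      qed
      show "holo_fun A (W \<inter> W') (\<lambda>p. (matrix_inv (e p) ** e' p) $ fst I $ fst J * (matrix_inv (e' p) ** e p) $ snd J $ snd I)"
      proof (rule holo_funI)
        fix c assume c: "c \<in> A"
        have "holo_fun A (W \<inter> W') (\<lambda>p. (matrix_inv (e' p) ** e p) $ snd J $ snd I)"
          using holo_bundleD(4)[OF E e'(1) e(1)] by (simp only: Int_commute)
        then show "holo_on (snd c ` (fst c \<inter> (W \<inter> W')))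
          (\<lambda>z. (matrix_inv (e (chart_inv c z)) ** e' (chart_inv c z)) $ fst I $ fst J *
               (matrix_inv (e' (chart_inv c z)) ** e (chart_inv c z)) $ snd J $ snd I)"
          by (intro holo_on_mult holo_funD[OF holo_bundleD(4)[OF E e(1) e'(1)] c] holo_funD[OF _ c])
      qed
    qed
    then show ?thesis by (simp add: eq)
  qed
  show ?thesis unfolding holo_bundle_def case_prod_beta
  proof (intro conjI ballI allI)
    show "(\<Union>We\<in>End_bundle E. fst We) = UNIV" using cov by blast
    fix We assume We: "We \<in> End_bundle E"
    show "open (fst We)" using ow[OF We] ..
    show "invertible (snd We p)" if "p \<in> fst We" for p using ow[OF We] that by blast
    show "holo_fun A (fst We \<inter> fst We') (\<lambda>p. (matrix_inv (snd We p) ** snd We' p) $ I $ J)"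
      if "We' \<in> End_bundle E" for We' I J by (rule tr[OF We that])
  qed
qed

lemma bundle_metric_End:
  assumes A: "complex_manifold A" and h: "bundle_metric A E h"
    and W: "\<And>W e. (W, e) \<in> E \<Longrightarrow> open W" "\<And>W e p. (W, e) \<in> E \<Longrightarrow> p \<in> W \<Longrightarrow> invertible (e p)"
  shows "bundle_metric A (End_bundle E) (End_metric h)"
proof -
  have eq: "End_metric h p = End_frame (h p)" for p by (simp add: End_metric_eq End_frame_def)
  have pd: "hermitian_posdef (End_metric h p)" for p
    unfolding eq by (rule End_frame_posdef[OF bundle_metricD(1)[OF h]])
  have "smooth_fun A W (\<lambda>p. gram f (End_metric h) p $ I $ J)" if Wf: "(W, f) \<in> End_bundle E" for W f I J
  proof -
    obtain e where e: "(W, e) \<in> E" "f = (\<lambda>p. End_frame (e p))" using Wf by (rule End_bundleE)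
    have "smooth_fun A W (\<lambda>p. End_frame (gram e h p) $ I $ J)"
    proof (rule smooth_funI)
      fix c k assume c: "c \<in> A"
      have sg: "smooth_gram (snd c ` (fst c \<inter> W)) (\<lambda>z. gram e h (chart_inv c z))"
        by (rule smooth_gram_chart[OF A c h e(1) W(1)[OF e(1)] W(2)[OF e(1)]])
      show "Ck_on k (snd c ` (fst c \<inter> W)) (\<lambda>z. End_frame (gram e h (chart_inv c z)) $ I $ J)"
        by (rule Ck_on_End_frame[OF smooth_gram_facts(1)[OF sg] smooth_funD[OF bundle_metricD(2)[OF h e(1)] c] smooth_gram_facts(2)[OF sg]])
    qed
    moreover have "gram f (End_metric h) p $ I $ J = End_frame (gram e h p) $ I $ J" if "p \<in> W" for p
      unfolding e(2) gram_End[of e p h, OF W(2)[OF e(1) that] posdef_invertible[OF bundle_metricD(1)[OF h]]] ..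
    ultimately show ?thesis by (intro smooth_fun_cong[OF A W(1)[OF e(1)], of "\<lambda>p. gram f (End_metric h) p $ I $ J" "\<lambda>p. End_frame (gram e h p) $ I $ J"])
  qed
  note sm = this
  show ?thesis unfolding bundle_metric_def case_prod_beta
  proof (intro conjI ballI allI pd)
    fix We I J assume "We \<in> End_bundle E"
    then show "smooth_fun A (fst We) (\<lambda>p. gram (snd We) (End_metric h) p $ I $ J)"
      using sm[of "fst We" "snd We" I J] by simp
  qed
qed

lemma curv_cong:
  assumes "open Z" "z \<in> Z" "\<And>y. y \<in> Z \<Longrightarrow> G y = G' y"
  shows "curv i j G z = curv i j G' z"
proof -
  have "theta i G y = theta i G' y" if "y \<in> Z" for y
  proof -
    have "mwirt i G y = mwirt i G' y" by (rule mwirt_cong(1)[OF assms(1) that assms(3)])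
    then show ?thesis by (simp only: theta_def assms(3)[OF that])
  qed
  from mwirt_cong(2)[OF assms(1,2) this] show ?thesis unfolding curv_def by simp
qed

lemma curv_gram_End:
  assumes A: "complex_manifold A" "c \<in> A" and h: "bundle_metric A E h" and We: "(W, e) \<in> E"
    and W: "open W" "\<And>p. p \<in> W \<Longrightarrow> invertible (e p)" and p: "p \<in> W" "p \<in> fst c"
  shows "curv i j (\<lambda>z. gram (\<lambda>p. End_frame (e p)) (End_metric h) (chart_inv c z)) (snd c p)
     = ad (curv i j (\<lambda>z. gram e h (chart_inv c z)) (snd c p))"
proof -
  have sg: "smooth_gram (snd c ` (fst c \<inter> W)) (\<lambda>z. gram e h (chart_inv c z))"
    by (rule smooth_gram_chart[OF A h We W])
  have pz: "snd c p \<in> snd c ` (fst c \<inter> W)" using p by auto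
  have "curv i j (\<lambda>z. gram (\<lambda>p. End_frame (e p)) (End_metric h) (chart_inv c z)) (snd c p)
     = curv i j (\<lambda>z. End_frame (gram e h (chart_inv c z))) (snd c p)"
  proof (rule curv_cong[OF smooth_gram_facts(1)[OF sg] pz])
    fix y assume "y \<in> snd c ` (fst c \<inter> W)"
    then have "chart_inv c y \<in> W" using chart_inv_apply(1)[OF A] by auto
    then show "gram (\<lambda>p. End_frame (e p)) (End_metric h) (chart_inv c y) = End_frame (gram e h (chart_inv c y))"
      using gram_End[of e "chart_inv c y" h] W(2) posdef_invertible[OF bundle_metricD(1)[OF h]] by simp
  qed
  also have "\<dots> = ad (curv i j (\<lambda>z. gram e h (chart_inv c z)) (snd c p))" by (rule curv_End[OF sg pz])
  finally show ?thesis .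
qed

text \<open>Two atlases: the chart and the smoothness of the metric belong to \<open>A\<close>,
  which may be enlarged, while the bundle is known to be holomorphic over \<open>A0\<close>. The
  frame chosen by \<open>frame_at\<close> for End(E) is itself induced from a frame of E, so the
  computation stays in that frame and exhibits the curvature as some commutator.\<close>

lemma chern_curvature_End_ad:
  assumes A: "complex_manifold A" "c \<in> A" and h: "bundle_metric A E h"
    and E: "holo_bundle A0 E" and p: "p \<in> fst c" and E2: "holo_bundle A0 (End_bundle E)"
  shows "\<exists>M. chern_curvature c (End_bundle E) (End_metric h) i j p = ad M"
proof -
  obtain W where W: "(W, frame_at (End_bundle E) p) \<in> End_bundle E" "p \<in> W" using frame_at[OF E2] by blast
  obtain e where e: "(W, e) \<in> E" "frame_at (End_bundle E) p = (\<lambda>p. End_frame (e p))"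
    using W(1) by (rule End_bundleE)
  have cv: "curv i j (\<lambda>z. gram (\<lambda>p. End_frame (e p)) (End_metric h) (chart_inv c z)) (snd c p)
     = ad (curv i j (\<lambda>z. gram e h (chart_inv c z)) (snd c p))"
    by (rule curv_gram_End[OF A h e(1) holo_bundleD(2)[OF E e(1)] holo_bundleD(3)[OF E e(1)] W(2) p])
  show ?thesis
    unfolding chern_curvature_frame_at e(2) cv ad_conj[OF holo_bundleD(3)[OF E e(1) W(2)]]
    by (rule exI, rule refl)
qed

lemma chern_curvature_End:
  assumes A: "complex_manifold A" "c \<in> A" and E: "holo_bundle A E" and h: "bundle_metric A E h"
    and p: "p \<in> fst c"
  shows "chern_curvature c (End_bundle E) (End_metric h) i j p = ad (chern_curvature c E h i j p)"
proof -
  obtain W e where We: "(W, e) \<in> E" "p \<in> W" using holo_bundleD(1)[OF E, of p] by blast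
  note W = holo_bundleD(2)[OF E We(1)] holo_bundleD(3)[OF E We(1)]
  have h2: "bundle_metric A (End_bundle E) (End_metric h)"
    by (rule bundle_metric_End[OF A(1) h]) (use holo_bundleD(2,3)[OF E] in blast)+
  have cv: "curv i j (\<lambda>z. gram (\<lambda>p. End_frame (e p)) (End_metric h) (chart_inv c z)) (snd c p)
     = ad (curv i j (\<lambda>z. gram e h (chart_inv c z)) (snd c p))"
    by (rule curv_gram_End[OF A h We(1) W We(2) p])
  show ?thesis
    unfolding chern_curvature_frame[OF A E h We p]
      chern_curvature_frame[OF A holo_bundle_End[OF A(1) E] h2 End_bundleI[OF We(1)] We(2) p]
      cv ad_conj[OF W(2)[OF We(2)]] ..
qed

lemma mat_mult_entry: "(mat c ** M) $ a $ b = c * (M :: complex^'r^'r) $ a $ b"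
proof -
  have "(mat c ** M) $ a $ b = (\<Sum>k\<in>UNIV. if k = a then c * M $ a $ b else 0)"
    unfolding matrix_matrix_mult_def vec_lambda_beta by (rule sum.cong) (auto simp: mat_def)
  then show ?thesis by simp
qed

lemma ad_entry: "ad M $ I $ J = M $ fst I $ fst J * (mat 1 :: complex^'r^'r) $ snd J $ snd I
    - (mat 1 :: complex^'r^'r) $ fst I $ fst J * (M :: complex^'r^'r) $ snd J $ snd I"
  by (simp add: ad_def sandwich_def)

lemma ad_mat_mult: "ad (mat c ** M) = mat c ** ad M"
  unfolding vec_eq_iff
proof (intro allI)
  fix I J
  show "ad (mat c ** M) $ I $ J = (mat c ** ad M) $ I $ J"
    unfolding mat_mult_entry ad_entry by (simp only: right_diff_distrib mult.assoc mult.left_commute)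
qed

lemma ad_add: "ad (M + N) = ad M + ad N"
  unfolding vec_eq_iff
proof (intro allI)
  fix I J
  show "ad (M + N) $ I $ J = (ad M + ad N) $ I $ J"
    unfolding vector_add_component ad_entry by (simp only: ring_distribs) simp
qed

lemma ad_0 [simp]: "ad 0 = 0"
  by (simp add: ad_def)

lemma ad_sum: "ad (\<Sum>k\<in>K. M k) = (\<Sum>k\<in>K. ad (M k))"
  by (induction K rule: infinite_finite_induct) (simp_all add: ad_add)

text \<open>The contraction passes through the linear map \<open>ad\<close>, which kills
  \<open>mat \<kappa>\<close>. The constant becomes 0 on End(E), and a second application keeps it 0
  on End(End(E)).\<close>

lemma hermite_einstein_End:
  assumes A: "complex_manifold A" and E: "holo_bundle A E" and h: "bundle_metric A E h"
    and he: "\<And>c x. c \<in> A \<Longrightarrow> x \<in> fst c \<Longrightarrow>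
        (\<Sum>\<alpha>\<in>UNIV. \<Sum>\<beta>\<in>UNIV. mat (matrix_inv (g c x) $ \<beta> $ \<alpha>) ** chern_curvature c E h \<alpha> \<beta> x) = mat \<kappa>"
    and c: "c \<in> A" "x \<in> fst c"
  shows "(\<Sum>\<alpha>\<in>UNIV. \<Sum>\<beta>\<in>UNIV. mat (matrix_inv (g c x) $ \<beta> $ \<alpha>) **
      chern_curvature c (End_bundle E) (End_metric h) \<alpha> \<beta> x) = mat 0"
proof -
  have "(\<Sum>\<alpha>\<in>UNIV. \<Sum>\<beta>\<in>UNIV. mat (matrix_inv (g c x) $ \<beta> $ \<alpha>) **
      chern_curvature c (End_bundle E) (End_metric h) \<alpha> \<beta> x)
    = ad (\<Sum>\<alpha>\<in>UNIV. \<Sum>\<beta>\<in>UNIV. mat (matrix_inv (g c x) $ \<beta> $ \<alpha>) ** chern_curvature c E h \<alpha> \<beta> x)"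
    by (simp only: chern_curvature_End[OF A c(1) E h c(2)] ad_sum ad_mat_mult)
  then show ?thesis by (simp only: he[OF c] ad_mat mat_0)
qed

section \<open>The strong maximum principle\<close>

text \<open>The derivative vanishes at 0; if c were positive, it would be positive just to the
  right, and the mean value theorem would push \<phi> above its maximum.\<close>

lemma second_derivative_max:
  fixes \<phi> :: "real \<Rightarrow> real"
  assumes d: "d > 0" and \<phi>: "\<And>t. \<bar>t\<bar> < d \<Longrightarrow> (\<phi> has_real_derivative \<phi>' t) (at t)"
    and c: "(\<phi>' has_real_derivative c) (at 0)" and max: "\<And>t. \<bar>t\<bar> < d \<Longrightarrow> \<phi> t \<le> \<phi> 0"
  shows "c \<le> 0"
proof (rule ccontr)
  assume "\<not> c \<le> 0"
  then have "c > 0" by simp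
  have z: "\<phi>' 0 = 0"
    by (rule DERIV_local_max[OF \<phi>[of 0] d]) (use d max in \<open>auto simp: abs_minus_commute\<close>)
  obtain e where e: "e > 0" "\<And>h. 0 < h \<Longrightarrow> h < e \<Longrightarrow> \<phi>' 0 < \<phi>' (0 + h)"
    using DERIV_pos_inc_right[OF c \<open>c > 0\<close>] by auto
  define h where "h = min d e / 2"
  have h: "0 < h" "h < d" "h < e" using d e by (auto simp: h_def)
  obtain \<xi> where \<xi>: "0 < \<xi>" "\<xi> < h" "\<phi> h - \<phi> 0 = (h - 0) * \<phi>' \<xi>"
    using MVT2[OF h(1), of \<phi> \<phi>'] \<phi> h by force
  have "\<phi>' \<xi> > 0" using e(2)[of \<xi>] \<xi> h z by simp
  then have "\<phi> h > \<phi> 0" using \<xi> h by (smt (verit) mult_pos_pos)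
  then show False using max[of h] h by simp
qed

text \<open>Only the real part of \<open>k\<close> has to be the derivative of \<open>f\<close>
  along \<open>v\<close>. This freedom lets \<open>levi_max\<close> take complex expressions built
  from \<open>wirt \<alpha> f\<close> for \<open>k\<close>.\<close>

lemma max_directional:
  fixes f k :: "complex^'n \<Rightarrow> complex"
  assumes Z: "open Z" "z \<in> Z" and f: "\<And>y. y \<in> Z \<Longrightarrow> f differentiable (at y)"
    and max: "\<And>y. y \<in> Z \<Longrightarrow> Re (f y) \<le> Re (f z)"
    and k: "\<And>y. y \<in> Z \<Longrightarrow> Re (frechet_derivative f (at y) v) = Re (k y)" and kd: "k differentiable (at z)"
  shows "Re (frechet_derivative k (at z) v) \<le> 0"
proof -
  obtain r where r: "r > 0" "ball z r \<subseteq> Z" using Z open_contains_ball by blast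
  define d where "d = r / (norm v + 1)"
  have nv: "norm v + 1 > 0" by (smt (verit) norm_ge_zero)
  have d: "d > 0" using r nv by (simp add: d_def)
  have inZ: "z + t *\<^sub>R v \<in> Z" if "\<bar>t\<bar> < d" for t
  proof -
    have "\<bar>t\<bar> * norm v \<le> \<bar>t\<bar> * (norm v + 1)" by (intro mult_left_mono) auto
    also have "\<dots> < r" using that nv by (simp add: d_def pos_less_divide_eq)
    finally have "z + t *\<^sub>R v \<in> ball z r" by (simp add: dist_norm)
    then show ?thesis using r by blast
  qed
  have line: "((\<lambda>t. z + t *\<^sub>R v) has_derivative (\<lambda>h. h *\<^sub>R v)) (at t)" for t
    by (auto intro!: derivative_eq_intros)
  have chain: "((\<lambda>t. Re (g (z + t *\<^sub>R v))) has_real_derivative Re (frechet_derivative g (at (z + t *\<^sub>R v)) v)) (at t)"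
    if g: "g differentiable (at (z + t *\<^sub>R v))" for g :: "complex^'n \<Rightarrow> complex" and t
  proof -
    have gd: "(g has_derivative frechet_derivative g (at (z + t *\<^sub>R v))) (at (z + t *\<^sub>R v))"
      using g by (simp only: frechet_derivative_works)
    have l: "linear (frechet_derivative g (at (z + t *\<^sub>R v)))" by (rule has_derivative_linear[OF gd])
    have "((\<lambda>t. g (z + t *\<^sub>R v)) has_derivative (\<lambda>h. frechet_derivative g (at (z + t *\<^sub>R v)) (h *\<^sub>R v))) (at t)"
      using diff_chain_at[OF line gd] by (simp only: o_def)
    then have "((\<lambda>t. Re (g (z + t *\<^sub>R v))) has_derivative (\<lambda>h. Re (frechet_derivative g (at (z + t *\<^sub>R v)) (h *\<^sub>R v)))) (at t)"
      by (rule bounded_linear.has_derivative[OF bounded_linear_Re])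
    moreover have "(\<lambda>h. Re (frechet_derivative g (at (z + t *\<^sub>R v)) (h *\<^sub>R v))) = (*) (Re (frechet_derivative g (at (z + t *\<^sub>R v)) v))"
      by (rule ext) (simp add: linear_scale[OF l])
    ultimately show ?thesis unfolding has_field_derivative_def by simp
  qed
  show ?thesis
  proof (rule second_derivative_max[OF d])
    show "((\<lambda>t. Re (f (z + t *\<^sub>R v))) has_real_derivative Re (k (z + t *\<^sub>R v))) (at t)" if "\<bar>t\<bar> < d" for t
      using chain[OF f[OF inZ[OF that]]] unfolding k[OF inZ[OF that]] .
    show "((\<lambda>t. Re (k (z + t *\<^sub>R v))) has_real_derivative Re (frechet_derivative k (at z) v)) (at 0)"
      using chain[of k 0] kd by simp
    show "Re (f (z + t *\<^sub>R v)) \<le> Re (f (z + 0 *\<^sub>R v))" if "\<bar>t\<bar> < d" for t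
      using max[OF inZ[OF that]] by simp
  qed
qed

lemma frechet_derivative_smult_i: "frechet_derivative u (at z) (\<i> *s w) = \<i> * (\<Sum>i\<in>UNIV. w$i * wirt i u z) - \<i> * (\<Sum>i\<in>UNIV. cnj (w$i) * wirt_bar i u z)"
  if "u differentiable (at z)"
  unfolding frechet_wirt[OF that]
  by (simp add: sum.distrib sum_distrib_left sum_subtractf sum_negf mult.assoc)

text \<open>Half of the second derivatives along w and along i w are Re (A + B) and Re (B - A), with
  A the holomorphic Hessian and B the Levi form. Both are nonpositive at a maximum; in their sum A
  cancels and Re B remains.\<close>

lemma levi_max:
  fixes f :: "complex^'n \<Rightarrow> complex"
  assumes Z: "open Z" "z \<in> Z" and f: "\<And>y. y \<in> Z \<Longrightarrow> f differentiable (at y)"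
    and fd: "\<And>\<alpha>. wirt \<alpha> f differentiable (at z)" and real: "\<And>y. y \<in> Z \<Longrightarrow> Im (f y) = 0"
    and max: "\<And>y. y \<in> Z \<Longrightarrow> Re (f y) \<le> Re (f z)"
  shows "Re (\<Sum>\<alpha>\<in>UNIV. \<Sum>\<beta>\<in>UNIV. w $ \<alpha> * cnj (w $ \<beta>) * wirt_bar \<beta> (wirt \<alpha> f) z) \<le> 0"
proof -
  define u where "u y = (\<Sum>\<alpha>\<in>UNIV. w $ \<alpha> * wirt \<alpha> f y)" for y
  have ud: "u differentiable (at z)" unfolding u_def[abs_def]
    by (intro differentiable_sum_fun differentiable_mult differentiable_const fd)
  have conj: "wirt_bar \<alpha> f y = cnj (wirt \<alpha> f y)" if y: "y \<in> Z" for \<alpha> y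
  proof -
    have "wirt_bar \<alpha> f y = wirt_bar \<alpha> (\<lambda>y. cnj (f y)) y"
      by (rule wirt_cong(2)[OF Z(1) y]) (simp add: complex_eq_iff real)
    then show ?thesis by (simp add: wirt_cnj(2)[OF f[OF y]])
  qed
  have k1: "Re (frechet_derivative f (at y) w) = Re (2 * u y)" if y: "y \<in> Z" for y
    unfolding frechet_wirt[OF f[OF y]] conj[OF y] u_def
    by (simp add: sum.distrib Re_sum sum_distrib_left)
  have k2: "Re (frechet_derivative f (at y) (\<i> *s w)) = Re (2 * \<i> * u y)" if y: "y \<in> Z" for y
  proof -
    have "(\<Sum>i\<in>UNIV. cnj (w $ i) * wirt_bar i f y) = cnj (u y)" by (simp add: conj[OF y] u_def)
    then show ?thesis unfolding frechet_derivative_smult_i[OF f[OF y]] by (simp add: u_def[symmetric])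
  qed
  define A where "A = (\<Sum>i\<in>UNIV. w$i * wirt i u z)"
  define B where "B = (\<Sum>i\<in>UNIV. cnj (w$i) * wirt_bar i u z)"
  have fk: "frechet_derivative (\<lambda>y. c * u y) (at z) v = c * frechet_derivative u (at z) v" for c v
    using frechet_mult[OF differentiable_const[of c] ud] by simp
  have "Re (frechet_derivative (\<lambda>y. 2 * u y) (at z) w) \<le> 0"
    by (rule max_directional[OF Z f max k1]) (simp_all add: differentiable_mult ud)
  moreover have "Re (frechet_derivative (\<lambda>y. 2 * \<i> * u y) (at z) (\<i> *s w)) \<le> 0"
    by (rule max_directional[OF Z f max k2]) (simp_all add: differentiable_mult ud)
  moreover have "frechet_derivative u (at z) w = A + B"
    by (simp add: frechet_wirt[OF ud] A_def B_def sum.distrib)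
  moreover have "frechet_derivative u (at z) (\<i> *s w) = \<i> * A - \<i> * B"
    by (simp add: frechet_derivative_smult_i[OF ud] A_def B_def)
  ultimately have "Re B \<le> 0" unfolding fk by simp
  moreover have "B = (\<Sum>\<alpha>\<in>UNIV. \<Sum>\<beta>\<in>UNIV. w $ \<alpha> * cnj (w $ \<beta>) * wirt_bar \<beta> (wirt \<alpha> f) z)"
  proof -
    have "wirt_bar \<beta> u z = (\<Sum>\<alpha>\<in>UNIV. w $ \<alpha> * wirt_bar \<beta> (wirt \<alpha> f) z)" for \<beta>
      unfolding u_def[abs_def]
      by (subst wirt_sum(2)) (simp_all add: differentiable_mult fd wirt_cmult(2)[OF fd])
    then have "B = (\<Sum>\<beta>\<in>UNIV. \<Sum>\<alpha>\<in>UNIV. w $ \<alpha> * cnj (w $ \<beta>) * wirt_bar \<beta> (wirt \<alpha> f) z)"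
      by (simp add: B_def sum_distrib_left mult_ac)
    also have "\<dots> = (\<Sum>\<alpha>\<in>UNIV. \<Sum>\<beta>\<in>UNIV. w $ \<alpha> * cnj (w $ \<beta>) * wirt_bar \<beta> (wirt \<alpha> f) z)"
      by (rule sum.swap)
    finally show ?thesis .
  qed
  ultimately show ?thesis by simp
qed

text \<open>\<open>P\<close> stands for the inverse metric at one point, whence the order of its
  indices; it is kept as a constant matrix so that the operator is evaluated point by point.\<close>

definition lap :: "complex^'n^'n \<Rightarrow> (complex^'n \<Rightarrow> complex) \<Rightarrow> complex^'n \<Rightarrow> complex" where
  "lap P f z = (\<Sum>\<alpha>\<in>UNIV. \<Sum>\<beta>\<in>UNIV. P $ \<beta> $ \<alpha> * wirt_bar \<beta> (wirt \<alpha> f) z)"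

text \<open>The factorization of \<open>P\<close> writes the operator as a sum of Levi forms, one
  for each conjugated column of \<open>N\<close>.\<close>

lemma lap_max:
  fixes f :: "complex^'n \<Rightarrow> complex"
  assumes Z: "open Z" "z \<in> Z" and f: "\<And>y. y \<in> Z \<Longrightarrow> f differentiable (at y)"
    and fd: "\<And>\<alpha>. wirt \<alpha> f differentiable (at z)" and real: "\<And>y. y \<in> Z \<Longrightarrow> Im (f y) = 0"
    and max: "\<And>y. y \<in> Z \<Longrightarrow> Re (f y) \<le> Re (f z)" and P: "gram_factor P"
  shows "Re (lap P f z) \<le> 0"
proof -
  obtain N :: "complex^'n^'n" where N: "\<And>a b. P $ a $ b = (\<Sum>m\<in>UNIV. N $ a $ m * cnj (N $ b $ m))"
    using P unfolding gram_factor_def by blast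
  define w where "w m = (\<chi> \<alpha>. cnj (N $ \<alpha> $ m))" for m
  define X where "X m \<alpha> \<beta> = w m $ \<alpha> * cnj (w m $ \<beta>) * wirt_bar \<beta> (wirt \<alpha> f) z" for m \<alpha> \<beta>
  have "lap P f z = (\<Sum>\<alpha>\<in>UNIV. \<Sum>\<beta>\<in>UNIV. \<Sum>m\<in>UNIV. X m \<alpha> \<beta>)"
    by (simp add: lap_def N X_def w_def sum_distrib_left sum_distrib_right mult_ac)
  also have "\<dots> = (\<Sum>\<alpha>\<in>UNIV. \<Sum>m\<in>UNIV. \<Sum>\<beta>\<in>UNIV. X m \<alpha> \<beta>)"
    by (intro sum.cong refl sum.swap)
  also have "\<dots> = (\<Sum>m\<in>UNIV. \<Sum>\<alpha>\<in>UNIV. \<Sum>\<beta>\<in>UNIV. X m \<alpha> \<beta>)" by (rule sum.swap)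
  finally have "Re (lap P f z) = (\<Sum>m\<in>UNIV. Re (\<Sum>\<alpha>\<in>UNIV. \<Sum>\<beta>\<in>UNIV. X m \<alpha> \<beta>))" by simp
  also have "\<dots> \<le> 0"
    by (rule sum_nonpos) (use levi_max[OF Z f fd real max] in \<open>simp only: X_def\<close>)
  finally show ?thesis .
qed

text \<open>The barrier function of Hopf's argument.\<close>

definition gauss :: "real \<Rightarrow> complex^'n \<Rightarrow> complex^'n \<Rightarrow> complex" where
  "gauss a p y = exp (of_real (- a) * cdot (y - p) (y - p))"

lemma wirt_exp:
  assumes "g differentiable (at z)"
  shows "wirt i (\<lambda>z. exp (g z)) z = exp (g z) * wirt i g z"
    and "wirt_bar i (\<lambda>z. exp (g z)) z = exp (g z) * wirt_bar i g z"
    and "(\<lambda>z. exp (g z)) differentiable (at z)"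
proof -
  have "(g has_derivative frechet_derivative g (at z)) (at z)" using assms by (simp only: frechet_derivative_works)
  from diff_chain_at[OF this DERIV_exp[unfolded has_field_derivative_def]]
  have d: "((\<lambda>z. exp (g z)) has_derivative (\<lambda>v. exp (g z) * frechet_derivative g (at z) v)) (at z)"
    by (simp only: o_def)
  show "wirt i (\<lambda>z. exp (g z)) z = exp (g z) * wirt i g z"
    "wirt_bar i (\<lambda>z. exp (g z)) z = exp (g z) * wirt_bar i g z"
    unfolding wirt_eqI[OF d] by (simp_all add: wirt_def wirt_bar_def algebra_simps)
  show "(\<lambda>z. exp (g z)) differentiable (at z)" using d unfolding differentiable_def by blast
qed

lemma wirt_coord: "wirt i (\<lambda>y. y $ a - c) z = (if a = i then 1 else 0)" "wirt_bar i (\<lambda>y. y $ a - c) z = 0"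
  "(\<lambda>y. y $ a - c) differentiable (at z)" for z :: "complex^'n"
proof -
  have "bounded_linear (\<lambda>z::complex^'n. z $ a)" by (rule bounded_linear_vec_nth)
  from has_derivative_diff[OF bounded_linear_imp_has_derivative[OF this] has_derivative_const[of c]]
  have d: "((\<lambda>z::complex^'n. z $ a - c) has_derivative (\<lambda>v. v $ a - 0)) (at z)" .
  show "wirt i (\<lambda>y. y $ a - c) z = (if a = i then 1 else 0)" "wirt_bar i (\<lambda>y. y $ a - c) z = 0"
    by (simp_all add: wirt_eqI[OF d] axis_def)
  show "(\<lambda>y. y $ a - c) differentiable (at z)" using d unfolding differentiable_def by blast
qed

lemma wirt_gauss:
  fixes p :: "complex^'n"
  shows "gauss a p differentiable (at z)"
    and "wirt \<alpha> (gauss a p) = (\<lambda>y. of_real (- a) * (cnj (y $ \<alpha> - p $ \<alpha>) * gauss a p y))"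
    and "wirt \<alpha> (gauss a p) differentiable (at z)"
    and "wirt_bar \<beta> (wirt \<alpha> (gauss a p)) z =
      (of_real (- a) * (if \<alpha> = \<beta> then 1 else 0) + of_real (a * a) * (cnj (z $ \<alpha> - p $ \<alpha>) * (z $ \<beta> - p $ \<beta>))) * gauss a p z"
proof -
  have vd: "vdiff (\<lambda>y. y - p) z" for z by (simp add: vdiff_def wirt_coord(3))
  have vw: "vwirt i (\<lambda>y. y - p) z = axis i 1" "vwirt_bar i (\<lambda>y. y - p) z = 0" for i z
    by (simp_all add: vwirt_def vwirt_bar_def wirt_coord vec_eq_iff axis_def)
  have ca: "cdot (axis i 1) w = cnj (w $ i)" "cdot w (axis i 1) = w $ i" for i and w :: "complex^'n"
    by (simp_all add: cdot_def axis_def if_distrib if_distribR cong: if_cong)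
  have cd: "(\<lambda>y. cdot (y - p) (y - p)) differentiable (at z)" for z
    unfolding cdot_def
    by (intro differentiable_sum_fun differentiable_mult differentiable_cnj) (simp_all add: wirt_coord(3))
  have cw: "wirt i (\<lambda>y. cdot (y - p) (y - p)) z = cnj (z $ i - p $ i)"
    "wirt_bar i (\<lambda>y. cdot (y - p) (y - p)) z = z $ i - p $ i" for i z
    by (simp_all add: wirt_cdot[OF vd vd] vw ca)
  have gd: "(\<lambda>y. of_real (- a) * cdot (y - p) (y - p)) differentiable (at z)" for z
    by (intro differentiable_mult differentiable_const cd)
  show d: "gauss a p differentiable (at z)" for z
    unfolding gauss_def[abs_def] by (rule wirt_exp(3)[OF gd])
  show w: "wirt \<alpha> (gauss a p) = (\<lambda>y. of_real (- a) * (cnj (y $ \<alpha> - p $ \<alpha>) * gauss a p y))"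
    unfolding gauss_def[abs_def] by (rule ext) (simp only: wirt_exp(1)[OF gd] wirt_cmult(1)[OF cd] cw mult_ac)
  have wb: "wirt_bar \<beta> (gauss a p) z = of_real (- a) * ((z $ \<beta> - p $ \<beta>) * gauss a p z)"
    unfolding gauss_def[abs_def] by (simp only: wirt_exp(2)[OF gd] wirt_cmult(2)[OF cd] cw mult_ac)
  have cc: "(\<lambda>y. cnj (y $ \<alpha> - p $ \<alpha>)) differentiable (at z)" by (rule differentiable_cnj[OF wirt_coord(3)])
  have cg: "(\<lambda>y. cnj (y $ \<alpha> - p $ \<alpha>) * gauss a p y) differentiable (at z)"
    by (rule differentiable_mult[OF cc d])
  show "wirt \<alpha> (gauss a p) differentiable (at z)" unfolding w
    by (rule differentiable_mult[OF differentiable_const cg])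
  show "wirt_bar \<beta> (wirt \<alpha> (gauss a p)) z =
      (of_real (- a) * (if \<alpha> = \<beta> then 1 else 0) + of_real (a * a) * (cnj (z $ \<alpha> - p $ \<alpha>) * (z $ \<beta> - p $ \<beta>))) * gauss a p z"
    unfolding w wirt_cmult(2)[OF cg] wirt_mult(2)[OF cc d] wb wirt_cnj(2)[OF wirt_coord(3)] wirt_coord(1)
    by (simp add: algebra_simps)
qed

lemma gauss_real: "gauss a p y = of_real (exp (- a * (norm (y - p))\<^sup>2))"
proof -
  have "cdot v v = of_real ((norm v)\<^sup>2)" for v :: "complex^'a"
    by (simp add: cdot_self norm_vec_def L2_set_def sum_nonneg)
  then show ?thesis by (simp add: gauss_def exp_of_real[symmetric])
qed

text \<open>The a^2 term carries the quadratic form of P at z - p. For positive definite P it is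
  positive away from p and outweighs the trace term once a is large, which makes the barrier
  strictly subharmonic there.\<close>

lemma lap_gauss:
  fixes p :: "complex^'n"
  shows "lap P (gauss a p) z = (of_real (- a) * trace P
     + of_real (a * a) * (\<Sum>\<alpha>\<in>UNIV. \<Sum>\<beta>\<in>UNIV. P $ \<alpha> $ \<beta> * ((z - p) $ \<alpha> * cnj ((z - p) $ \<beta>)))) * gauss a p z"
proof -
  have "lap P (gauss a p) z = (\<Sum>\<alpha>\<in>UNIV. \<Sum>\<beta>\<in>UNIV. (of_real (- a) * (if \<alpha> = \<beta> then P $ \<beta> $ \<alpha> else 0)
     + of_real (a * a) * (P $ \<beta> $ \<alpha> * ((z - p) $ \<beta> * cnj ((z - p) $ \<alpha>)))) * gauss a p z)"
    unfolding lap_def wirt_gauss(4) by (intro sum.cong refl) (simp add: algebra_simps)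
  also have "\<dots> = (of_real (- a) * (\<Sum>\<alpha>\<in>UNIV. \<Sum>\<beta>\<in>UNIV. if \<alpha> = \<beta> then P $ \<beta> $ \<alpha> else 0)
     + of_real (a * a) * (\<Sum>\<alpha>\<in>UNIV. \<Sum>\<beta>\<in>UNIV. P $ \<beta> $ \<alpha> * ((z - p) $ \<beta> * cnj ((z - p) $ \<alpha>)))) * gauss a p z"
    by (simp only: sum_distrib_right[symmetric] sum_distrib_left[symmetric] sum.distrib)
  also have "(\<Sum>\<alpha>\<in>UNIV. \<Sum>\<beta>\<in>UNIV. if \<alpha> = \<beta> then P $ \<beta> $ \<alpha> else 0) = trace P"
    by (simp add: trace_def)
  also have "(\<Sum>\<alpha>\<in>UNIV. \<Sum>\<beta>\<in>UNIV. P $ \<beta> $ \<alpha> * ((z - p) $ \<beta> * cnj ((z - p) $ \<alpha>)))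
     = (\<Sum>\<alpha>\<in>UNIV. \<Sum>\<beta>\<in>UNIV. P $ \<alpha> $ \<beta> * ((z - p) $ \<alpha> * cnj ((z - p) $ \<beta>)))" by (rule sum.swap)
  finally show ?thesis .
qed

text \<open>
  Halving the radius of the largest free ball makes its boundary touch \<open>K\<close> in a single point.
\<close>

lemma touching_ball:
  fixes K :: "'a::euclidean_space set"
  assumes \<Omega>: "open \<Omega>" and K: "closedin (top_of_set \<Omega>) K" and no: "\<not> open K"
  obtains p q \<rho> where "q \<in> K" "\<rho> > 0" "dist p q = \<rho>" "cball p \<rho> - {q} \<subseteq> \<Omega> - K"
proof -
  have KO: "K \<subseteq> \<Omega>" using K closedin_imp_subset by blast
  obtain z0 where z0: "z0 \<in> K" "\<And>e. e > 0 \<Longrightarrow> \<not> ball z0 e \<subseteq> K"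
    using no unfolding open_contains_ball by blast
  obtain e where e: "e > 0" "cball z0 e \<subseteq> \<Omega>" using \<Omega> z0 KO open_contains_cball by blast
  define R where "R = e / 2"
  have R: "R > 0" "cball z0 (2 * R) \<subseteq> \<Omega>" using e by (auto simp: R_def)
  obtain p where p: "p \<in> ball z0 R" "p \<notin> K" using z0(2)[OF R(1)] by blast
  obtain C where C: "closed C" "K = \<Omega> \<inter> C" using K closedin_closed by metis
  have "K \<inter> cball z0 (2 * R) = C \<inter> cball z0 (2 * R)" using C R by blast
  then have cmp: "compact (K \<inter> cball z0 (2 * R))" using C(1) by (simp add: closed_Int_compact)
  have z0K: "z0 \<in> K \<inter> cball z0 (2 * R)" using z0 R by simp
  have "\<exists>q\<in>K \<inter> cball z0 (2 * R). \<forall>y\<in>K \<inter> cball z0 (2 * R). dist p q \<le> dist p y"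
    by (rule continuous_attains_inf[OF cmp _ continuous_on_dist[OF continuous_on_const continuous_on_id]]) (use z0K in blast)
  then obtain q where q: "q \<in> K \<inter> cball z0 (2 * R)" "\<And>y. y \<in> K \<inter> cball z0 (2 * R) \<Longrightarrow> dist p q \<le> dist p y"
    by (elim bexE) (simp only: Ball_def)
  define \<rho> where "\<rho> = dist p q"
  have \<rho>: "\<rho> > 0" using p q by (auto simp: \<rho>_def)
  have \<rho>R: "\<rho> < R" using q(2)[OF z0K] p by (simp add: \<rho>_def dist_commute)
  \<comment> \<open>Truncating K to \<open>cball z0 (2 * R)\<close> loses nothing here: p is within
    R of z0 and \<rho> < R, so the ball of radius \<rho> about p lies in the truncation
    region.\<close>
  have out: "y \<in> \<Omega> - K" if "dist p y < \<rho>" for y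
  proof -
    have "dist z0 y \<le> dist z0 p + dist p y" by (rule dist_triangle)
    then have "y \<in> cball z0 (2 * R)" using that p \<rho>R by simp
    moreover have "y \<notin> K" using q(2)[of y] that calculation by (auto simp: \<rho>_def)
    ultimately show ?thesis using R by blast
  qed
  define m where "m = midpoint p q"
  have mq: "dist m q = \<rho> / 2" by (simp add: m_def \<rho>_def dist_midpoint)
  have "dist p m = \<rho> / 2" by (simp add: m_def \<rho>_def dist_midpoint)
  then have pm: "norm (m - p) = \<rho> / 2" by (simp only: dist_norm norm_minus_commute)
  have sub: "y \<in> \<Omega> - K" if y: "y \<in> cball m (\<rho> / 2)" "y \<noteq> q" for y
  proof (rule out, rule ccontr)
    assume "\<not> dist p y < \<rho>"
    \<comment> \<open>Both |y - m| and |m - p| are at most \<rho>/2, so the triangle inequality is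
      an equality. Then y is the reflection of p in m, which is q.\<close>
    then have ge: "norm ((y - m) + (m - p)) \<ge> \<rho>" by (simp add: dist_norm norm_minus_commute)
    have ym: "norm (y - m) \<le> \<rho> / 2" using y by (simp add: dist_norm norm_minus_commute)
    have "norm ((y - m) + (m - p)) \<le> norm (y - m) + norm (m - p)" by (rule norm_triangle_ineq)
    then have eq: "norm (y - m) = \<rho> / 2" "norm ((y - m) + (m - p)) = norm (y - m) + norm (m - p)"
      using ge ym pm by linarith+
    then have "norm (y - m) *\<^sub>R (m - p) = norm (m - p) *\<^sub>R (y - m)" using norm_triangle_eq by blast
    then have "m - p = y - m" using \<rho> by (simp add: eq(1) pm)
    then have "y = (m + m) - p" by (simp add: algebra_simps)
    also have "\<dots> = q" by (simp add: m_def midpoint_plus_self)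
    finally show False using y by simp
  qed
  show thesis
    by (rule that[of q "\<rho> / 2" m]) (use q \<rho> mq sub in auto)
qed

lemma lap_add:
  assumes \<Omega>: "open \<Omega>" "z \<in> \<Omega>" and "\<And>y. y \<in> \<Omega> \<Longrightarrow> f differentiable (at y)" "\<And>y. y \<in> \<Omega> \<Longrightarrow> g differentiable (at y)"
    and d: "\<And>\<alpha>. wirt \<alpha> f differentiable (at z)" "\<And>\<alpha>. wirt \<alpha> g differentiable (at z)"
  shows "lap P (\<lambda>y. f y + c * g y) z = lap P f z + c * lap P g z"
    and "wirt \<alpha> (\<lambda>y. f y + c * g y) differentiable (at z)"
proof -
  have w: "wirt \<alpha> (\<lambda>y. f y + c * g y) y = wirt \<alpha> f y + c * wirt \<alpha> g y" if y: "y \<in> \<Omega>" for \<alpha> y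
    using wirt_add(1)[OF assms(3)[OF y] differentiable_mult[OF differentiable_const assms(4)[OF y]]]
      wirt_cmult(1)[OF assms(4)[OF y]] by simp
  have cd: "(\<lambda>y. c * wirt \<alpha> g y) differentiable (at z)" for \<alpha>
    by (rule differentiable_mult[OF differentiable_const d(2)])
  have "wirt_bar \<beta> (wirt \<alpha> (\<lambda>y. f y + c * g y)) z = wirt_bar \<beta> (wirt \<alpha> f) z + c * wirt_bar \<beta> (wirt \<alpha> g) z" for \<alpha> \<beta>
  proof -
    have "wirt_bar \<beta> (wirt \<alpha> (\<lambda>y. f y + c * g y)) z = wirt_bar \<beta> (\<lambda>y. wirt \<alpha> f y + c * wirt \<alpha> g y) z"
      by (rule wirt_cong(2)[OF \<Omega> w])
    then show ?thesis by (simp only: wirt_add(2)[OF d(1) cd] wirt_cmult(2)[OF d(2)])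
  qed
  then show "lap P (\<lambda>y. f y + c * g y) z = lap P f z + c * lap P g z"
    by (simp add: lap_def distrib_left sum.distrib sum_distrib_left mult_ac)
  show "wirt \<alpha> (\<lambda>y. f y + c * g y) differentiable (at z)"
    using differentiable_cong_open[OF \<Omega>, of "wirt \<alpha> (\<lambda>y. f y + c * g y)" "\<lambda>y. wirt \<alpha> f y + c * wirt \<alpha> g y"]
      differentiable_add[OF d(1)[of \<alpha>] cd[of \<alpha>]] w by blast
qed

text \<open>Hopf's argument. If the maximum set is not open, some ball about p touches it at a
  single point q. Adding a small multiple of the barrier, strictly subharmonic near q, moves the
  maximum over \<open>cball q \<delta>\<close> into the interior: on the part of the sphere in
  \<open>cball p \<rho>\<close> f stays below M by a fixed margin, and on the rest the barrier is
  smaller than at q. At an interior maximum \<open>lap_max\<close> contradicts strict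
  subharmonicity.\<close>

lemma strong_maximum_principle:
  fixes f :: "complex^'n \<Rightarrow> complex" and P :: "complex^'n \<Rightarrow> complex^'n^'n"
  assumes \<Omega>: "open \<Omega>" and f: "Ck_on 2 \<Omega> f" and real: "\<And>z. z \<in> \<Omega> \<Longrightarrow> Im (f z) = 0"
    and P: "\<And>z. z \<in> \<Omega> \<Longrightarrow> gram_factor (P z)" and Pc: "\<And>a b. continuous_on \<Omega> (\<lambda>z. P z $ a $ b)"
    and sub: "\<And>z. z \<in> \<Omega> \<Longrightarrow> Re (lap (P z) f z) \<ge> 0" and max: "\<And>z. z \<in> \<Omega> \<Longrightarrow> Re (f z) \<le> M"
  shows "open {z \<in> \<Omega>. Re (f z) = M}"
proof (rule ccontr)
  assume no: "\<not> open {z \<in> \<Omega>. Re (f z) = M}"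
  have fC: "Ck_on (Suc 1) \<Omega> f" using f by (simp add: numeral_2_eq_2)
  have fd: "f differentiable (at z)" if "z \<in> \<Omega>" for z using fC that by simp
  have fw: "wirt \<alpha> f differentiable (at z)" if "z \<in> \<Omega>" for z \<alpha>
    using Ck_on_wirt(1)[OF \<Omega> fC, of \<alpha>] that by simp
  have fcont: "continuous_on \<Omega> (\<lambda>z. Re (f z))"
    by (intro continuous_on_Re continuous_at_imp_continuous_on ballI differentiable_imp_continuous_within fd)
  have "closedin (top_of_set \<Omega>) {z \<in> \<Omega>. Re (f z) = M}"
  proof -
    have "{z \<in> \<Omega>. Re (f z) = M} = \<Omega> \<inter> (\<lambda>z. Re (f z)) -` {M}" by auto
    then show ?thesis using continuous_closedin_preimage[OF fcont, of "{M}"] by simp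
  qed
  from \<Omega> this no obtain p q \<rho> where qK: "q \<in> {z \<in> \<Omega>. Re (f z) = M}" and \<rho>: "\<rho> > 0" "dist p q = \<rho>"
    and ball: "cball p \<rho> - {q} \<subseteq> \<Omega> - {z \<in> \<Omega>. Re (f z) = M}" by (rule touching_ball)
  have q: "q \<in> \<Omega>" "Re (f q) = M" using qK by auto
  define Q where "Q z = Re (\<Sum>\<alpha>\<in>UNIV. \<Sum>\<beta>\<in>UNIV. P z $ \<alpha> $ \<beta> * ((z - p) $ \<alpha> * cnj ((z - p) $ \<beta>)))" for z
  have "Q q > 0" unfolding Q_def by (rule gram_factor_quadratic_pos[OF P[OF q(1)]]) (use \<rho> in auto)
  \<comment> \<open>Chosen so that a Q(q) = |Re tr P(q)| + 1 exceeds the trace, which makes the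
    factor \<open>l q\<close> positive.\<close>
  define a where "a = (\<bar>Re (trace (P q))\<bar> + 1) / Q q"
  have a: "a > 0" using \<open>Q q > 0\<close> by (simp add: a_def)
  define l where "l z = - a * Re (trace (P z)) + a * a * Q z" for z
  have "l q = a * (\<bar>Re (trace (P q))\<bar> + 1 - Re (trace (P q)))"
    using \<open>Q q > 0\<close> by (simp add: l_def a_def field_simps)
  then have "l q > 0" using a by (simp add: mult_pos_pos)
  have lcont: "continuous_on \<Omega> l"
    unfolding l_def Q_def trace_def by (intro continuous_intros Pc)
  have lap_b: "Re (lap (P z) (gauss a p) z) = l z * exp (- a * (norm (z - p))\<^sup>2)" for z
  proof -
    have "Re ((of_real (- a) * X + of_real (a * a) * Y) * of_real E) = (- a * Re X + a * a * Re Y) * E" for X Y E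
      by simp
    then show ?thesis unfolding lap_gauss gauss_real l_def Q_def .
  qed
  have "open (\<Omega> \<inter> l -` {0<..})" using continuous_open_preimage[OF lcont \<Omega>] by simp
  moreover have "q \<in> \<Omega> \<inter> l -` {0<..}" using q \<open>l q > 0\<close> by simp
  ultimately obtain \<delta> where \<delta>: "\<delta> > 0" "cball q \<delta> \<subseteq> \<Omega> \<inter> l -` {0<..}" using open_contains_cball by metis
  define S where "S = sphere q \<delta> \<inter> cball p \<rho>"
  have S: "compact S" unfolding S_def by (rule compact_Int) auto
  have S\<Omega>: "S \<subseteq> \<Omega>" using \<delta> by (auto simp: S_def)
  have Slt: "Re (f y) < M" if "y \<in> S" for y
  proof -
    have "y \<noteq> q" using that \<delta>(1) by (auto simp: S_def)
    then have "y \<in> \<Omega>" "Re (f y) \<noteq> M" using that ball by (auto simp: S_def)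
    then show ?thesis using max by force
  qed
  obtain m where m: "m > 0" "\<And>y. y \<in> S \<Longrightarrow> Re (f y) \<le> M - m"
  proof (cases "S = {}")
    case True
    then show ?thesis using that[of 1] by simp
  next
    case False
    obtain y0 where "y0 \<in> S" "\<And>y. y \<in> S \<Longrightarrow> Re (f y) \<le> Re (f y0)"
      using continuous_attains_sup[OF S False continuous_on_subset[OF fcont S\<Omega>]] by blast
    then show ?thesis using that[of "M - Re (f y0)"] Slt[of y0] by simp
  qed
  \<comment> \<open>The barrier is at most 1, so on \<open>S\<close> the perturbed function is at
    most M - m/2, below its value at q.\<close>
  define \<epsilon> where "\<epsilon> = m / 2"
  have \<epsilon>: "\<epsilon> > 0" "\<epsilon> < m" using m by (simp_all add: \<epsilon>_def)
  define F where "F y = f y + of_real \<epsilon> * gauss a p y" for y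
  define b where "b y = exp (- a * (norm (y - p))\<^sup>2)" for y
  have ReF: "Re (F y) = Re (f y) + \<epsilon> * b y" for y by (simp add: F_def gauss_real b_def)
  have b_bounds: "0 < b y" "b y \<le> 1" for y using a by (simp_all add: b_def)
  have Fd: "F differentiable (at y)" if "y \<in> \<Omega>" for y unfolding F_def[abs_def]
    by (intro differentiable_add differentiable_mult differentiable_const fd that wirt_gauss(1))
  have "continuous_on (cball q \<delta>) (\<lambda>y. Re (F y))"
    by (intro continuous_on_Re continuous_at_imp_continuous_on ballI differentiable_imp_continuous_within Fd) (use \<delta> in auto)
  then obtain ys where ys: "ys \<in> cball q \<delta>" "\<And>y. y \<in> cball q \<delta> \<Longrightarrow> Re (F y) \<le> Re (F ys)"
    using continuous_attains_sup[OF compact_cball, of q \<delta> "\<lambda>y. Re (F y)"] \<delta>(1) by auto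
  have Fq: "M + \<epsilon> * b q \<le> Re (F ys)" using ys(2)[of q] \<delta>(1) q(2) by (simp add: ReF)
  have ysb: "ys \<in> ball q \<delta>"
  proof (rule ccontr)
    assume "ys \<notin> ball q \<delta>"
    then have sph: "ys \<in> sphere q \<delta>" using ys(1) by auto
    have ys\<Omega>: "ys \<in> \<Omega>" using ys(1) \<delta> by blast
    show False
    proof (cases "ys \<in> cball p \<rho>")
      case True
      then have "Re (f ys) \<le> M - m" using sph m by (simp add: S_def)
      moreover have "\<epsilon> * b ys \<le> \<epsilon> * 1" using b_bounds \<epsilon> by (intro mult_left_mono) auto
      moreover have "0 < \<epsilon> * b q" using b_bounds \<epsilon> by simp
      ultimately show False using Fq \<epsilon> unfolding ReF mult_1_right by linarith
    next
      case False
      then have "norm (q - p) < norm (ys - p)" using \<rho> by (simp add: dist_norm norm_minus_commute)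
      then have "(norm (q - p))\<^sup>2 < (norm (ys - p))\<^sup>2" by (intro power_strict_mono) auto
      then have "b ys < b q" using a by (simp add: b_def)
      then have "\<epsilon> * b ys < \<epsilon> * b q" using \<epsilon> by simp
      then show False using Fq max[OF ys\<Omega>] by (simp add: ReF)
    qed
  qed
  have bs: "ball q \<delta> \<subseteq> \<Omega>" using \<delta> ball_subset_cball by blast
  have ys\<Omega>: "ys \<in> \<Omega>" using ysb bs by blast
  note la = lap_add[OF \<Omega> ys\<Omega> fd wirt_gauss(1) fw[OF ys\<Omega>] wirt_gauss(3)]
  have "Re (lap (P ys) F ys) \<le> 0"
  proof (rule lap_max[OF open_ball ysb])
    show "F differentiable (at y)" if "y \<in> ball q \<delta>" for y using Fd bs that by blast
    show "wirt \<alpha> F differentiable (at ys)" for \<alpha> unfolding F_def[abs_def] by (rule la(2))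
    show "Im (F y) = 0" if "y \<in> ball q \<delta>" for y using real bs that by (auto simp: F_def gauss_real)
    show "Re (F y) \<le> Re (F ys)" if "y \<in> ball q \<delta>" for y using ys(2) that by auto
  qed (rule P[OF ys\<Omega>])
  moreover have "lap (P ys) F ys = lap (P ys) f ys + of_real \<epsilon> * lap (P ys) (gauss a p) ys"
    unfolding F_def[abs_def] by (rule la(1))
  ultimately have "Re (lap (P ys) f ys) + \<epsilon> * (l ys * exp (- a * (norm (ys - p))\<^sup>2)) \<le> 0"
    by (simp add: lap_b)
  moreover have "l ys > 0" using \<delta>(2) ys(1) by auto
  then have "\<epsilon> * (l ys * exp (- a * (norm (ys - p))\<^sup>2)) > 0" using \<epsilon> by simp
  ultimately show False using sub[OF ys\<Omega>] by linarith
qed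

section \<open>The volume measure\<close>

lemma holo_onD:
  assumes "holo_on Z f" "z \<in> Z"
  shows "f differentiable (at z)" "wirt_bar i f z = 0"
  using assms unfolding holo_on_iff by blast+

lemma Ck_on_SucE: "Ck_on (Suc k) Z f \<Longrightarrow> z \<in> Z \<Longrightarrow> f differentiable (at z)"
  by simp

text \<open>Regularity of sections and metrics is known only in frame coordinates, so continuity of
  a global scalar built from them is tested on intersections of a chart domain with a frame
  domain.\<close>

lemma continuous_on_frames:
  fixes F :: "'x::{t2_space, second_countable_topology} \<Rightarrow> 'b::topological_space"
  assumes A: "complex_manifold A" and E: "holo_bundle A E"
    and F: "\<And>c W e. c \<in> A \<Longrightarrow> (W, e) \<in> E \<Longrightarrow> continuous_on (snd c ` (fst c \<inter> W)) (\<lambda>z. F (chart_inv c z))"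
  shows "continuous_on UNIV F"
proof (rule continuous_at_imp_continuous_on, rule ballI)
  fix x
  obtain c where c: "c \<in> A" "x \<in> fst c" using chart_covers[OF A] by blast
  obtain W e where We: "(W, e) \<in> E" "x \<in> W" using holo_bundleD(1)[OF E] by blast
  let ?V = "fst c \<inter> W"
  have V: "open ?V" by (rule open_Int[OF chart_open[OF A c(1)] holo_bundleD(2)[OF E We(1)]])
  have "continuous_on ?V (\<lambda>y. F (chart_inv c (snd c y)))"
    by (rule continuous_on_compose2[OF F[OF c(1) We(1)] continuous_on_subset[OF chart_cont[OF A c(1)]]]) auto
  then have "continuous_on ?V F"
    by (rule continuous_on_cong[THEN iffD1, rotated 2]) (auto simp: chart_inv_apply(1)[OF A c(1)])
  then show "isCont F x" using V c We by (simp add: continuous_on_eq_continuous_at)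
qed

definition volume_density :: "('x, 'n::finite) metric \<Rightarrow> ('x, 'n) cchart \<Rightarrow> complex^'n \<Rightarrow> real" where
  "volume_density g c z = 2 ^ CARD('n) * Re (det (g c (chart_inv c z)))"

lemma hermitian_metricD:
  assumes "hermitian_metric A g" "c \<in> A"
  shows "x \<in> fst c \<Longrightarrow> hermitian_posdef (g c x)"
    and "smooth_fun A (fst c) (\<lambda>x. g c x $ \<alpha> $ \<beta>)"
proof -
  have 1: "\<forall>c\<in>A. \<forall>x\<in>fst c. hermitian_posdef (g c x)"
    using assms(1) unfolding hermitian_metric_def by (elim conjE)
  have 2: "\<forall>c\<in>A. \<forall>\<alpha> \<beta>. smooth_fun A (fst c) (\<lambda>x. g c x $ \<alpha> $ \<beta>)"
    using assms(1) unfolding hermitian_metric_def by (elim conjE)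
  show "x \<in> fst c \<Longrightarrow> hermitian_posdef (g c x)" "smooth_fun A (fst c) (\<lambda>x. g c x $ \<alpha> $ \<beta>)"
    using 1 2 assms(2) by simp_all
qed

lemma volume_density_facts:
  assumes A: "complex_manifold A" "c \<in> A" and g: "hermitian_metric A g"
  shows "continuous_on (snd c ` fst c) (volume_density g c)" and "z \<in> snd c ` fst c \<Longrightarrow> volume_density g c z > 0"
proof -
  have "Ck_on 0 (snd c ` fst c) (\<lambda>z. g c (chart_inv c z) $ \<alpha> $ \<beta>)" for \<alpha> \<beta>
    using smooth_funD[OF hermitian_metricD(2)[OF g A(2)] A(2), of 0 \<alpha> \<beta>] by (simp only: Int_absorb)
  then have "Ck_on 0 (snd c ` fst c) (\<lambda>z. det (g c (chart_inv c z)))"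
    by (rule Ck_on_det[OF chart_range_open[OF A]])
  then have "continuous_on (snd c ` fst c) (\<lambda>z. det (g c (chart_inv c z)))" by (simp only: Ck_on.simps)
  then show "continuous_on (snd c ` fst c) (volume_density g c)"
    unfolding volume_density_def[abs_def] by (intro continuous_on_mult continuous_on_const continuous_on_Re)
  assume "z \<in> snd c ` fst c"
  then have "chart_inv c z \<in> fst c" by (rule chart_inv_apply(2)[OF A])
  from posdef_det[OF hermitian_metricD(1)[OF g A(2) this]] show "volume_density g c z > 0" by (simp add: volume_density_def)
qed

lemma volume_measureD:
  assumes "volume_measure A g vol" "c \<in> A" "B \<in> sets borel" "B \<subseteq> fst c"
  shows "emeasure vol B = (\<integral>\<^sup>+z. ennreal (volume_density g c z) * indicator (snd c ` B) z \<partial>lborel)"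
proof -
  have "\<forall>c\<in>A. \<forall>B\<in>sets borel. B \<subseteq> fst c \<longrightarrow> emeasure vol B =
      (\<integral>\<^sup>+z. ennreal (volume_density g c z) * indicator (snd c ` B) z \<partial>lborel)"
    using assms(1) unfolding volume_measure_def volume_density_def by (elim conjE)
  with assms(2-4) show ?thesis by simp
qed

lemma volume_sets: "volume_measure A g vol \<Longrightarrow> sets vol = sets borel"
  unfolding volume_measure_def by (elim conjE)

lemma volume_locally_finite:
  assumes A: "complex_manifold A" and g: "hermitian_metric A g" and vol: "volume_measure A g vol"
  shows "\<exists>V. open V \<and> x \<in> V \<and> emeasure vol V < \<infinity>"
proof -
  obtain c where c: "c \<in> A" "x \<in> fst c" using chart_covers[OF A] by blast
  have "snd c x \<in> snd c ` fst c" using c by blast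
  then obtain r where r: "r > 0" "cball (snd c x) r \<subseteq> snd c ` fst c"
    using chart_range_open[OF A c(1)] open_contains_cball by metis
  define V where "V = fst c \<inter> snd c -` ball (snd c x) r"
  have V: "open V" unfolding V_def
    by (rule continuous_open_preimage[OF chart_cont[OF A c(1)] chart_open[OF A c(1)] open_ball])
  have xV: "x \<in> V" using c r by (simp add: V_def)
  have im: "snd c ` V \<subseteq> cball (snd c x) r" by (auto simp: V_def)
  have "compact (volume_density g c ` cball (snd c x) r)"
    by (rule compact_continuous_image[OF continuous_on_subset[OF volume_density_facts(1)[OF A c(1) g] r(2)] compact_cball])
  then obtain C where C: "\<And>z. z \<in> cball (snd c x) r \<Longrightarrow> norm (volume_density g c z) \<le> C"
    using compact_imp_bounded bounded_iff by (metis image_eqI)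
  have "emeasure vol V = (\<integral>\<^sup>+z. ennreal (volume_density g c z) * indicator (snd c ` V) z \<partial>lborel)"
    by (rule volume_measureD[OF vol c(1)]) (use V in \<open>auto simp: V_def\<close>)
  also have "\<dots> \<le> (\<integral>\<^sup>+z. ennreal C * indicator (cball (snd c x) r) z \<partial>lborel)"
  proof (rule nn_integral_mono)
    fix z
    show "ennreal (volume_density g c z) * indicator (snd c ` V) z \<le> ennreal C * indicator (cball (snd c x) r) z"
    proof (cases "z \<in> snd c ` V")
      case True
      then have z: "z \<in> cball (snd c x) r" using im by blast
      then have "volume_density g c z \<le> C" using C by fastforce
      then show ?thesis using True z by (simp add: ennreal_leI)
    qed simp
  qed
  also have "\<dots> = ennreal C * emeasure lborel (cball (snd c x) r)"
    by (rule nn_integral_cmult_indicator) simp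
  also have "\<dots> < \<infinity>"
    using emeasure_bounded_finite[OF bounded_cball, of "snd c x" r] by (simp add: ennreal_mult_less_top)
  finally show ?thesis using V xV by blast
qed

lemma volume_finite:
  assumes A: "complex_manifold A" and g: "hermitian_metric A g" and vol: "volume_measure A g (vol :: 'x measure)"
    and cmp: "compact (UNIV :: 'x::{t2_space, second_countable_topology} set)"
  shows "finite_measure vol"
proof
  obtain V where V: "\<And>x. open (V x)" "\<And>x. x \<in> V x" "\<And>x. emeasure vol (V x) < \<infinity>"
    using volume_locally_finite[OF A g vol] by metis
  have "(UNIV :: 'x set) \<subseteq> (\<Union>x\<in>UNIV. V x)" using V(2) by auto
  then obtain D where D: "finite D" "(UNIV :: 'x set) \<subseteq> (\<Union>x\<in>D. V x)"
    using compactE_image[OF cmp, of UNIV V] V(1) by (metis subset_UNIV)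
  have s: "V ` D \<subseteq> sets vol" using V(1) volume_sets[OF vol] by auto
  have "space vol = UNIV" using sets_eq_imp_space_eq[OF volume_sets[OF vol]] by simp
  then have "space vol = (\<Union>x\<in>D. V x)" using D by auto
  then have "emeasure vol (space vol) \<le> (\<Sum>x\<in>D. emeasure vol (V x))"
    using emeasure_subadditive_finite[OF D(1) s] by simp
  also have "\<dots> < \<infinity>" using V(3) by (simp add: D(1))
  finally show "emeasure vol (space vol) \<noteq> \<infinity>" by simp
qed

text \<open>The density is positive and nonempty open sets of coordinate space are not negligible.
  Full support is what turns vanishing almost everywhere into vanishing everywhere for continuous
  functions.\<close>

lemma volume_open_pos:
  assumes A: "complex_manifold A" and g: "hermitian_metric A g" and vol: "volume_measure A g vol"
    and V: "open V" "x \<in> V"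
  shows "emeasure vol V > 0"
proof -
  obtain c where c: "c \<in> A" "x \<in> fst c" using chart_covers[OF A] by blast
  let ?S = "snd c ` (fst c \<inter> V)"
  have S: "open ?S" by (rule chart_image_open[OF A c(1) V(1)])
  have Sne: "?S \<noteq> {}" using V c by blast
  have sub: "?S \<subseteq> snd c ` fst c" by blast
  have meas: "(\<lambda>z. ennreal (volume_density g c z) * indicator ?S z) \<in> borel_measurable lborel"
  proof -
    have "(\<lambda>z. indicator ?S z *\<^sub>R volume_density g c z) \<in> borel_measurable borel"
      by (rule borel_measurable_continuous_on_indicator)
        (use S continuous_on_subset[OF volume_density_facts(1)[OF A c(1) g] sub] in auto)
    then have "(\<lambda>z. ennreal (indicator ?S z *\<^sub>R volume_density g c z)) \<in> borel_measurable borel" by measurable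
    moreover have "ennreal (indicator ?S z *\<^sub>R volume_density g c z) = ennreal (volume_density g c z) * indicator ?S z" for z
      by (simp add: indicator_def)
    ultimately show ?thesis by simp
  qed
  have "(\<integral>\<^sup>+z. ennreal (volume_density g c z) * indicator ?S z \<partial>lborel) \<noteq> 0"
  proof
    assume "(\<integral>\<^sup>+z. ennreal (volume_density g c z) * indicator ?S z \<partial>lborel) = 0"
    then have "AE z in lborel. ennreal (volume_density g c z) * indicator ?S z = 0"
      using nn_integral_0_iff_AE[OF meas] by simp
    then have "AE z in lborel. z \<notin> ?S"
    proof (rule AE_mp, intro AE_I2 impI notI)
      fix z assume "ennreal (volume_density g c z) * indicator ?S z = 0" "z \<in> ?S"
      then have "volume_density g c z \<le> 0" by (simp add: ennreal_eq_0_iff)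
      moreover have "volume_density g c z > 0" by (rule volume_density_facts(2)[OF A c(1) g]) (use \<open>z \<in> ?S\<close> in blast)
      ultimately show False by simp
    qed
    moreover have "?S \<in> sets lborel" using S by simp
    ultimately have "?S \<in> null_sets lborel" using AE_iff_null_sets by blast
    then have "?S \<in> null_sets lebesgue" by (rule null_sets_completionI)
    then have "negligible ?S" using negligible_iff_null_sets by blast
    then show False using open_not_negligible[OF S Sne] by blast
  qed
  moreover have "emeasure vol (fst c \<inter> V) = (\<integral>\<^sup>+z. ennreal (volume_density g c z) * indicator ?S z \<partial>lborel)"
    by (rule volume_measureD[OF vol c(1)]) (use V chart_open[OF A c(1)] in auto)
  moreover have "emeasure vol (fst c \<inter> V) \<le> emeasure vol V"
    by (rule emeasure_mono) (use V volume_sets[OF vol] in auto)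
  ultimately show ?thesis by (metis less_le_trans zero_less_iff_neq_zero)
qed

lemma integral_zero_imp_zero:
  fixes F :: "'x::{t2_space, second_countable_topology} \<Rightarrow> complex"
  assumes A: "complex_manifold A" and g: "hermitian_metric A g" and vol: "volume_measure A g vol"
    and cmp: "compact (UNIV :: 'x set)" and F: "continuous_on UNIV F" and pos: "\<And>x. Re (F x) \<ge> 0" "\<And>x. Im (F x) = 0"
    and int: "(LINT x|vol. F x) = 0"
  shows "F x = 0"
proof (rule ccontr)
  assume nz: "F x \<noteq> 0"
  interpret finite_measure vol by (rule volume_finite[OF A g vol cmp])
  \<comment> \<open>A non-integrable function has integral 0 by default, so integrability comes
    first: \<open>F\<close> is bounded by compactness and the measure is finite.\<close>
  have "compact (F ` UNIV)" by (rule compact_continuous_image[OF F cmp])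
  then obtain C where C: "\<And>x. cmod (F x) \<le> C" using compact_imp_bounded bounded_iff by (metis UNIV_I image_eqI)
  have m: "F \<in> borel_measurable vol"
    using borel_measurable_continuous_onI[OF F] measurable_cong_sets[OF volume_sets[OF vol] refl] by blast
  have i: "integrable vol F" by (rule integrable_const_bound[of _ C]) (use C m in auto)
  then have ir: "integrable vol (\<lambda>x. Re (F x))" by (rule integrable_Re)
  have "(LINT x|vol. Re (F x)) = 0" using integral_Re[OF i] int by simp
  then have "AE x in vol. Re (F x) = 0"
    using integral_nonneg_eq_0_iff_AE[OF ir] pos(1) by simp
  define V where "V = {x. Re (F x) > 0}"
  have V: "open V" unfolding V_def by (rule open_Collect_less) (intro continuous_intros F continuous_on_Re)+
  have "x \<in> V" using nz pos[of x] by (auto simp: V_def complex_eq_iff order_less_le)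
  then have "emeasure vol V > 0" by (rule volume_open_pos[OF A g vol V])
  moreover have "V \<in> null_sets vol"
  proof -
    have "V \<in> sets vol" using V volume_sets[OF vol] by simp
    moreover have "AE x in vol. x \<notin> V" using \<open>AE x in vol. Re (F x) = 0\<close> by (rule AE_mp) (simp add: V_def)
    ultimately show ?thesis using AE_iff_null_sets by blast
  qed
  ultimately show False by auto
qed

section \<open>Harmonic sections are holomorphic\<close>

definition coords :: "('p \<Rightarrow> complex^'r^'r) \<Rightarrow> ('p \<Rightarrow> complex^'r) \<Rightarrow> ('p, 'n) cchart \<Rightarrow> complex^'n \<Rightarrow> complex^'r" where
  "coords e u c z = matrix_inv (e (chart_inv c z)) *v u (chart_inv c z)"

lemma smooth_sectionD:
  assumes "smooth_section A E u" "(W, e) \<in> E" "c \<in> A"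
  shows "Ck_on k (snd c ` (fst c \<inter> W)) (\<lambda>z. coords e u c z $ a)"
proof -
  have "\<forall>We\<in>E. \<forall>a. smooth_fun A (fst We) (\<lambda>p. (matrix_inv (snd We p) *v u p) $ a)"
    using assms(1) unfolding smooth_section_def case_prod_beta .
  from bspec[OF this assms(2)] have "smooth_fun A W (\<lambda>p. (matrix_inv (e p) *v u p) $ a)" by simp
  from smooth_funD[OF this assms(3)] show ?thesis by (simp only: coords_def)
qed

lemma vdiff_coords:
  assumes "smooth_section A E u" "(W, e) \<in> E" "c \<in> A" "z \<in> snd c ` (fst c \<inter> W)"
  shows "vdiff (coords e u c) z"
  unfolding vdiff_def using Ck_on_SucE[OF smooth_sectionD[OF assms(1-3)] assms(4)] by blast

text \<open>The change of frame \<open>a\<close> is holomorphic and therefore passes through the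
  conjugate derivative; any frame computes the same form as the one that \<open>frame_at\<close>
  picks.\<close>

lemma dbar_frame:
  assumes A: "complex_manifold A" "c \<in> A" and E: "holo_bundle A E" and u: "smooth_section A E u"
    and We: "(W, e) \<in> E" and x: "x \<in> W" "x \<in> fst c"
  shows "dbar E u c x \<beta> = e x *v vwirt_bar \<beta> (coords e u c) (snd c x)"
proof -
  define e0 where "e0 = frame_at E x"
  obtain W0 where W0: "(W0, e0) \<in> E" "x \<in> W0" using frame_at[OF E, of x] by (auto simp: e0_def)
  note inv = holo_bundleD(3)[OF E We] and inv0 = holo_bundleD(3)[OF E W0(1)]
  let ?Z = "snd c ` (fst c \<inter> (W \<inter> W0))"
  have Z: "open ?Z" by (rule chart_image_open[OF A open_Int[OF holo_bundleD(2)[OF E We] holo_bundleD(2)[OF E W0(1)]]])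
  have xz: "snd c x \<in> ?Z" using x W0 by auto
  define a where "a z = matrix_inv (e0 (chart_inv c z)) ** e (chart_inv c z)" for z
  have ah: "holo_on ?Z (\<lambda>z. a z $ k $ l)" for k l
    unfolding a_def using holo_funD[OF holo_bundleD(4)[OF E W0(1) We] A(2)] by (simp only: Int_commute)
  have ad: "mdiff a (snd c x)" and ab: "mwirt_bar \<beta> a (snd c x) = 0"
    using holo_onD[OF ah xz] by (simp_all add: mdiff_def mwirt_bar_def vec_eq_iff)
  have "coords e0 u c z = a z *v coords e u c z" if "z \<in> ?Z" for z
  proof -
    have "chart_inv c z \<in> W" using that chart_inv_apply(1)[OF A] by auto
    from matrix_inv_left_vec(1)[OF inv[OF this]] show ?thesis
      by (simp add: coords_def a_def matrix_vector_mul_assoc[symmetric])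
  qed
  then have "vwirt_bar \<beta> (coords e0 u c) (snd c x) = vwirt_bar \<beta> (\<lambda>z. a z *v coords e u c z) (snd c x)"
    by (rule vwirt_cong(2)[OF Z xz])
  also have "\<dots> = a (snd c x) *v vwirt_bar \<beta> (coords e u c) (snd c x)"
    using vwirt_mult(2)[OF ad vdiff_coords[OF u We A(2)], of \<beta>] x ab by simp
  finally have "dbar E u c x \<beta> = e0 x *v (a (snd c x) *v vwirt_bar \<beta> (coords e u c) (snd c x))"
    by (simp add: dbar_def Let_def e0_def[symmetric] coords_def[abs_def] vwirt_bar_def)
  moreover have "e0 x ** a (snd c x) = e x"
    by (simp add: a_def chart_inv_apply(1)[OF A x(2)] matrix_inv_cancel(1)[OF inv0[OF W0(2)]])
  ultimately show ?thesis by (simp add: matrix_vector_mul_assoc)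
qed

text \<open>
  The integrand of the Dirichlet form. It must be shown to be independent of the chart, since the
  charts chosen by \<open>chart_at\<close> do not vary continuously and a non-integrable function has
  integral 0.
\<close>

definition energy :: "('x, 'n::finite) metric \<Rightarrow> ('x \<Rightarrow> complex^'r^'r) \<Rightarrow> ('x, 'n, 'r) form01 \<Rightarrow> ('x, 'n) cchart \<Rightarrow> 'x \<Rightarrow> complex" where
  "energy g h \<eta> c x = (\<Sum>\<alpha>\<in>UNIV. \<Sum>\<beta>\<in>UNIV. matrix_inv (g c x) $ \<beta> $ \<alpha> * hinner (h x) (\<eta> c x \<beta>) (\<eta> c x \<alpha>))"

text \<open>In the chain rule the terms with holomorphic derivatives of the section carry conjugate
  derivatives of the chart change, which vanish. Only the conjugated Jacobian survives.\<close>

lemma dbar_chart_change: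
  assumes A: "complex_manifold A" "c \<in> A" "c' \<in> A" and E: "holo_bundle A E" and u: "smooth_section A E u"
    and x: "x \<in> fst c" "x \<in> fst c'"
  defines "J \<equiv> \<lambda>\<gamma> \<beta>. wirt \<beta> (\<lambda>z. snd c' (chart_inv c z) $ \<gamma>) (snd c x)"
  shows "dbar E u c x \<beta> = (\<Sum>\<gamma>\<in>UNIV. cnj (J \<gamma> \<beta>) *s dbar E u c' x \<gamma>)"
proof -
  obtain W e where We: "(W, e) \<in> E" "x \<in> W" using holo_bundleD(1)[OF E] by blast
  let ?Z = "snd c ` (fst c \<inter> (fst c' \<inter> W))"
  let ?\<phi> = "\<lambda>z. snd c' (chart_inv c z)"
  have Z: "open ?Z" by (rule chart_image_open[OF A(1,2) open_Int[OF chart_open[OF A(1,3)] holo_bundleD(2)[OF E We(1)]]])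
  have xz: "snd c x \<in> ?Z" using x We by auto
  have \<phi>x: "?\<phi> (snd c x) = snd c' x" by (simp add: chart_inv_apply(1)[OF A(1,2) x(1)])
  have "holo_on ?Z (\<lambda>z. ?\<phi> z $ k)" for k
    by (rule holo_on_subset[OF transition_holo[OF A]]) auto
  then have \<phi>d: "(\<lambda>z. ?\<phi> z $ k) differentiable (at (snd c x))" and \<phi>b: "wirt_bar \<beta> (\<lambda>z. ?\<phi> z $ k) (snd c x) = 0" for k \<beta>
    using holo_onD[OF _ xz] by blast+
  have co: "coords e u c z = coords e u c' (?\<phi> z)" if "z \<in> ?Z" for z
    using that chart_inv_apply(1)[OF A(1,2)] chart_inv_apply(1)[OF A(1,3)] by (auto simp: coords_def)
  have td: "vdiff (coords e u c') (?\<phi> (snd c x))" unfolding \<phi>x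
    by (rule vdiff_coords[OF u We(1) A(3)]) (use x We in auto)
  have "vwirt_bar \<beta> (coords e u c) (snd c x) = vwirt_bar \<beta> (\<lambda>z. coords e u c' (?\<phi> z)) (snd c x)"
    by (rule vwirt_cong(2)[OF Z xz co])
  also have "\<dots> = (\<Sum>\<gamma>\<in>UNIV. cnj (J \<gamma> \<beta>) *s vwirt_bar \<gamma> (coords e u c') (snd c' x))"
  proof -
    have "wirt_bar \<beta> (\<lambda>z. coords e u c' (?\<phi> z) $ a) (snd c x)
      = (\<Sum>\<gamma>\<in>UNIV. cnj (J \<gamma> \<beta>) * wirt_bar \<gamma> (\<lambda>z. coords e u c' z $ a) (snd c' x))" for a
    proof -
      have fd: "(\<lambda>y. coords e u c' y $ a) differentiable (at (?\<phi> (snd c x)))" using td by (simp only: vdiff_def)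
      show ?thesis
        using wirt_bar_compose[where f = "\<lambda>y. coords e u c' y $ a" and \<phi> = ?\<phi> and i = \<beta>, OF fd \<phi>d]
        by (simp only: \<phi>b \<phi>x J_def mult_zero_left add_0)
    qed
    then show ?thesis by (simp add: vec_eq_iff vwirt_bar_def)
  qed
  finally have v: "vwirt_bar \<beta> (coords e u c) (snd c x) = (\<Sum>\<gamma>\<in>UNIV. cnj (J \<gamma> \<beta>) *s vwirt_bar \<gamma> (coords e u c') (snd c' x))" .
  show ?thesis
    unfolding dbar_frame[OF A(1,2) E u We x(1)] dbar_frame[OF A(1,3) E u We x(2)] v
    by (simp only: vec.sum vec.scale)
qed

lemma energy_trace:
  "energy g h \<eta> c x = trace (matrix_inv (g c x) ** (\<chi> \<alpha> \<beta>. hinner (h x) (\<eta> c x \<beta>) (\<eta> c x \<alpha>)))"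
  unfolding energy_def trace_def matrix_matrix_mult_def vec_lambda_beta by (rule sum.swap)

text \<open>With \<open>M\<close> the Jacobian and \<open>M'\<close> its entrywise conjugate, the
  metric and the matrix \<open>K\<close> of inner products transform alike, as
  \<open>transpose M ** _ ** M'\<close>. The trace of the inverse metric times \<open>K\<close> is
  then invariant by cyclicity.\<close>

lemma energy_chart_independent:
  fixes A :: "('x::{t2_space, second_countable_topology}, 'n::finite) cchart set"
  assumes A: "complex_manifold A" "c \<in> A" "c' \<in> A" and g: "hermitian_metric A g"
    and E: "holo_bundle A E" and u: "smooth_section A E u" and x: "x \<in> fst c" "x \<in> fst c'"
  shows "energy g h (dbar E u) c x = energy g h (dbar E u) c' x"
proof -
  define J where "J \<gamma> \<beta> = wirt \<beta> (\<lambda>z. snd c' (chart_inv c z) $ \<gamma>) (snd c x)" for \<gamma> \<beta>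
  define M where "M = (\<chi> \<gamma> \<beta>. J \<gamma> \<beta>)"
  define M' where "M' = (\<chi> \<gamma> \<beta>. cnj (J \<gamma> \<beta>))"
  define K where "K c = (\<chi> \<alpha> \<beta>. hinner (h x) (dbar E u c x \<beta>) (dbar E u c x \<alpha>))" for c :: "('x, 'n) cchart"
  have gt: "g c x $ \<alpha> $ \<beta> = (\<Sum>\<gamma>\<in>UNIV. \<Sum>\<delta>\<in>UNIV. J \<gamma> \<alpha> * cnj (J \<delta> \<beta>) * g c' x $ \<gamma> $ \<delta>)" for \<alpha> \<beta>
  proof -
    have "\<forall>c\<in>A. \<forall>c'\<in>A. \<forall>x\<in>fst c \<inter> fst c'. \<forall>\<alpha> \<beta>.
        let J = (\<lambda>\<gamma> \<alpha>. wirt \<alpha> (\<lambda>z. snd c' (inv_into (fst c) (snd c) z) $ \<gamma>) (snd c x))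
        in g c x $ \<alpha> $ \<beta> = (\<Sum>\<gamma>\<in>UNIV. \<Sum>\<delta>\<in>UNIV. J \<gamma> \<alpha> * cnj (J \<delta> \<beta>) * g c' x $ \<gamma> $ \<delta>)"
      using g unfolding hermitian_metric_def by (elim conjE)
    from bspec[OF bspec[OF bspec[OF this A(2)] A(3)], of x] x show ?thesis
      unfolding Let_def J_def by blast
  qed
  have gM: "g c x = transpose M ** g c' x ** M'"
  proof -
    have "(transpose M ** g c' x ** M') $ \<alpha> $ \<beta> = (\<Sum>\<delta>\<in>UNIV. \<Sum>\<gamma>\<in>UNIV. J \<gamma> \<alpha> * cnj (J \<delta> \<beta>) * g c' x $ \<gamma> $ \<delta>)" for \<alpha> \<beta>
      by (simp add: matrix_matrix_mult_def transpose_def M_def M'_def sum_distrib_left sum_distrib_right mult_ac)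
    also have "\<dots> \<alpha> \<beta> = g c x $ \<alpha> $ \<beta>" for \<alpha> \<beta> unfolding gt by (rule sum.swap)
    finally show ?thesis by (simp add: vec_eq_iff)
  qed
  have ig: "invertible (g c x)" "invertible (g c' x)"
    using posdef_invertible hermitian_metricD(1)[OF g] A x by blast+
  \<comment> \<open>Invertibility of the Jacobian is read off from the transformation law of the
    nondegenerate metric instead of from the inverse chart change.\<close>
  have "matrix_inv (g c x) ** transpose M ** g c' x ** M' = mat 1"
    using matrix_inv_both(2)[OF ig(1)] gM by (simp add: matrix_mul_assoc)
  then have iM': "invertible M'" using invertible_left_inverse by blast
  have one: "M' ** (matrix_inv (g c x) ** transpose M ** g c' x) = mat 1"
    using \<open>matrix_inv (g c x) ** transpose M ** g c' x ** M' = mat 1\<close> matrix_left_right_inverse by blast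
  have "M' ** matrix_inv (g c x) ** transpose M = M' ** (matrix_inv (g c x) ** transpose M ** g c' x) ** matrix_inv (g c' x)"
    by (simp add: matrix_mul_assoc matrix_inv_cancel(3)[OF ig(2)])
  then have key: "M' ** matrix_inv (g c x) ** transpose M = matrix_inv (g c' x)" by (simp add: one)
  have KM: "K c = transpose M ** K c' ** M'"
  proof -
    have "K c $ \<alpha> $ \<beta> = (transpose M ** K c' ** M') $ \<alpha> $ \<beta>" for \<alpha> \<beta>
    proof -
      have d: "dbar E u c x \<beta> = (\<Sum>\<gamma>\<in>UNIV. cnj (J \<gamma> \<beta>) *s dbar E u c' x \<gamma>)" for \<beta>
        unfolding J_def by (rule dbar_chart_change[OF A E u x])
      have "K c $ \<alpha> $ \<beta> = (\<Sum>\<gamma>\<in>UNIV. \<Sum>\<delta>\<in>UNIV. cnj (J \<gamma> \<beta>) * (J \<delta> \<alpha> * hinner (h x) (dbar E u c' x \<gamma>) (dbar E u c' x \<delta>)))"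
        unfolding K_def vec_lambda_beta d hinner_cdot
        by (simp add: vec.sum vec.scale cdot_sum cdot_smult sum_distrib_left) (subst sum.swap, simp add: mult_ac)
      also have "\<dots> = (transpose M ** K c' ** M') $ \<alpha> $ \<beta>"
        by (simp add: matrix_matrix_mult_def transpose_def M_def M'_def K_def sum_distrib_left sum_distrib_right mult_ac)
      finally show ?thesis .
    qed
    then show ?thesis by (simp add: vec_eq_iff)
  qed
  have "energy g h (dbar E u) c x = trace (matrix_inv (g c x) ** (transpose M ** K c' ** M'))"
    unfolding energy_trace K_def[symmetric] KM ..
  also have "\<dots> = trace ((matrix_inv (g c x) ** transpose M ** K c') ** M')" by (simp add: matrix_mul_assoc)
  also have "\<dots> = trace (M' ** (matrix_inv (g c x) ** transpose M ** K c'))" by (rule trace_mul_sym)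
  also have "\<dots> = trace ((M' ** matrix_inv (g c x) ** transpose M) ** K c')" by (simp add: matrix_mul_assoc)
  also have "\<dots> = energy g h (dbar E u) c' x" unfolding key energy_trace K_def ..
  finally show ?thesis .
qed

lemma energy_nonneg:
  fixes A :: "('x::{t2_space, second_countable_topology}, 'n::finite) cchart set"
  assumes g: "hermitian_metric A g" and c: "c \<in> A" "x \<in> fst c" and h: "hermitian_posdef (h x)"
  shows "Re (energy g h \<eta> c x) \<ge> 0" "Im (energy g h \<eta> c x) = 0" "energy g h \<eta> c x = 0 \<Longrightarrow> \<eta> c x \<beta> = 0"
proof -
  have e: "energy g h \<eta> c x = (\<Sum>\<beta>\<in>UNIV. \<Sum>\<alpha>\<in>UNIV. matrix_inv (g c x) $ \<beta> $ \<alpha> * hinner (h x) (\<eta> c x \<beta>) (\<eta> c x \<alpha>))"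
    unfolding energy_def by (rule sum.swap)
  have G: "gram_factor (matrix_inv (g c x))" by (rule posdef_inv_gram_factor[OF hermitian_metricD(1)[OF g c]])
  note cn = contraction_nonneg[OF G h, of "\<eta> c x"]
  show "Re (energy g h \<eta> c x) \<ge> 0" "Im (energy g h \<eta> c x) = 0" "energy g h \<eta> c x = 0 \<Longrightarrow> \<eta> c x \<beta> = 0"
    unfolding e by (rule cn(1), rule cn(2), rule cn(3))
qed

lemma Ck_on_gram:
  assumes "bundle_metric A E h" "(W, e) \<in> E" "c \<in> A"
  shows "Ck_on k (snd c ` (fst c \<inter> W)) (\<lambda>z. gram e h (chart_inv c z) $ a $ b)"
  using smooth_funD[OF bundle_metricD(2)[OF assms(1,2)] assms(3)] .

lemma Ck_on_cdot:
  assumes "open Z" "\<And>a b. Ck_on k Z (\<lambda>z. M z $ a $ b)" "\<And>a. Ck_on k Z (\<lambda>z. v z $ a)" "\<And>a. Ck_on k Z (\<lambda>z. w z $ a)"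
  shows "Ck_on k Z (\<lambda>z. cdot (M z *v v z) (w z))"
  unfolding cdot_def matrix_vector_mult_def vec_lambda_beta
  by (intro Ck_on_sum Ck_on_mult Ck_on_cnj assms)

lemma Ck_on_metric_inv:
  assumes A: "complex_manifold A" "c \<in> A" and g: "hermitian_metric A g"
  shows "Ck_on k (snd c ` fst c) (\<lambda>z. matrix_inv (g c (chart_inv c z)) $ a $ b)"
proof (rule Ck_on_matrix_inv[OF chart_range_open[OF A]])
  show "Ck_on k (snd c ` fst c) (\<lambda>z. g c (chart_inv c z) $ i $ j)" for i j
    using smooth_funD[OF hermitian_metricD(2)[OF g A(2)] A(2), of k i j] by (simp only: Int_absorb)
  show "invertible (g c (chart_inv c z))" if "z \<in> snd c ` fst c" for z
    by (rule posdef_invertible[OF hermitian_metricD(1)[OF g A(2) chart_inv_apply(2)[OF A that]]])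
qed

lemma dbar_hinner:
  assumes A: "complex_manifold A" "c \<in> A" and E: "holo_bundle A E" and u: "smooth_section A E u"
    and We: "(W, e) \<in> E" and z: "z \<in> snd c ` (fst c \<inter> W)"
  shows "hinner (h (chart_inv c z)) (dbar E u c (chart_inv c z) \<beta>) (dbar E u c (chart_inv c z) \<alpha>)
    = cdot (gram e h (chart_inv c z) *v vwirt_bar \<beta> (coords e u c) z) (vwirt_bar \<alpha> (coords e u c) z)"
proof -
  have zz: "z \<in> snd c ` fst c" using z by blast
  have x: "chart_inv c z \<in> W" "chart_inv c z \<in> fst c" and pz: "snd c (chart_inv c z) = z"
    using z chart_inv_apply(1)[OF A] chart_inv_apply(2,3)[OF A zz] by auto
  show ?thesis
    unfolding dbar_frame[OF A E u We x] pz gram_def by (rule hinner_gram)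
qed

lemma energy_continuous:
  fixes A :: "('x::{t2_space, second_countable_topology}, 'n::finite) cchart set"
  assumes A: "complex_manifold A" and g: "hermitian_metric A g"
    and E: "holo_bundle A E" and h: "bundle_metric A E h" and u: "smooth_section A E u"
  shows "continuous_on UNIV (\<lambda>x. energy g h (dbar E u) (chart_at A x) x)"
proof (rule continuous_on_frames[OF A E])
  fix c W e assume c: "c \<in> A" and We: "(W, e) \<in> E"
  let ?Z = "snd c ` (fst c \<inter> W)"
  have Z: "open ?Z" by (rule chart_image_open[OF A c holo_bundleD(2)[OF E We]])
  have tb: "Ck_on 0 ?Z (\<lambda>z. vwirt_bar \<beta> (coords e u c) z $ a)" for \<beta> a
    using Ck_on_wirt(2)[OF Z smooth_sectionD[OF u We c, of "Suc 0" a], of \<beta>] by (simp only: vwirt_bar_def vec_lambda_beta)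
  have Pc: "Ck_on 0 ?Z (\<lambda>z. matrix_inv (g c (chart_inv c z)) $ a $ b)" for a b
    by (rule Ck_on_subset[OF Ck_on_metric_inv[OF A c g]]) blast
  have "Ck_on 0 ?Z (\<lambda>z. \<Sum>\<alpha>\<in>UNIV. \<Sum>\<beta>\<in>UNIV. matrix_inv (g c (chart_inv c z)) $ \<beta> $ \<alpha> *
      cdot (gram e h (chart_inv c z) *v vwirt_bar \<beta> (coords e u c) z) (vwirt_bar \<alpha> (coords e u c) z))"
    by (intro Ck_on_sum Ck_on_mult Ck_on_cdot Z tb Pc Ck_on_gram[OF h We c])
  then have cont: "continuous_on ?Z (\<lambda>z. \<Sum>\<alpha>\<in>UNIV. \<Sum>\<beta>\<in>UNIV. matrix_inv (g c (chart_inv c z)) $ \<beta> $ \<alpha> *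
      cdot (gram e h (chart_inv c z) *v vwirt_bar \<beta> (coords e u c) z) (vwirt_bar \<alpha> (coords e u c) z))"
    by (simp only: Ck_on.simps)
  have eq: "energy g h (dbar E u) (chart_at A (chart_inv c z)) (chart_inv c z)
      = (\<Sum>\<alpha>\<in>UNIV. \<Sum>\<beta>\<in>UNIV. matrix_inv (g c (chart_inv c z)) $ \<beta> $ \<alpha> *
      cdot (gram e h (chart_inv c z) *v vwirt_bar \<beta> (coords e u c) z) (vwirt_bar \<alpha> (coords e u c) z))"
    if z: "z \<in> ?Z" for z
  proof -
    have x: "chart_inv c z \<in> fst c" using chart_inv_apply(2)[OF A c] z by blast
    have "energy g h (dbar E u) (chart_at A (chart_inv c z)) (chart_inv c z) = energy g h (dbar E u) c (chart_inv c z)"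
      by (rule energy_chart_independent[OF A chart_at(1)[OF A] c g E u chart_at(2)[OF A] x])
    then show ?thesis by (simp only: energy_def dbar_hinner[OF A c E u We z])
  qed
  show "continuous_on ?Z (\<lambda>z. energy g h (dbar E u) (chart_at A (chart_inv c z)) (chart_inv c z))"
    by (rule continuous_on_cong[THEN iffD2, OF refl eq cont])
qed

text \<open>Taking the section itself as test section makes the integral of its energy 0. The energy
  is continuous and nonnegative, so it vanishes everywhere, and definiteness gives
  \<open>dbar E u\<close> = 0, first in the charts chosen by \<open>chart_at\<close> and then in
  all.\<close>

lemma ker_box_holo:
  fixes A :: "('x::{t2_space, second_countable_topology}, 'n::finite) cchart set"
  assumes A: "complex_manifold A" and g: "hermitian_metric A g" and vol: "volume_measure A g vol"
    and cmp: "compact (UNIV :: 'x set)" and E: "holo_bundle A E" and h: "bundle_metric A E h"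
    and u: "u \<in> ker_box A g vol E h"
  shows "smooth_section A E u"
    and "\<And>W e c a. (W, e) \<in> E \<Longrightarrow> c \<in> A \<Longrightarrow> holo_on (snd c ` (fst c \<inter> W)) (\<lambda>z. coords e u c z $ a)"
proof -
  have bx: "box A g vol E h u (\<lambda>_. 0)" using u unfolding ker_box_def by (rule CollectD)
  show su: "smooth_section A E u" using bx unfolding box_def by (rule conjunct1)
  have "dbar_adjoint A g vol E h (dbar E u) (\<lambda>_. 0)" using bx unfolding box_def by (rule conjunct2)
  then have "L2_inner vol h (\<lambda>_. 0) u = L2_inner_form A g vol h (dbar E u) (dbar E u)"
    unfolding dbar_adjoint_def using su by blast
  moreover have "L2_inner vol h (\<lambda>_. 0) u = 0" by (simp add: L2_inner_def hinner_def)
  ultimately have int: "(LINT x|vol. energy g h (dbar E u) (chart_at A x) x) = 0"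
    by (simp add: L2_inner_form_def energy_def Let_def)
  note pos = energy_nonneg[OF g chart_at[OF A] bundle_metricD(1)[OF h]]
  have "energy g h (dbar E u) (chart_at A x) x = 0" for x
    by (rule integral_zero_imp_zero[OF A g vol cmp energy_continuous[OF A g E h su] pos(1) pos(2) int])
  then have d0: "dbar E u (chart_at A x) x \<beta> = 0" for x \<beta> by (rule pos(3))
  fix W e c a assume We: "(W, e) \<in> E" and c: "c \<in> A"
  show "holo_on (snd c ` (fst c \<inter> W)) (\<lambda>z. coords e u c z $ a)"
    unfolding holo_on_iff
  proof (intro ballI conjI allI)
    fix z \<beta> assume z: "z \<in> snd c ` (fst c \<inter> W)"
    show "(\<lambda>z. coords e u c z $ a) differentiable (at z)"
      using vdiff_coords[OF su We c z] unfolding vdiff_def by blast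
    obtain x where x: "x \<in> fst c" "x \<in> W" "z = snd c x" using z by blast
    have "dbar E u c x \<beta> = 0"
      unfolding dbar_chart_change[OF A c chart_at(1)[OF A] E su x(1) chart_at(2)[OF A]] d0 by simp
    then have "e x *v vwirt_bar \<beta> (coords e u c) z = 0"
      unfolding dbar_frame[OF A c E su We x(2) x(1)] x(3) .
    then have "vwirt_bar \<beta> (coords e u c) z = 0"
      using matrix_inv_left_vec(2)[OF holo_bundleD(3)[OF E We x(2)], of "vwirt_bar \<beta> (coords e u c) z"] by simp
    then show "wirt_bar \<beta> (\<lambda>z. coords e u c z $ a) z = 0" by (simp add: vwirt_bar_def vec_eq_iff)
  qed
qed

lemma hinner_coords:
  assumes A: "complex_manifold A" "c \<in> A" and E: "holo_bundle A E" and We: "(W, e) \<in> E" and z: "z \<in> snd c ` (fst c \<inter> W)"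
  shows "hinner (h (chart_inv c z)) (u (chart_inv c z)) (u (chart_inv c z))
    = hinner (gram e h (chart_inv c z)) (coords e u c z) (coords e u c z)"
proof -
  have x: "chart_inv c z \<in> W" using z chart_inv_apply(1)[OF A] by auto
  have "u (chart_inv c z) = e (chart_inv c z) *v coords e u c z"
    unfolding coords_def by (rule matrix_inv_left_vec(1)[OF holo_bundleD(3)[OF E We x], symmetric])
  then show ?thesis by (simp only: gram_def hinner_congruence)
qed

lemma norm_continuous:
  assumes A: "complex_manifold A" and E: "holo_bundle A E" and h: "bundle_metric A E h" and u: "smooth_section A E u"
  shows "continuous_on UNIV (\<lambda>x. hinner (h x) (u x) (u x))"
proof (rule continuous_on_frames[OF A E])
  fix c W e assume c: "c \<in> A" and We: "(W, e) \<in> E"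
  let ?Z = "snd c ` (fst c \<inter> W)"
  have Z: "open ?Z" by (rule chart_image_open[OF A c holo_bundleD(2)[OF E We]])
  have "Ck_on 0 ?Z (\<lambda>z. cdot (gram e h (chart_inv c z) *v coords e u c z) (coords e u c z))"
    by (intro Ck_on_cdot Z Ck_on_gram[OF h We c] smooth_sectionD[OF u We c])
  then have cont: "continuous_on ?Z (\<lambda>z. hinner (gram e h (chart_inv c z)) (coords e u c z) (coords e u c z))"
    by (simp only: Ck_on.simps hinner_cdot)
  show "continuous_on ?Z (\<lambda>z. hinner (h (chart_inv c z)) (u (chart_inv c z)) (u (chart_inv c z)))"
    by (rule continuous_on_cong[THEN iffD2, OF refl hinner_coords[OF A c E We] cont])
qed

lemma hinner_self:
  assumes "hermitian_posdef h"
  shows "Im (hinner h v v) = 0" "Re (hinner h v v) \<ge> 0" "hinner h v v = 0 \<Longrightarrow> v = 0"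
proof -
  have "hinner h v v = cnj (hinner h v v)" by (rule hinner_commute) (use assms in \<open>simp add: hermitian_posdef_def\<close>)
  then show "Im (hinner h v v) = 0" by (simp add: complex_eq_iff)
  have p: "v \<noteq> 0 \<Longrightarrow> Re (hinner h v v) > 0" using assms by (simp add: hermitian_posdef_def)
  then show "Re (hinner h v v) \<ge> 0" by (cases "v = 0") (simp_all add: hinner_cdot less_imp_le)
  show "hinner h v v = 0 \<Longrightarrow> v = 0" using p by force
qed

section \<open>Holomorphic sections are parallel\<close>

text \<open>Vanishing mean curvature: the Hermite-Einstein condition with constant 0.\<close>

definition flat_contraction ::
  "('x, 'n::finite) cchart set \<Rightarrow> ('x, 'n) metric \<Rightarrow> ('x, 'r::finite) holo_frames \<Rightarrow> ('x \<Rightarrow> complex^'r^'r) \<Rightarrow> bool" where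
  "flat_contraction A g E h \<longleftrightarrow> (\<forall>c\<in>A. \<forall>x\<in>fst c.
     (\<Sum>\<alpha>\<in>UNIV. \<Sum>\<beta>\<in>UNIV. mat (matrix_inv (g c x) $ \<beta> $ \<alpha>) ** chern_curvature c E h \<alpha> \<beta> x) = 0)"

text \<open>The (1,0) part of the Chern covariant derivative in frame coordinates.\<close>

definition cderiv :: "'n \<Rightarrow> (complex^'n \<Rightarrow> complex^'r^'r) \<Rightarrow> (complex^'n \<Rightarrow> complex^'r) \<Rightarrow> complex^'n \<Rightarrow> complex^'r" where
  "cderiv i G t z = theta i G z *v t z + vwirt i t z"

lemma matrix_vector_sum: "(\<Sum>k\<in>K. M k) *v v = (\<Sum>k\<in>K. M k *v (v :: complex^'r))"
  by (induction K rule: infinite_finite_induct) (simp_all add: matrix_vector_mult_add_rdistrib)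

lemma mat_mult_vec: "(mat c ** M) *v v = c *s (M *v (v :: complex^'r) :: complex^'r)"
  by (simp add: matrix_vector_mult_def vec_eq_iff mat_mult_entry sum_distrib_left mult.assoc)

lemma matrix_mult_add: "(D + E) ** F = D ** F + E ** (F :: complex^'k^'l)"
  by (simp add: matrix_matrix_mult_def vec_eq_iff sum.distrib algebra_simps)

text \<open>Contract \<open>bochner\<close> with the inverse metric. The curvature term contains the
  mean curvature, conjugated by \<open>e x\<close> into frame coordinates, which is zero; the
  gradient term is what remains. The transpose puts the indices in the order used by
  \<open>contraction_nonneg\<close>.\<close>

lemma lap_norm:
  fixes A :: "('x::{t2_space, second_countable_topology}, 'n::finite) cchart set"
  assumes A: "complex_manifold A" "c \<in> A" and E: "holo_bundle A E" and h: "bundle_metric A E h"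
    and flat: "flat_contraction A g E h" and We: "(W, e) \<in> E"
    and t: "\<And>a. holo_on (snd c ` (fst c \<inter> W)) (\<lambda>z. t z $ a)" and z: "z \<in> snd c ` (fst c \<inter> W)"
  defines "G \<equiv> \<lambda>z. gram e h (chart_inv c z)"
  defines "P \<equiv> matrix_inv (g c (chart_inv c z))"
  shows "lap P (\<lambda>z. hinner (G z) (t z) (t z)) z
    = (\<Sum>\<alpha>\<in>UNIV. \<Sum>\<beta>\<in>UNIV. transpose P $ \<alpha> $ \<beta> * hinner (G z) (cderiv \<alpha> G t z) (cderiv \<beta> G t z))"
    and "vwirt i (\<lambda>z. G z *v t z) z = G z *v cderiv i G t z"
proof -
  note W = holo_bundleD(2)[OF E We] holo_bundleD(3)[OF E We]
  have G: "smooth_gram (snd c ` (fst c \<inter> W)) G" unfolding G_def by (rule smooth_gram_chart[OF A h We W])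
  have inW: "chart_inv c y \<in> W" "chart_inv c y \<in> fst c" "snd c (chart_inv c y) = y"
    if "y \<in> snd c ` (fst c \<inter> W)" for y
    using that chart_inv_apply(1)[OF A] by auto
  have herm: "cadj (G y) = G y" if "y \<in> snd c ` (fst c \<inter> W)" for y
    using gram_posdef[of h _ e, OF bundle_metricD(1)[OF h] W(2)[OF inW(1)[OF that]]] by (simp add: G_def hermitian_posdef_def)
  note b = bochner[OF G herm t z, folded cderiv_def]
  show "vwirt i (\<lambda>z. G z *v t z) z = G z *v cderiv i G t z" by (rule b(2))
  have b1: "wirt_bar \<beta> (wirt \<alpha> (\<lambda>z. hinner (G z) (t z) (t z))) z
      = hinner (G z) (cderiv \<alpha> G t z) (cderiv \<beta> G t z) - hinner (G z) (curv \<alpha> \<beta> G z *v t z) (t z)" for \<alpha> \<beta>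
    by (rule b(1))
  define x where "x = chart_inv c z"
  have x: "x \<in> W" "x \<in> fst c" "snd c x = z" using inW[OF z] by (simp_all add: x_def)
  have ix: "invertible (e x)" by (rule W(2)[OF x(1)])
  let ?R = "\<Sum>\<alpha>\<in>UNIV. \<Sum>\<beta>\<in>UNIV. mat (P $ \<beta> $ \<alpha>) ** curv \<alpha> \<beta> G z"
  have ch: "chern_curvature c E h \<alpha> \<beta> x = e x ** curv \<alpha> \<beta> G z ** matrix_inv (e x)" for \<alpha> \<beta>
    unfolding chern_curvature_frame[OF A E h We x(1,2)] x(3) G_def ..
  have mc: "mat k ** (e x ** C ** matrix_inv (e x)) = e x ** (mat k ** C) ** matrix_inv (e x)" for k C
  proof -
    have "mat k ** (e x ** C ** matrix_inv (e x)) = (mat k ** e x) ** C ** matrix_inv (e x)" by (simp only: matrix_mul_assoc)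
    also have "\<dots> = (e x ** mat k) ** C ** matrix_inv (e x)" by (simp only: mat_commute)
    finally show ?thesis by (simp only: matrix_mul_assoc)
  qed
  have sm: "(\<Sum>k\<in>K. e x ** M k ** matrix_inv (e x)) = e x ** (\<Sum>k\<in>K. M k) ** matrix_inv (e x)" for K and M :: "'n \<Rightarrow> _"
    by (induction K rule: infinite_finite_induct) (simp_all add: matrix_add_ldistrib matrix_mult_add)
  have "(\<Sum>\<alpha>\<in>UNIV. \<Sum>\<beta>\<in>UNIV. mat (matrix_inv (g c x) $ \<beta> $ \<alpha>) ** chern_curvature c E h \<alpha> \<beta> x) = 0"
    using flat A(2) x(2) unfolding flat_contraction_def by blast
  then have eR: "e x ** ?R ** matrix_inv (e x) = 0"
    by (simp only: ch mc sm P_def x_def[symmetric])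
  have "?R = matrix_inv (e x) ** (e x ** ?R ** matrix_inv (e x)) ** e x"
    by (simp only: matrix_mul_assoc[symmetric] matrix_inv_cancel[OF ix] matrix_inv_both[OF ix] matrix_mul_rid)
  then have R0: "?R = 0" by (simp add: eR)
  have "(\<Sum>\<alpha>\<in>UNIV. \<Sum>\<beta>\<in>UNIV. P $ \<beta> $ \<alpha> * hinner (G z) (curv \<alpha> \<beta> G z *v t z) (t z)) = hinner (G z) (?R *v t z) (t z)"
    by (simp add: matrix_vector_sum mat_mult_vec hinner_cdot vec.sum vec.scale cdot_sum cdot_smult)
  also have "\<dots> = 0" unfolding R0 by (simp add: hinner_cdot)
  finally have z0: "(\<Sum>\<alpha>\<in>UNIV. \<Sum>\<beta>\<in>UNIV. P $ \<beta> $ \<alpha> * hinner (G z) (curv \<alpha> \<beta> G z *v t z) (t z)) = 0" .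
  show "lap P (\<lambda>z. hinner (G z) (t z) (t z)) z
    = (\<Sum>\<alpha>\<in>UNIV. \<Sum>\<beta>\<in>UNIV. transpose P $ \<alpha> $ \<beta> * hinner (G z) (cderiv \<alpha> G t z) (cderiv \<beta> G t z))"
    unfolding lap_def b1 right_diff_distrib sum_subtractf z0 by (simp add: transpose_def)
qed

text \<open>Compactness provides a maximum of |u|^2. The set where it is attained is closed by
  continuity and open by \<open>strong_maximum_principle\<close>, hence everything by
  \<open>conn\<close>. For constant |u|^2 the definite contraction in \<open>lap_norm\<close> is 0,
  so \<open>cderiv\<close> vanishes. The conclusion is phrased for G t, as antiholomorphy, because
  this is the quantity differentiated in \<open>ad_orthogonal\<close>.\<close>

lemma holomorphic_imp_parallel:
  fixes A :: "('x::{t2_space, second_countable_topology}, 'n::finite) cchart set"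
  assumes A: "complex_manifold A" and g: "hermitian_metric A g" and cmp: "compact (UNIV :: 'x set)"
    and conn: "\<And>C :: 'x set. open C \<Longrightarrow> closed C \<Longrightarrow> C = {} \<or> C = UNIV"
    and E: "holo_bundle A E" and h: "bundle_metric A E h" and flat: "flat_contraction A g E h"
    and u: "smooth_section A E u"
    and hol: "\<And>W e c a. (W, e) \<in> E \<Longrightarrow> c \<in> A \<Longrightarrow> holo_on (snd c ` (fst c \<inter> W)) (\<lambda>z. coords e u c z $ a)"
    and We: "(W, e) \<in> E" and c: "c \<in> A" and z: "z \<in> snd c ` (fst c \<inter> W)"
  shows "vwirt i (\<lambda>z. gram e h (chart_inv c z) *v coords e u c z) z = 0"
proof -
  define f where "f x = hinner (h x) (u x) (u x)" for x
  have fc: "continuous_on UNIV (\<lambda>x. Re (f x))"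
    unfolding f_def by (rule continuous_on_Re[OF norm_continuous[OF A E h u]])
  have fim: "Im (f x) = 0" for x unfolding f_def by (rule hinner_self(1)[OF bundle_metricD(1)[OF h]])
  obtain x0 where x0: "\<And>x. Re (f x) \<le> Re (f x0)" using continuous_attains_sup[OF cmp _ fc] by auto
  define M where "M = Re (f x0)"
  have cps: "gram_factor (matrix_inv (g c (chart_inv c z)))" if "c \<in> A" "z \<in> snd c ` (fst c \<inter> W)" for c z W
  proof -
    have "chart_inv c z \<in> fst c" using chart_inv_apply(2)[OF A that(1)] that(2) by blast
    then show ?thesis by (rule posdef_inv_gram_factor[OF hermitian_metricD(1)[OF g that(1)]])
  qed
  have gp: "hermitian_posdef (gram e h (chart_inv c z))" if "(W, e) \<in> E" "c \<in> A" "z \<in> snd c ` (fst c \<inter> W)" for W e c z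
  proof -
    have "chart_inv c z \<in> W" using chart_inv_apply(1)[OF A that(2)] that(3) by auto
    then show ?thesis by (rule gram_posdef[of h _ e, OF bundle_metricD(1)[OF h] holo_bundleD(3)[OF E that(1)]])
  qed
  define T where "T = {x. Re (f x) = M}"
  have "closed T" unfolding T_def by (intro closed_Collect_eq fc continuous_on_const)
  moreover have "open T"
  proof (subst open_subopen, rule ballI)
    fix x assume xT: "x \<in> T"
    obtain c where c: "c \<in> A" "x \<in> fst c" using chart_covers[OF A] by blast
    obtain W e where We: "(W, e) \<in> E" "x \<in> W" using holo_bundleD(1)[OF E] by blast
    let ?Z = "snd c ` (fst c \<inter> W)"
    let ?f = "\<lambda>z. hinner (gram e h (chart_inv c z)) (coords e u c z) (coords e u c z)"
    have Z: "open ?Z" by (rule chart_image_open[OF A c(1) holo_bundleD(2)[OF E We(1)]])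
    have fz: "f (chart_inv c z) = ?f z" if "z \<in> ?Z" for z
      unfolding f_def by (rule hinner_coords[OF A c(1) E We(1) that])
    have "open {z \<in> ?Z. Re (?f z) = M}"
    proof (rule strong_maximum_principle[OF Z, where P = "\<lambda>z. matrix_inv (g c (chart_inv c z))"])
      show "Ck_on 2 ?Z ?f" unfolding hinner_cdot
        by (intro Ck_on_cdot Z Ck_on_gram[OF h We(1) c(1)] smooth_sectionD[OF u We(1) c(1)])
      show "Im (?f z) = 0" if "z \<in> ?Z" for z using fim fz[OF that] by metis
      show "Re (?f z) \<le> M" if "z \<in> ?Z" for z using x0 fz[OF that] unfolding M_def by metis
      show "gram_factor (matrix_inv (g c (chart_inv c z)))" if "z \<in> ?Z" for z by (rule cps[OF c(1) that])
      show "continuous_on ?Z (\<lambda>z. matrix_inv (g c (chart_inv c z)) $ a $ b)" for a b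
        using Ck_on_subset[OF Ck_on_metric_inv[OF A c(1) g, of 0 a b], of ?Z] by auto
      show "0 \<le> Re (lap (matrix_inv (g c (chart_inv c z))) ?f z)" if "z \<in> ?Z" for z
        unfolding lap_norm(1)[OF A c(1) E h flat We(1) hol[OF We(1) c(1)] that]
        by (rule contraction_nonneg(1)[OF gram_factor_transpose[OF cps[OF c(1) that]] gp[OF We(1) c(1) that]])
    qed
    then have "open (fst c \<inter> snd c -` {z \<in> ?Z. Re (?f z) = M})"
      by (rule continuous_open_preimage[OF chart_cont[OF A c(1)] chart_open[OF A c(1)]])
    moreover have "x \<in> fst c \<inter> snd c -` {z \<in> ?Z. Re (?f z) = M}"
    proof -
      have xz: "snd c x \<in> ?Z" using c We by blast
      moreover have "Re (?f (snd c x)) = M"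
        using fz[OF xz] xT by (simp only: chart_inv_apply(1)[OF A c] T_def mem_Collect_eq)
      ultimately show ?thesis using c by blast
    qed
    moreover have "fst c \<inter> snd c -` {z \<in> ?Z. Re (?f z) = M} \<subseteq> T"
    proof
      fix y assume y: "y \<in> fst c \<inter> snd c -` {z \<in> ?Z. Re (?f z) = M}"
      then have "f (chart_inv c (snd c y)) = ?f (snd c y)" by (intro fz) blast
      then show "y \<in> T" using y chart_inv_apply(1)[OF A c(1), of y] by (simp add: T_def)
    qed
    ultimately show "\<exists>V. open V \<and> x \<in> V \<and> V \<subseteq> T" by blast
  qed
  moreover have "x0 \<in> T" by (simp add: T_def M_def)
  ultimately have "T = UNIV" using conn[of T] by blast
  then have fM: "f x = of_real M" for x using fim[of x] by (auto simp: T_def complex_eq_iff)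
  let ?Z = "snd c ` (fst c \<inter> W)"
  let ?f = "\<lambda>z. hinner (gram e h (chart_inv c z)) (coords e u c z) (coords e u c z)"
  have Z: "open ?Z" by (rule chart_image_open[OF A c holo_bundleD(2)[OF E We]])
  have fz: "?f y = of_real M" if "y \<in> ?Z" for y
    using hinner_coords[OF A c E We that, of h u] fM[of "chart_inv c y"] by (simp only: f_def)
  have w0: "wirt \<alpha> ?f y = 0" if "y \<in> ?Z" for \<alpha> y
  proof -
    have "wirt \<alpha> ?f y = wirt \<alpha> (\<lambda>y. of_real M) y" by (rule wirt_cong(1)[OF Z that fz])
    then show ?thesis by simp
  qed
  have "wirt_bar \<beta> (wirt \<alpha> ?f) z = 0" for \<alpha> \<beta>
  proof -
    have "wirt_bar \<beta> (wirt \<alpha> ?f) z = wirt_bar \<beta> (\<lambda>y. 0) z" by (rule wirt_cong(2)[OF Z z w0])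
    then show ?thesis by simp
  qed
  then have l0: "lap (matrix_inv (g c (chart_inv c z))) ?f z = 0" by (simp add: lap_def)
  have "cderiv i (\<lambda>z. gram e h (chart_inv c z)) (coords e u c) z = 0"
    by (rule contraction_nonneg(3)[OF gram_factor_transpose[OF cps[OF c z]] gp[OF We c z]])
      (use l0[unfolded lap_norm(1)[OF A c E h flat We hol[OF We c] z]] in simp)
  then show ?thesis unfolding lap_norm(2)[OF A c E h flat We hol[OF We c] z] by simp
qed

lemma matrix_mult_zero: "M ** 0 = (0 :: complex^'n^'m)" "(0 :: complex^'l^'m) ** N = 0"
  by (simp_all add: matrix_matrix_mult_def vec_eq_iff)

text \<open>A clopen set \<open>C\<close> gives the holomorphic endomorphism that is \<open>id\<close> on \<open>C\<close> and 0 elsewhere.\<close>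

lemma clopen_trivial:
  fixes A :: "('x::{t2_space, second_countable_topology}, 'n::finite) cchart set"
    and E :: "('x, 'r::finite) holo_frames"
  assumes A: "complex_manifold A" and E: "holo_bundle A E" and s: "simple_bundle A E"
    and C: "open (C :: 'x set)" "closed C"
  shows "C = {} \<or> C = UNIV"
proof -
  define u :: "'x \<Rightarrow> complex^'r^'r" where "u x = (if x \<in> C then mat 1 else 0)" for x
  have "holo_section A (End_bundle E) (\<lambda>x. vec_of_mat (u x))"
    unfolding holo_section_def case_prod_beta
  proof (intro ballI allI)
    fix Wf a assume "Wf \<in> End_bundle E"
    obtain W f where Wf: "Wf = (W, f)" by (cases Wf)
    obtain e where e: "(W, e) \<in> E" "f = (\<lambda>p. End_frame (e p))"
      using \<open>Wf \<in> End_bundle E\<close> unfolding Wf by (rule End_bundleE)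
    have val: "(matrix_inv (f p) *v vec_of_mat (u p)) $ a = (if p \<in> C then vec_of_mat (mat 1) $ a else 0)" if "p \<in> W" for p
    proof -
      have i: "invertible (e p)" by (rule holo_bundleD(3)[OF E e(1) that])
      show ?thesis unfolding e(2) End_frame_inv[OF i] sandwich_vec u_def
        by (simp add: matrix_inv_both[OF i] matrix_mult_zero)
    qed
    have o: "open W" by (rule holo_bundleD(2)[OF E e(1)])
    have "holo_fun A W (\<lambda>p. if p \<in> C then vec_of_mat (mat 1) $ a else 0)"
    proof (rule holo_funI)
      fix c assume c: "c \<in> A"
      let ?g = "\<lambda>z. if chart_inv c z \<in> C then vec_of_mat (mat 1) $ a else 0"
      let ?Y1 = "snd c ` (fst c \<inter> (W \<inter> C))" and ?Y2 = "snd c ` (fst c \<inter> (W \<inter> - C))"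
      have 1: "holo_on ?Y1 ?g"
        by (subst holo_on_cong_open[OF chart_image_open[OF A c open_Int[OF o C(1)]], where g = "\<lambda>z. vec_of_mat (mat 1) $ a"])
          (auto simp: chart_inv_apply(1)[OF A c])
      have 2: "holo_on ?Y2 ?g"
        by (subst holo_on_cong_open[OF chart_image_open[OF A c open_Int[OF o open_Compl[OF C(2)]]], where g = "\<lambda>z. 0"])
          (auto simp: chart_inv_apply(1)[OF A c])
      have "snd c ` (fst c \<inter> W) = ?Y1 \<union> ?Y2" by blast
      with 1 2 show "holo_on (snd c ` (fst c \<inter> W)) ?g" unfolding holo_on_def by blast
    qed
    from holo_fun_cong[OF A o val this]
    show "holo_fun A (fst Wf) (\<lambda>p. (matrix_inv (snd Wf p) *v vec_of_mat (u p)) $ a)" by (simp add: Wf)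
  qed
  then obtain k where k: "\<And>x. u x = mat k" using s unfolding simple_bundle_def by blast
  have "mat k $ i $ i = k" "(mat 1 :: complex^'r^'r) $ i $ i = 1" for i :: 'r by (simp_all add: mat_def)
  then have "(mat 1 :: complex^'r^'r) \<noteq> 0" by (metis zero_index zero_neq_one)
  then have "x \<in> C \<longleftrightarrow> y \<in> C" for x y using k[of x] k[of y] unfolding u_def by (metis (full_types))
  then show ?thesis by blast
qed

section \<open>Orthogonality to the image of ad\<close>

lemma munit_decomp: "M = (\<Sum>a\<in>UNIV. \<Sum>b\<in>UNIV. mat (M $ a $ b) ** munit a b)"
proof -
  have "(\<Sum>a\<in>UNIV. \<Sum>b\<in>UNIV. mat (M $ a $ b) ** munit a b) $ i $ j = M $ i $ j" for i j
  proof -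
    have "(\<Sum>a\<in>UNIV. \<Sum>b\<in>UNIV. mat (M $ a $ b) ** munit a b) $ i $ j
        = (\<Sum>a\<in>UNIV. \<Sum>b\<in>UNIV. if a = i \<and> b = j then M $ i $ j else 0)"
      unfolding sum_component mat_mult_entry by (intro sum.cong refl) (auto simp: munit_def)
    also have "\<dots> = (\<Sum>a\<in>UNIV. if a = i then M $ i $ j else 0)"
      by (intro sum.cong refl) auto
    finally show ?thesis by simp
  qed
  then show ?thesis by (simp add: vec_eq_iff)
qed

lemma vec_of_mat_sum: "vec_of_mat (\<Sum>k\<in>K. M k) = (\<Sum>k\<in>K. vec_of_mat (M k))"
  by (simp add: vec_of_mat_def vec_eq_iff)

lemma vec_of_mat_smult: "vec_of_mat (mat c ** M) = c *s vec_of_mat M"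
  by (simp add: vec_of_mat_def vec_eq_iff mat_mult_entry)

lemma hinner_sum_left: "hinner h (\<Sum>k\<in>K. v k) w = (\<Sum>k\<in>K. hinner h (v k) w)"
  by (simp add: hinner_cdot vec.sum cdot_sum)

lemma hinner_smult_left: "hinner h (c *s v) w = c * hinner h v w"
  by (simp add: hinner_cdot vec.scale cdot_smult)

text \<open>The functional taking M to the pairing of ad(M) with u is represented under the trace
  form by a matrix \<sigma>. Antiholomorphy of G t makes \<sigma> a holomorphic endomorphism,
  simplicity makes it scalar, and its trace is the value of the functional at the identity, whose
  commutators vanish.\<close>

lemma ad_orthogonal:
  fixes A :: "('x::{t2_space, second_countable_topology}, 'n::finite) cchart set"
    and E :: "('x, 'r::finite) holo_frames"
  assumes A: "complex_manifold A" and g: "hermitian_metric A g" and vol: "volume_measure A g vol"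
    and cmp: "compact (UNIV :: 'x set)" and E: "holo_bundle A E" and h: "bundle_metric A E h"
    and s: "simple_bundle A E" and he: "hermite_einstein A g E h"
    and u: "u \<in> ker_box A g vol (End_bundle (End_bundle E)) (End_metric (End_metric h))"
  shows "hinner (End_metric (End_metric h) x) (vec_of_mat (ad M)) (u x) = 0"
proof -
  let ?E1 = "End_bundle E" and ?h1 = "End_metric h"
  let ?E2 = "End_bundle ?E1" and ?h2 = "End_metric ?h1"
  have E1: "holo_bundle A ?E1" by (rule holo_bundle_End[OF A E])
  have E2: "holo_bundle A ?E2" by (rule holo_bundle_End[OF A E1])
  have h1: "bundle_metric A ?E1 ?h1" by (rule bundle_metric_End[OF A h]) (use holo_bundleD(2,3)[OF E] in blast)+
  have h2: "bundle_metric A ?E2 ?h2" by (rule bundle_metric_End[OF A h1]) (use holo_bundleD(2,3)[OF E1] in blast)+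
  obtain \<kappa> where \<kappa>: "\<And>c x. c \<in> A \<Longrightarrow> x \<in> fst c \<Longrightarrow>
     (\<Sum>\<alpha>\<in>UNIV. \<Sum>\<beta>\<in>UNIV. mat (matrix_inv (g c x) $ \<beta> $ \<alpha>) ** chern_curvature c E h \<alpha> \<beta> x) = mat \<kappa>"
    using he unfolding hermite_einstein_def by blast
  have he1: "(\<Sum>\<alpha>\<in>UNIV. \<Sum>\<beta>\<in>UNIV. mat (matrix_inv (g c x) $ \<beta> $ \<alpha>) ** chern_curvature c ?E1 ?h1 \<alpha> \<beta> x) = mat 0"
    if "c \<in> A" "x \<in> fst c" for c x by (rule hermite_einstein_End[OF A E h \<kappa> that])
  have flat: "flat_contraction A g ?E2 ?h2"
    unfolding flat_contraction_def using hermite_einstein_End[OF A E1 h1 he1] by (simp add: mat_0)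
  have su: "smooth_section A ?E2 u" by (rule ker_box_holo(1)[OF A g vol cmp E2 h2 u])
  have conn: "C = {} \<or> C = UNIV" if "open C" "closed C" for C :: "'x set"
    by (rule clopen_trivial[OF A E s that])
  have hol: "holo_on (snd c ` (fst c \<inter> W)) (\<lambda>z. coords e u c z $ a)"
    if "(W, e) \<in> ?E2" "c \<in> A" for W e c a
    by (rule ker_box_holo(2)[OF A g vol cmp E2 h2 u that])
  have par: "vwirt i (\<lambda>z. gram e ?h2 (chart_inv c z) *v coords e u c z) z = 0"
    if "(W, e) \<in> ?E2" "c \<in> A" "z \<in> snd c ` (fst c \<inter> W)" for W e c z i
    by (rule holomorphic_imp_parallel[OF A g cmp conn E2 h2 flat su hol that])
  \<comment> \<open>The indices are transposed relative to \<open>munit a b\<close> so that the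
    functional becomes the trace of M times \<sigma>.\<close>
  define \<sigma> :: "'x \<Rightarrow> complex^'r^'r" where
    "\<sigma> x = (\<chi> b a. hinner (?h2 x) (vec_of_mat (ad (munit a b))) (u x))" for x
  have tr: "hinner (?h2 x) (vec_of_mat (ad M)) (u x) = trace (M ** \<sigma> x)" for M x
  proof -
    have "hinner (?h2 x) (vec_of_mat (ad M)) (u x)
       = hinner (?h2 x) (vec_of_mat (ad (\<Sum>a\<in>UNIV. \<Sum>b\<in>UNIV. mat (M $ a $ b) ** munit a b))) (u x)"
      by (rule arg_cong[OF munit_decomp[of M]])
    also have "\<dots> = (\<Sum>a\<in>UNIV. \<Sum>b\<in>UNIV. M $ a $ b * \<sigma> x $ b $ a)"
      by (simp only: ad_sum ad_mat_mult vec_of_mat_sum vec_of_mat_smult hinner_sum_left hinner_smult_left \<sigma>_def vec_lambda_beta)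
    also have "\<dots> = trace (M ** \<sigma> x)" by (simp add: trace_def matrix_matrix_mult_def)
    finally show ?thesis .
  qed
  have "holo_section A ?E1 (\<lambda>x. vec_of_mat (\<sigma> x))"
    unfolding holo_section_def case_prod_beta
  proof (intro ballI allI)
    fix Wf and I :: "'r \<times> 'r" assume "Wf \<in> ?E1"
    obtain W f where Wf: "Wf = (W, f)" by (cases Wf)
    obtain e where e: "(W, e) \<in> E" "f = (\<lambda>p. End_frame (e p))"
      using \<open>Wf \<in> ?E1\<close> unfolding Wf by (rule End_bundleE)
    have e2: "(W, \<lambda>p. End_frame (End_frame (e p))) \<in> ?E2" by (rule End_bundleI[OF End_bundleI[OF e(1)]])
    let ?e2 = "\<lambda>p. End_frame (End_frame (e p))"
    obtain b a :: 'r where I: "I = (b, a)" by (cases I)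
    define v where "v = vec_of_mat (ad (munit a b) :: complex^('r \<times> 'r)^('r \<times> 'r))"
    \<comment> \<open>An entry of \<sigma> in the frame is a trace against an elementary matrix.
      Cyclicity moves the frame onto that matrix, \<open>ad_conj\<close> turns this into the frame
      of End(End(E)) acting on the constant vector \<open>v\<close>, and hermitian symmetry shifts
      the Gram matrix to the second slot.\<close>
    have val: "(matrix_inv (f p) *v vec_of_mat (\<sigma> p)) $ I = cdot v (gram ?e2 ?h2 p *v (matrix_inv (?e2 p) *v u p))" if p: "p \<in> W" for p
    proof -
      have i: "invertible (e p)" by (rule holo_bundleD(3)[OF E e(1) p])
      have i1: "invertible (End_frame (e p))" by (rule invertible_End_frame[OF i])
      have i2: "invertible (?e2 p)" by (rule invertible_End_frame[OF i1])
      have "(matrix_inv (f p) *v vec_of_mat (\<sigma> p)) $ I = (matrix_inv (e p) ** \<sigma> p ** e p) $ b $ a"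
        unfolding e(2) End_frame_inv[OF i] sandwich_vec by (simp add: vec_of_mat_def I)
      also have "\<dots> = trace (munit a b ** (matrix_inv (e p) ** \<sigma> p ** e p))" by (rule trace_munit[symmetric])
      also have "\<dots> = trace ((munit a b ** matrix_inv (e p) ** \<sigma> p) ** e p)" by (simp only: matrix_mul_assoc)
      also have "\<dots> = trace (e p ** (munit a b ** matrix_inv (e p) ** \<sigma> p))" by (rule trace_mul_sym)
      also have "\<dots> = trace ((e p ** munit a b ** matrix_inv (e p)) ** \<sigma> p)" by (simp only: matrix_mul_assoc)
      also have "\<dots> = hinner (?h2 p) (vec_of_mat (ad (e p ** munit a b ** matrix_inv (e p)))) (u p)" by (rule tr[symmetric])
      also have "vec_of_mat (ad (e p ** munit a b ** matrix_inv (e p))) = ?e2 p *v v"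
        unfolding ad_conj[OF i, symmetric] v_def End_frame_def[of "End_frame (e p)"] sandwich_vec ..
      also have "u p = ?e2 p *v (matrix_inv (?e2 p) *v u p)" by (rule matrix_inv_left_vec(1)[OF i2, symmetric])
      also have "hinner (?h2 p) (?e2 p *v v) (?e2 p *v (matrix_inv (?e2 p) *v u p))
          = cdot (gram ?e2 ?h2 p *v v) (matrix_inv (?e2 p) *v u p)"
        unfolding gram_def by (rule hinner_gram)
      also have "\<dots> = cdot v (cadj (gram ?e2 ?h2 p) *v (matrix_inv (?e2 p) *v u p))" by (rule cdot_cadj)
      also have "cadj (gram ?e2 ?h2 p) = gram ?e2 ?h2 p"
        using gram_posdef[of ?h2 p ?e2, OF bundle_metricD(1)[OF h2] i2] by (simp add: hermitian_posdef_def)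
      finally show ?thesis .
    qed
    have "holo_fun A W (\<lambda>p. cdot v (gram ?e2 ?h2 p *v (matrix_inv (?e2 p) *v u p)))"
    proof (rule holo_funI)
      fix c assume c: "c \<in> A"
      let ?Z = "snd c ` (fst c \<inter> W)"
      let ?q = "\<lambda>z. gram ?e2 ?h2 (chart_inv c z) *v coords ?e2 u c z"
      have sg: "smooth_gram ?Z (\<lambda>z. gram ?e2 ?h2 (chart_inv c z))"
        by (rule smooth_gram_chart[OF A c h2 e2 holo_bundleD(2)[OF E2 e2] holo_bundleD(3)[OF E2 e2]])
      have "holo_on ?Z (\<lambda>z. cdot v (?q z))"
        unfolding holo_on_iff
      proof (intro ballI conjI allI)
        fix z i assume z: "z \<in> ?Z"
        have qd: "vdiff ?q z" by (rule vwirt_mult(3)[OF smooth_gram_facts(3)[OF sg z] vdiff_coords[OF su e2 c z]])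
        have vd: "vdiff (\<lambda>z. v) z" by (simp add: vdiff_def)
        show "(\<lambda>z. cdot v (?q z)) differentiable (at z)"
          unfolding cdot_def
          by (intro differentiable_sum_fun differentiable_mult differentiable_const differentiable_cnj)
            (use qd in \<open>simp only: vdiff_def\<close>)
        \<comment> \<open>The second slot of \<open>cdot\<close> is conjugated, so the conjugate
          derivative of the pairing involves the holomorphic derivative of G t, which vanishes by
          parallelism.\<close>
        have "vwirt_bar i (\<lambda>z. v) z = 0" by (simp add: vwirt_bar_def vec_eq_iff)
        moreover have "vwirt i ?q z = 0" by (rule par[OF e2 c z])
        ultimately show "wirt_bar i (\<lambda>z. cdot v (?q z)) z = 0"
          using wirt_cdot(2)[OF vd qd, of i] by simp
      qed
      then show "holo_on ?Z (\<lambda>z. cdot v (gram ?e2 ?h2 (chart_inv c z) *v (matrix_inv (?e2 (chart_inv c z)) *v u (chart_inv c z))))"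
        by (simp only: coords_def)
    qed
    from holo_fun_cong[OF A holo_bundleD(2)[OF E e(1)] val this]
    show "holo_fun A (fst Wf) (\<lambda>p. (matrix_inv (snd Wf p) *v vec_of_mat (\<sigma> p)) $ I)" by (simp add: Wf)
  qed
  then obtain k where k: "\<And>x. \<sigma> x = mat k" using s unfolding simple_bundle_def by blast
  have "trace (mat 1 ** \<sigma> x) = 0" unfolding tr[symmetric] ad_mat by (simp add: hinner_cdot)
  then have "trace (mat k :: complex^'r^'r) = 0" by (simp only: k matrix_mul_lid)
  then have "k = 0" by (simp add: trace_def mat_def)
  then show ?thesis by (simp add: tr k mat_0 matrix_mult_zero trace_def)
qed

section \<open>The harmonic projection\<close>

lemma zero_in_ker_box:
  fixes A :: "('x, 'n::finite) cchart set" and E :: "('x, 'r::finite) holo_frames"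
  shows "(\<lambda>_. 0) \<in> ker_box A g vol E h"
proof -
  have sm: "smooth_section A E (\<lambda>_. 0)"
    unfolding smooth_section_def case_prod_beta by (intro ballI allI smooth_funI) simp
  have "dbar E (\<lambda>_. 0) c x \<beta> = 0" for c :: "('x, 'n) cchart" and x \<beta>
    by (simp add: dbar_def Let_def vec_eq_iff matrix_vector_mult_def)
  then show ?thesis
    using sm by (simp add: ker_box_def box_def dbar_adjoint_def L2_inner_def L2_inner_form_def hinner_cdot Let_def)
qed

text \<open>The projection is a definite description, so uniqueness must be shown as well: a
  candidate u, tested against itself, has the integral of |u|^2 equal to 0 because its pairing with
  \<rho> vanishes pointwise, and continuity gives u = 0.\<close>

lemma harmonic_projection_zero:
  fixes A :: "('x::{t2_space, second_countable_topology}, 'n::finite) cchart set"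
  assumes A: "complex_manifold A" and g: "hermitian_metric A g" and vol: "volume_measure A g vol"
    and cmp: "compact (UNIV :: 'x set)" and E: "holo_bundle A E" and h: "bundle_metric A E h"
    and orth: "\<And>u x. u \<in> ker_box A g vol E h \<Longrightarrow> hinner (h x) (\<rho> x) (u x) = 0"
  shows "harmonic_projection A g vol E h \<rho> = (\<lambda>x. 0)"
  unfolding harmonic_projection_def
proof (rule the_equality)
  show "(\<lambda>x. 0) \<in> ker_box A g vol E h \<and> (\<forall>w\<in>ker_box A g vol E h. L2_inner vol h (\<lambda>x. \<rho> x - 0) w = 0)"
    using zero_in_ker_box orth by (simp add: L2_inner_def)
  fix u assume u: "u \<in> ker_box A g vol E h \<and> (\<forall>w\<in>ker_box A g vol E h. L2_inner vol h (\<lambda>x. \<rho> x - u x) w = 0)"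
  then have uk: "u \<in> ker_box A g vol E h" by blast
  have "hinner (h x) (\<rho> x - u x) (u x) = - hinner (h x) (u x) (u x)" for x
  proof -
    have "hinner (h x) (\<rho> x - u x) (u x) = hinner (h x) (\<rho> x) (u x) - hinner (h x) (u x) (u x)"
      by (simp add: hinner_def algebra_simps sum_subtractf)
    then show ?thesis by (simp add: orth[OF uk])
  qed
  then have int: "(LINT x|vol. hinner (h x) (u x) (u x)) = 0" using u uk by (auto simp: L2_inner_def)
  note hs = hinner_self[OF bundle_metricD(1)[OF h]]
  have "hinner (h x) (u x) (u x) = 0" for x
    by (rule integral_zero_imp_zero[OF A g vol cmp
        norm_continuous[OF A E h ker_box_holo(1)[OF A g vol cmp E h uk]] hs(2) hs(1) int])
  then show "u = (\<lambda>x. 0)" using hs(3) by blast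
qed

text \<open>The coordinates \<open>d\<close> need not belong to \<open>B\<close>, so the atlas is enlarged first.\<close>

lemma rho_End_ad:
  assumes A: "complex_manifold A" and B: "complex_manifold B" and d: "d \<in> coordinates B" "s \<in> fst d"
    and F: "holo_bundle (prod_atlas A B) F" and h: "bundle_metric (prod_atlas A B) F h"
  shows "\<exists>M. rho A d (End_bundle F) (End_metric h) k l s x = ad M"
proof -
  have B': "complex_manifold (insert d B)" using d(1) unfolding coordinates_def by (rule CollectD)
  have sub: "prod_atlas A B \<subseteq> prod_atlas A (insert d B)" unfolding prod_atlas_def by blast
  note P = complex_manifold_prod[OF A B] and P' = complex_manifold_prod[OF A B']
  have "smooth_fun (prod_atlas A (insert d B)) (fst We) (\<lambda>p. gram (snd We) h p $ a $ b)" if We: "We \<in> F" for We a b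
  proof -
    have We': "(fst We, snd We) \<in> F" using We by simp
    show ?thesis
      by (rule smooth_fun_mono_atlas[OF P' P sub holo_bundleD(2)[OF F We'] bundle_metricD(2)[OF h We']])
  qed
  then have h': "bundle_metric (prod_atlas A (insert d B)) F h"
    unfolding bundle_metric_def case_prod_beta using bundle_metricD(1)[OF h] by blast
  have c: "prod_chart (chart_at A x) d \<in> prod_atlas A (insert d B)"
    by (rule prod_chart_in[OF chart_at(1)[OF A] insertI1])
  have p: "(x, s) \<in> fst (prod_chart (chart_at A x) d)" using chart_at(2)[OF A] d(2) by simp
  show ?thesis unfolding rho_def
    by (rule chern_curvature_End_ad[OF P' c h' F p holo_bundle_End[OF P F]])
qed

theorem proposition3:
  fixes A :: "('x::{t2_space, second_countable_topology}, 'n::finite) cchart set"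
    and B :: "('s::{t2_space, second_countable_topology}, 'm::finite) cchart set"
    and g :: "('x, 'n) metric"
    and vol :: "'x measure"
    and F :: "('x \<times> 's, 'r::finite) holo_frames"
    and h :: "'x \<times> 's \<Rightarrow> complex^'r^'r"
  assumes "complex_manifold A" and "compact (UNIV :: 'x set)" and "kaehler_metric A g"
    and "volume_measure A g vol"
    and "complex_manifold B"
    and "holo_bundle (prod_atlas A B) F" and "bundle_metric (prod_atlas A B) F h"
    and "\<And>s. simple_bundle A (restr_bundle F s)"
    and "\<And>s. hermite_einstein A g (restr_bundle F s) (restr_metric h s)"
  shows "\<forall>d\<in>coordinates B. \<forall>s\<in>fst d. \<forall>k l.
    harmonic_projection A g vol
      (End_bundle (End_bundle (restr_bundle F s)))
      (End_metric (End_metric (restr_metric h s)))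
      (\<lambda>x. vec_of_mat (rho A d (End_bundle F) (End_metric h) k l s x))
    = (\<lambda>x. 0)"
proof (intro ballI allI)
  fix d s k l assume d: "d \<in> coordinates B" and s: "s \<in> fst d"
  note A = assms(1) and cmp = assms(2) and vol = assms(4) and B = assms(5) and F = assms(6) and h = assms(7)
  have g: "hermitian_metric A g" using assms(3) unfolding kaehler_metric_def by (rule conjunct1)
  let ?E = "restr_bundle F s" and ?h = "restr_metric h s"
  have E: "holo_bundle A ?E" by (rule holo_bundle_slice[OF A B F])
  have hs: "bundle_metric A ?E ?h" by (rule bundle_metric_slice[OF A B F h])
  have E1: "holo_bundle A (End_bundle ?E)" by (rule holo_bundle_End[OF A E])
  have h1: "bundle_metric A (End_bundle ?E) (End_metric ?h)"
    by (rule bundle_metric_End[OF A hs]) (use holo_bundleD(2,3)[OF E] in blast)+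
  have h2: "bundle_metric A (End_bundle (End_bundle ?E)) (End_metric (End_metric ?h))"
    by (rule bundle_metric_End[OF A h1]) (use holo_bundleD(2,3)[OF E1] in blast)+
  show "harmonic_projection A g vol (End_bundle (End_bundle ?E)) (End_metric (End_metric ?h))
      (\<lambda>x. vec_of_mat (rho A d (End_bundle F) (End_metric h) k l s x)) = (\<lambda>x. 0)"
  proof (rule harmonic_projection_zero[OF A g vol cmp holo_bundle_End[OF A E1] h2])
    fix u x assume u: "u \<in> ker_box A g vol (End_bundle (End_bundle ?E)) (End_metric (End_metric ?h))"
    \<comment> \<open>\<open>M\<close> is obtained separately at each x, with no regularity in x;
      \<open>ad_orthogonal\<close> holds for every matrix at every point, so this suffices.\<close>
    obtain M where M: "rho A d (End_bundle F) (End_metric h) k l s x = ad M"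
      using rho_End_ad[OF A B d s F h] by blast
    show "hinner (End_metric (End_metric ?h) x) (vec_of_mat (rho A d (End_bundle F) (End_metric h) k l s x)) (u x) = 0"
      unfolding M by (rule ad_orthogonal[OF A g vol cmp E hs assms(8,9) u])
  qed
qed

end
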